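(* Let $S(X)$ denote the number of distinct biquadratic extensions $K/\mathbb{Q}$ such that $\Delta_K \leq X$. Then, as $X \to \infty$, $$S(X) = \frac{23}{960} \sqrt{X}\, (\log X)^2 \prod_p \left( 1- \frac{1}{p}\right)^3\left(1+\frac{3}{p}\right)+O\left(\sqrt{X} \log X\right),$$ where the product runs over all primes $p$.
   Context: A biquadratic extension of $\mathbb{Q}$ is a Galois extension $K/\mathbb{Q}$ with Galois group isomorphic to $(\mathbb{Z}/2\mathbb{Z})^2$, i.e. a degree $4$ field $K=\mathbb{Q}(\sqrt{a},\sqrt{b})$ with $a,b\in\mathbb{Z}$. Fields are counted as subfields of a fixed algebraic closure of $\mathbb{Q}$. $\Delta_K$ denotes the discriminant of $K$ (it is positive for every biquadratic $K$). *)

theory Defs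
  imports
    "HOL-Analysis.Infinite_Products"
    "HOL-Library.Landau_Symbols"
    "HOL-Algebra.Elementary_Groups"
    "HOL-Algebra.Bij"
    "HOL-Algebra.Embedded_Algebras"
    "HOL-Algebra.Algebraic_Closure_Type"
    "Jordan_Normal_Form.Determinant"
begin

hide_const (open) Divisibility.prime

text \<open>
  Number fields are subfields of the complex numbers that are finite-dimensional over the
  rationals. Such a field consists of algebraic numbers, so these are precisely the number fields
  inside one fixed algebraic closure of the rationals, namely the set of algebraic complex numbers.
\<close>

abbreviation complex_ring :: "complex ring" where
  "complex_ring \<equiv> ring_of_type_algebra"

abbreviation as_ring :: "complex set \<Rightarrow> complex ring" where
  "as_ring K \<equiv> complex_ring\<lparr>carrier := K\<rparr>"

definition number_field :: "complex set \<Rightarrow> bool" where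
  "number_field K \<longleftrightarrow>
     subfield K complex_ring \<and> ring.finite_dimension complex_ring \<rat> K"

text \<open>As in \<^const>\<open>BijGroup\<close>, maps on \<open>K\<close> are extensional, so that distinct elements of
  the carriers below are distinct as maps on \<open>K\<close>.\<close>

definition galois_group :: "complex set \<Rightarrow> (complex \<Rightarrow> complex) monoid" where
  "galois_group K = (BijGroup K)
     \<lparr>carrier := {\<sigma> \<in> Bij K. \<sigma> \<in> Ring.ring_hom (as_ring K) (as_ring K) \<and> (\<forall>q\<in>\<rat>. \<sigma> q = q)}\<rparr>"

definition galois_over_rat :: "complex set \<Rightarrow> bool" where
  "galois_over_rat K \<longleftrightarrow>
     number_field K \<and> {x \<in> K. \<forall>\<sigma>\<in>carrier (galois_group K). \<sigma> x = x} = \<rat>"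

definition biquadratic :: "complex set \<Rightarrow> bool" where
  "biquadratic K \<longleftrightarrow>
     galois_over_rat K \<and> galois_group K \<cong> integer_mod_group 2 \<times>\<times> integer_mod_group 2"

definition embeddings :: "complex set \<Rightarrow> (complex \<Rightarrow> complex) set" where
  "embeddings K = Ring.ring_hom (as_ring K) complex_ring \<inter> extensional K"

definition field_trace :: "complex set \<Rightarrow> complex \<Rightarrow> complex" where
  "field_trace K x = (\<Sum>\<sigma>\<in>embeddings K. \<sigma> x)"

definition ring_of_integers :: "complex set \<Rightarrow> complex set" where
  "ring_of_integers K = {x \<in> K. algebraic_int x}"

definition integral_basis :: "complex set \<Rightarrow> complex list \<Rightarrow> bool" where
  "integral_basis K ws \<longleftrightarrow>
     set ws \<subseteq> ring_of_integers K \<and>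
     (\<forall>x\<in>ring_of_integers K.
        \<exists>!c :: nat \<Rightarrow> int. c \<in> extensional {..<length ws} \<and>
          x = (\<Sum>i<length ws. of_int (c i) * ws ! i))"

definition trace_matrix :: "complex set \<Rightarrow> complex list \<Rightarrow> complex mat" where
  "trace_matrix K ws =
     mat (length ws) (length ws) (\<lambda>(i, j). field_trace K (ws ! i * ws ! j))"

text \<open>The determinant of the trace matrix is a rational integer and does not depend on the
  choice of the integral basis, hence the definite description.\<close>

definition field_discriminant :: "complex set \<Rightarrow> int" where
  "field_discriminant K =
     (THE d. \<exists>ws. integral_basis K ws \<and> of_int d = Determinant.det (trace_matrix K ws))"

definition biquadratic_count :: "real \<Rightarrow> nat" where
  "biquadratic_count x = card {K. biquadratic K \<and> real_of_int (field_discriminant K) \<le> x}"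

end

theory Submission
  imports Defs "HOL-Analysis.Harmonic_Numbers" "HOL-Real_Asymp.Real_Asymp" "Jordan_Normal_Form.Char_Poly"
begin

text \<open>
  A biquadratic field is \<open>\<rat>(\<surd>m, \<surd>n)\<close> for distinct squarefree integers \<open>m, n \<noteq> 1\<close>; it contains
  the square roots of exactly three squarefree integers other than \<open>1\<close>, namely \<open>m\<close>, \<open>n\<close> and
  \<open>k = m n / gcd(m, n)\<^sup>2\<close>. Hence each field comes from six ordered pairs \<open>(m, n)\<close>
  (\<open>biquadratic_imp_biquad_field\<close>, \<open>biquad_field_eq_iff\<close>), and the pairs can be counted instead.

  The discriminant is the product of the discriminants of the three quadratic subfields. This is
  read off from explicit integral bases, of which there are three kinds according to the residues of
  \<open>m, n, k\<close> modulo \<open>4\<close> (\<open>discriminant_all_1\<close>, \<open>discriminant_one_1\<close>, \<open>discriminant_no_1\<close>). As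
  \<open>m n k = lcm(m, n)\<^sup>2\<close>, the square root of the discriminant is \<open>lcm(|m|, |n|)\<close> times a power of
  two. Writing a squarefree integer as \<open>t M'\<close> with \<open>t \<in> {1, -1, 2, -2}\<close> and
  \<open>M' = \<plusminus>M \<equiv> 1 (mod 4)\<close>, \<open>M\<close> odd and positive, makes that power depend on the two factors
  \<open>t, s\<close> only: the square root is \<open>w(t, s) lcm(M, N)\<close>, where \<open>w\<close> takes the value \<open>1\<close> once, \<open>4\<close> three
  times, \<open>8\<close> six times and \<open>16\<close> six times on the sixteen pairs \<open>(t, s)\<close>. If \<open>G(y)\<close> is the number
  of pairs of odd squarefree \<open>M, N\<close> with \<open>lcm(M, N) \<le> y\<close>, then
  \<open>6 S(X) = G(\<surd>X) + 3 G(\<surd>X / 4) + 6 G(\<surd>X / 8) + 6 G(\<surd>X / 16) + O(\<surd>X)\<close>; the error accounts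
  for the degenerate pairs with \<open>m = 1\<close>, \<open>n = 1\<close> or \<open>m = n\<close> (\<open>six_biquadratic_count\<close>).

  The number \<open>g(r)\<close> of pairs with \<open>lcm(M, N) = r\<close> is multiplicative: it is \<open>3\<close> at odd primes and
  vanishes at \<open>2\<close> and at higher prime powers. It is the Dirichlet convolution of the ternary divisor
  function with a multiplicative \<open>h\<close> whose local series is \<open>(1 - t)\<^sup>3 (1 + 3 t) = 1 - 6 t\<^sup>2 + 8 t\<^sup>3 - 3 t\<^sup>4\<close>,
  or \<open>(1 - t)\<^sup>3\<close> at the prime \<open>2\<close>. Since \<open>h\<close> has no term of order \<open>t\<close> at odd primes, the sum of
  \<open>|h(n)| n powr (-3/4)\<close> is bounded (\<open>sum_weight_bounded\<close>), and so \<open>G\<close> inherits from the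
  ternary divisor problem the asymptotics \<open>G(y) = C y (log y)\<^sup>2 / 2 + O(y log y)\<close>, where \<open>C\<close> is the sum of
  \<open>h(n) / n\<close> (\<open>summatory_mult_fun_lcm_coeff_asymptotic\<close>). Its Euler product differs from the one in
  the theorem only at \<open>2\<close>, where the factor is \<open>1/8\<close> instead of \<open>5/16\<close>, so \<open>C\<close> is \<open>2/5\<close> of
  that product. With \<open>log \<surd>X = (log X) / 2\<close> the constant becomes
  \<open>(1 + 3/4 + 6/8 + 6/16) / 6 \<cdot> 1/8 \<cdot> 2/5 = 23/960\<close>.
\<close>

section \<open>Multiplicative functions given on prime powers\<close>

lemma prime_power_cofactor_induct [consumes 1, case_names one prime_power]:
  fixes n :: nat
  assumes "n > 0"
    and "P 1"
    and "\<And>p k m. prime p \<Longrightarrow> k > 0 \<Longrightarrow> m > 0 \<Longrightarrow> \<not> p dvd m \<Longrightarrow> P m \<Longrightarrow> P (p ^ k * m)"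
  shows "P n"
  using assms(1)
proof (induction n rule: less_induct)
  case (less n)
  show ?case
  proof (cases "n = 1")
    case False
    then obtain p where p: "prime p" "p dvd n"
      using prime_factor_nat by blast
    obtain m where m: "n = p ^ multiplicity p n * m" "\<not> p dvd m"
      using multiplicity_decompose'[of n p] p less.prems by (metis not_prime_unit not_gr_zero)
    have k: "multiplicity p n > 0"
      using p less.prems by (simp add: prime_multiplicity_gt_zero_iff)
    have m0: "m > 0"
      using m less.prems by (metis gr0I mult_0_right)
    have "p ^ multiplicity p n > 1"
      using p k by (metis one_less_power prime_gt_1_nat)
    then have "m < n"
      using m(1) m0 by (metis mult.commute mult_less_cancel2 nat_mult_1_right)
    then have "P m" using less.IH m0 by blast
    then show ?thesis using assms(3)[OF p(1) k m0 m(2)] m(1) by simp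
  qed (use assms(2) in simp)
qed

text \<open>The multiplicative function with value \<open>\<phi> p k\<close> at the prime power \<open>p ^ k\<close>. Requiring
  \<open>\<phi> p 0 = 1\<close>, as the lemmas below do, puts the exponent zero on the same footing as the others.\<close>

definition mult_fun :: "(nat \<Rightarrow> nat \<Rightarrow> real) \<Rightarrow> nat \<Rightarrow> real" where
  "mult_fun \<phi> n = (\<Prod>p\<in>prime_factors n. \<phi> p (multiplicity p n))"

lemma mult_fun_1 [simp]: "mult_fun \<phi> (Suc 0) = 1"
  by (simp add: mult_fun_def)

lemma prime_factors_prime_power_mult:
  fixes p m k :: nat
  assumes "prime p" "m > 0" "k > 0"
  shows "prime_factors (p ^ k * m) = insert p (prime_factors m)"
  using assms by (subst prime_factors_product) (auto simp: prime_factorization_prime_power)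

lemma multiplicity_prime_power_mult:
  fixes p q m k :: nat
  assumes "prime p" "prime q" "m > 0" "\<not> p dvd m"
  shows "multiplicity q (p ^ k * m) = (if q = p then k else multiplicity q m)"
proof -
  have "multiplicity q (p ^ k * m) = k * multiplicity q p + multiplicity q m"
    using assms by (subst prime_elem_multiplicity_mult_distrib)
      (auto simp: prime_elem_multiplicity_power_distrib)
  then show ?thesis
    using assms by (auto simp: not_dvd_imp_multiplicity_0 prime_multiplicity_other)
qed

lemma mult_fun_prime_power_mult:
  fixes p m k :: nat
  assumes "prime p" "m > 0" "\<not> p dvd m" "\<phi> p 0 = 1"
  shows "mult_fun \<phi> (p ^ k * m) = \<phi> p k * mult_fun \<phi> m"
proof (cases "k = 0")
  case False
  have "p \<notin> prime_factors m" using assms by auto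
  moreover have "(\<Prod>q\<in>prime_factors m. \<phi> q (multiplicity q (p ^ k * m))) = mult_fun \<phi> m"
    unfolding mult_fun_def using assms
    by (intro prod.cong refl) (auto simp: multiplicity_prime_power_mult in_prime_factors_iff)
  ultimately show ?thesis
    using False assms
    by (simp add: mult_fun_def prime_factors_prime_power_mult multiplicity_prime_power_mult)
qed (use assms in simp)

lemma mult_fun_times: "mult_fun (\<lambda>p k. \<phi> p k * \<psi> p k) n = mult_fun \<phi> n * mult_fun \<psi> n"
  by (simp add: mult_fun_def prod.distrib)

lemma mult_fun_abs: "\<bar>mult_fun \<phi> n\<bar> = mult_fun (\<lambda>p k. \<bar>\<phi> p k\<bar>) n"
  by (simp add: mult_fun_def abs_prod)

lemma mult_fun_powr: "n > 0 \<Longrightarrow> mult_fun (\<lambda>p k. (real p ^ k) powr s) n = real n powr s"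
proof (induction n rule: prime_power_cofactor_induct)
  case (prime_power p k m)
  then show ?case
    by (subst mult_fun_prime_power_mult) (auto simp: powr_mult)
qed auto

lemma bij_betw_divisors_prime_power_mult:
  fixes p m k :: nat
  assumes "prime p" "m > 0" "\<not> p dvd m"
  shows "bij_betw (\<lambda>(i, d). p ^ i * d) ({..k} \<times> {d. d dvd m}) {d. d dvd p ^ k * m}"
proof (rule bij_betwI')
  fix x y assume x: "x \<in> {..k} \<times> {d. d dvd m}" and y: "y \<in> {..k} \<times> {d. d dvd m}"
  obtain i d where [simp]: "x = (i, d)" by force
  obtain j e where [simp]: "y = (j, e)" by force
  have d: "d > 0" "\<not> p dvd d" "e > 0" "\<not> p dvd e"
    using x y assms by (auto intro!: Nat.gr0I dest: dvd_trans)
  have "i = j" if "p ^ i * d = p ^ j * e"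
    using multiplicity_prime_power_mult[of p p d i] multiplicity_prime_power_mult[of p p e j] that d assms
    by auto
  then show "((case x of (i, d) \<Rightarrow> p ^ i * d) = (case y of (i, d) \<Rightarrow> p ^ i * d)) = (x = y)"
    using assms by auto
next
  fix x assume "x \<in> {..k} \<times> {d. d dvd m}"
  then show "(case x of (i, d) \<Rightarrow> p ^ i * d) \<in> {d. d dvd p ^ k * m}"
    by (auto intro!: mult_dvd_mono le_imp_power_dvd)
next
  fix e assume "e \<in> {d. d dvd p ^ k * m}"
  then have "e dvd p ^ k * m" by simp
  then obtain a d where "e = a * d" "a dvd p ^ k" "d dvd m"
    by (meson division_decomp)
  moreover from this obtain i where "i \<le> k" "a = p ^ i"
    using divides_primepow_nat[of p a k] assms by auto
  ultimately show "\<exists>x\<in>{..k} \<times> {d. d dvd m}. e = (case x of (i, d) \<Rightarrow> p ^ i * d)"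
    by (intro bexI[of _ "(i, d)"]) auto
qed

text \<open>Convolution with the constant function \<open>1\<close> replaces the local sequences by their partial sums, because
  a divisor of \<open>p ^ k * m\<close> splits into a power of \<open>p\<close> and a divisor of \<open>m\<close>.\<close>

lemma mult_fun_dirichlet:
  assumes "\<And>p. prime p \<Longrightarrow> \<phi> p 0 = 1" and "n > 0"
  shows "(\<Sum>d | d dvd n. mult_fun \<phi> d) = mult_fun (\<lambda>p k. \<Sum>i\<le>k. \<phi> p i) n"
  using assms(2)
proof (induction n rule: prime_power_cofactor_induct)
  case (prime_power p k m)
  have "(\<Sum>d | d dvd p ^ k * m. mult_fun \<phi> d)
      = (\<Sum>x\<in>{..k} \<times> {d. d dvd m}. mult_fun \<phi> (case x of (i, d) \<Rightarrow> p ^ i * d))"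
    using sum.reindex_bij_betw[OF bij_betw_divisors_prime_power_mult[OF prime_power(1,3,4), of k],
        of "mult_fun \<phi>"] by simp
  also have "\<dots> = (\<Sum>(i, d)\<in>{..k} \<times> {d. d dvd m}. \<phi> p i * mult_fun \<phi> d)"
    using prime_power assms(1)
    by (intro sum.cong refl) (auto intro!: mult_fun_prime_power_mult intro: Nat.gr0I dest: dvd_trans)
  also have "\<dots> = (\<Sum>i\<le>k. \<phi> p i) * (\<Sum>d | d dvd m. mult_fun \<phi> d)"
    by (simp add: sum_product sum.cartesian_product)
  also have "\<dots> = mult_fun (\<lambda>p k. \<Sum>i\<le>k. \<phi> p i) (p ^ k * m)"
    using prime_power assms(1) by (subst mult_fun_prime_power_mult) auto
  finally show ?case .
qed auto

text \<open>These sets are finite for finite \<open>A\<close>, and summing a multiplicative function over one of them gives a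
  finite Euler product with each local series cut off after exponent \<open>K\<close>.\<close>

definition smooth_bounded :: "nat \<Rightarrow> nat set \<Rightarrow> nat set" where
  "smooth_bounded K A = {n. n > 0 \<and> prime_factors n \<subseteq> A \<and> (\<forall>p. prime p \<longrightarrow> multiplicity p n \<le> K)}"

lemma bij_betw_smooth_bounded_insert:
  assumes "prime p" "p \<notin> A"
  shows "bij_betw (\<lambda>(i, d). p ^ i * d) ({..K} \<times> smooth_bounded K A) (smooth_bounded K (insert p A))"
proof (rule bij_betwI')
  fix x y assume x: "x \<in> {..K} \<times> smooth_bounded K A" and y: "y \<in> {..K} \<times> smooth_bounded K A"
  obtain i d where [simp]: "x = (i, d)" by force
  obtain j e where [simp]: "y = (j, e)" by force
  have d: "d > 0" "\<not> p dvd d" "e > 0" "\<not> p dvd e"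
    using x y assms by (auto simp: smooth_bounded_def in_prime_factors_iff)
  have "i = j" if "p ^ i * d = p ^ j * e"
    using multiplicity_prime_power_mult[of p p d i] multiplicity_prime_power_mult[of p p e j] that d assms
    by auto
  then show "((case x of (i, d) \<Rightarrow> p ^ i * d) = (case y of (i, d) \<Rightarrow> p ^ i * d)) = (x = y)"
    using assms by auto
next
  fix x assume x: "x \<in> {..K} \<times> smooth_bounded K A"
  obtain i d where [simp]: "x = (i, d)" by force
  have d: "d > 0" "\<not> p dvd d"
    using x assms by (auto simp: smooth_bounded_def in_prime_factors_iff)
  have "prime_factors (p ^ i * d) \<subseteq> insert p (prime_factors d)"
    using prime_factors_prime_power_mult[of p d i] assms d by (cases "i = 0") auto
  then show "(case x of (i, d) \<Rightarrow> p ^ i * d) \<in> smooth_bounded K (insert p A)"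
    using x assms d by (auto simp: smooth_bounded_def multiplicity_prime_power_mult prime_gt_0_nat)
next
  fix n assume n: "n \<in> smooth_bounded K (insert p A)"
  then have n0: "n > 0" by (simp add: smooth_bounded_def)
  obtain m where m: "n = p ^ multiplicity p n * m" "\<not> p dvd m"
    using multiplicity_decompose'[of n p] assms n0 by (metis not_prime_unit not_gr_zero)
  define k where "k = multiplicity p n"
  have nk: "n = p ^ k * m" using m k_def by simp
  have m0: "m > 0" using m n0 by (metis gr0I mult_0_right)
  have mu: "multiplicity q n = (if q = p then k else multiplicity q m)" if "prime q" for q
    unfolding nk using multiplicity_prime_power_mult[OF assms(1) that m0 m(2)] .
  have "prime_factors m \<subseteq> prime_factors n"
    using n0 unfolding nk by (intro dvd_prime_factors) auto
  moreover have "p \<notin> prime_factors m" using m by auto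
  moreover have "multiplicity q m \<le> K" if "prime q" for q
    using mu[OF that] n that m(2) by (cases "q = p") (auto simp: smooth_bounded_def not_dvd_imp_multiplicity_0)
  ultimately have "m \<in> smooth_bounded K A"
    using n m0 by (auto simp: smooth_bounded_def)
  moreover have "k \<le> K" using n assms by (simp add: smooth_bounded_def k_def)
  ultimately show "\<exists>x\<in>{..K} \<times> smooth_bounded K A. n = (case x of (i, d) \<Rightarrow> p ^ i * d)"
    by (intro bexI[of _ "(k, m)"]) (auto simp: nk)
qed

lemma smooth_bounded_empty: "smooth_bounded K {} = {1}"
  by (auto simp: smooth_bounded_def prime_factorization_empty_iff)

lemma finite_smooth_bounded:
  assumes "finite A" "\<forall>p\<in>A. prime p" shows "finite (smooth_bounded K A)"
  using assms
proof (induction A rule: finite_induct)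
  case (insert p A)
  then show ?case
    using bij_betw_finite[OF bij_betw_smooth_bounded_insert[of p A K]] by auto
qed (simp add: smooth_bounded_empty)

lemma sum_mult_fun_smooth_bounded:
  assumes "finite A" "\<forall>p\<in>A. prime p" "\<And>p. prime p \<Longrightarrow> \<phi> p 0 = 1"
  shows "(\<Sum>n\<in>smooth_bounded K A. mult_fun \<phi> n) = (\<Prod>p\<in>A. \<Sum>k\<le>K. \<phi> p k)"
  using assms(1,2)
proof (induction A rule: finite_induct)
  case (insert p A)
  have "(\<Sum>n\<in>smooth_bounded K (insert p A). mult_fun \<phi> n)
      = (\<Sum>x\<in>{..K} \<times> smooth_bounded K A. mult_fun \<phi> (case x of (i, d) \<Rightarrow> p ^ i * d))"
    using sum.reindex_bij_betw[OF bij_betw_smooth_bounded_insert[of p A K], of "mult_fun \<phi>"] insert by simp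
  also have "\<dots> = (\<Sum>(i, d)\<in>{..K} \<times> smooth_bounded K A. \<phi> p i * mult_fun \<phi> d)"
    using insert assms(3)
    by (intro sum.cong refl) (auto intro!: mult_fun_prime_power_mult simp: smooth_bounded_def in_prime_factors_iff)
  also have "\<dots> = (\<Sum>i\<le>K. \<phi> p i) * (\<Sum>d\<in>smooth_bounded K A. mult_fun \<phi> d)"
    by (simp add: sum_product sum.cartesian_product)
  finally show ?case using insert by simp
qed (simp add: smooth_bounded_empty)

section \<open>The ternary divisor problem\<close>

definition summatory :: "(nat \<Rightarrow> real) \<Rightarrow> real \<Rightarrow> real" where
  "summatory f x = (\<Sum>n\<in>{1..nat \<lfloor>x\<rfloor>}. f n)"

text \<open>On summatory functions this operator is Dirichlet convolution with the constant function \<open>1\<close>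
  (\<open>summatory_dirichlet\<close>), and it commutes with rescaling of the argument.\<close>

definition dilate_sum :: "(real \<Rightarrow> real) \<Rightarrow> real \<Rightarrow> real" where
  "dilate_sum F x = (\<Sum>a\<in>{1..nat \<lfloor>x\<rfloor>}. F (x / real a))"

lemma nat_floor_ge_iff: "a > 0 \<Longrightarrow> a \<le> nat \<lfloor>x::real\<rfloor> \<longleftrightarrow> real a \<le> x"
  by linarith

text \<open>Order the pairs \<open>(a, d)\<close> with \<open>a d \<le> x\<close> by the codivisor \<open>a\<close> instead of the product.\<close>

lemma summatory_dirichlet:
  "summatory (\<lambda>n. \<Sum>d | d dvd n. f d) x = dilate_sum (summatory f) x"
proof -
  let ?N = "nat \<lfloor>x\<rfloor>"
  have "summatory (\<lambda>n. \<Sum>d | d dvd n. f d) x = (\<Sum>n\<in>{1..?N}. \<Sum>d | d dvd n. f d)"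
    by (simp add: summatory_def)
  also have "\<dots> = (\<Sum>(n, d)\<in>(SIGMA n:{1..?N}. {d. d dvd n}). f d)"
    by (rule sum.Sigma) auto
  also have "\<dots> = (\<Sum>(a, d)\<in>(SIGMA a:{1..?N}. {1..nat \<lfloor>x / real a\<rfloor>}). f d)"
  proof (rule sum.reindex_bij_witness[where i = "\<lambda>(a, d). (a * d, d)" and j = "\<lambda>(n, d). (n div d, d)"], goal_cases)
    case (2 y)
    then obtain n d where y: "y = (n, d)" "1 \<le> n" "n \<le> ?N" "d dvd n" by auto
    then have d: "d > 0" by (auto intro: Nat.gr0I)
    have 1: "n div d > 0" "n div d \<le> ?N" using y d by (auto simp: div_greater_zero_iff dvd_imp_le intro: order_trans[OF div_le_dividend])
    have "real d = real n / real (n div d)" using y d by (simp add: real_of_nat_div)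
    also have "\<dots> \<le> x / real (n div d)"
      using nat_floor_ge_iff[of n x] y by (intro divide_right_mono) auto
    finally show ?case using y 1 d by (auto simp: nat_floor_ge_iff)
  next
    case (4 z)
    then obtain a d where z: "z = (a, d)" "1 \<le> a" "a \<le> ?N" "1 \<le> d" "d \<le> nat \<lfloor>x / real a\<rfloor>" by auto
    then have "real a * real d \<le> x"
      using nat_floor_ge_iff[of d "x / real a"] by (simp add: field_simps)
    then have "a * d \<le> ?N" using z nat_floor_ge_iff[of "a * d" x] by simp
    then show ?case using z by auto
  qed auto
  also have "\<dots> = (\<Sum>a\<in>{1..?N}. \<Sum>d\<in>{1..nat \<lfloor>x / real a\<rfloor>}. f d)"
    by (rule sum.Sigma[symmetric]) auto
  finally show ?thesis by (simp add: dilate_sum_def summatory_def)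
qed

text \<open>The summatory function of the unit of Dirichlet convolution; every summatory function is a
  superposition of its dilates.\<close>

definition unit_step :: "real \<Rightarrow> real" where
  "unit_step x = (if x \<ge> 1 then 1 else 0)"

lemma dilate_sum_less_1: "x < 1 \<Longrightarrow> dilate_sum F x = 0"
  by (simp add: dilate_sum_def)

text \<open>The sum may run to \<open>x\<close> instead of \<open>x / d\<close>, since \<open>F\<close> vanishes below \<open>1\<close>. A common range for all \<open>d\<close>
  is what allows the summations to be interchanged in the next lemma.\<close>

lemma dilate_sum_scale:
  assumes "d > 0" and "x \<ge> 0" and F: "\<And>y. y < 1 \<Longrightarrow> F y = 0"
  shows "(\<Sum>a\<in>{1..nat \<lfloor>x\<rfloor>}. F (x / real a / real d)) = dilate_sum F (x / real d)"
  unfolding dilate_sum_def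
proof (rule sum.mono_neutral_cong_right)
  have "x / real d \<le> x" using divide_left_mono[of 1 "real d" x] assms by simp
  then show "{1..nat \<lfloor>x / real d\<rfloor>} \<subseteq> {1..nat \<lfloor>x\<rfloor>}"
    by (auto intro: nat_mono floor_mono order_trans)
  show "\<forall>a\<in>{1..nat \<lfloor>x\<rfloor>} - {1..nat \<lfloor>x / real d\<rfloor>}. F (x / real a / real d) = 0"
  proof
    fix a assume a: "a \<in> {1..nat \<lfloor>x\<rfloor>} - {1..nat \<lfloor>x / real d\<rfloor>}"
    then have "\<not> real a \<le> x / real d" using nat_floor_ge_iff[of a "x / real d"] by auto
    then have "x / real a / real d < 1" using a assms by (auto simp: field_simps)
    then show "F (x / real a / real d) = 0" using F by blast
  qed
qed (auto simp: field_simps)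

lemma dilate_sum_superposition:
  assumes "\<And>x. x \<ge> 0 \<Longrightarrow> S x = (\<Sum>d\<in>{1..nat \<lfloor>x\<rfloor>}. h d * F (x / real d))"
    and F: "\<And>y. y < 1 \<Longrightarrow> F y = 0" and x: "x \<ge> 0"
  shows "dilate_sum S x = (\<Sum>d\<in>{1..nat \<lfloor>x\<rfloor>}. h d * dilate_sum F (x / real d))"
proof -
  let ?N = "nat \<lfloor>x\<rfloor>"
  have S: "S (x / real a) = (\<Sum>d\<in>{1..?N}. h d * F (x / real a / real d))" if a: "a \<in> {1..?N}" for a
  proof -
    have le: "x / real a \<le> x" using divide_left_mono[of 1 "real a" x] a x by simp
    have "S (x / real a) = (\<Sum>d\<in>{1..nat \<lfloor>x / real a\<rfloor>}. h d * F (x / real a / real d))"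
      using assms(1) x by simp
    also have "\<dots> = (\<Sum>d\<in>{1..?N}. h d * F (x / real a / real d))"
    proof (rule sum.mono_neutral_left)
      show "{1..nat \<lfloor>x / real a\<rfloor>} \<subseteq> {1..?N}"
        using le by (auto intro: nat_mono floor_mono order_trans)
      show "\<forall>d\<in>{1..?N} - {1..nat \<lfloor>x / real a\<rfloor>}. h d * F (x / real a / real d) = 0"
      proof
        fix d assume d: "d \<in> {1..?N} - {1..nat \<lfloor>x / real a\<rfloor>}"
        then have "\<not> real d \<le> x / real a" using nat_floor_ge_iff[of d "x / real a"] by auto
        then have "x / real a / real d < 1" using d by (subst divide_less_eq_1_pos) auto
        then show "h d * F (x / real a / real d) = 0" using F by simp
      qed
    qed auto
    finally show ?thesis .
  qed
  have "dilate_sum S x = (\<Sum>a\<in>{1..?N}. \<Sum>d\<in>{1..?N}. h d * F (x / real a / real d))"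
    unfolding dilate_sum_def by (intro sum.cong refl S)
  also have "\<dots> = (\<Sum>d\<in>{1..?N}. \<Sum>a\<in>{1..?N}. h d * F (x / real a / real d))"
    by (rule sum.swap)
  also have "\<dots> = (\<Sum>d\<in>{1..?N}. h d * dilate_sum F (x / real d))"
  proof (rule sum.cong[OF refl])
    fix d assume "d \<in> {1..?N}"
    then show "(\<Sum>a\<in>{1..?N}. h d * F (x / real a / real d)) = h d * dilate_sum F (x / real d)"
      using dilate_sum_scale[of d x F] F x by (simp flip: sum_distrib_left)
  qed
  finally show ?thesis .
qed

text \<open>The number of triples of positive integers with product at most \<open>x\<close>.\<close>

definition ternary_divisor_sum :: "real \<Rightarrow> real" where
  "ternary_divisor_sum = dilate_sum (dilate_sum (dilate_sum unit_step))"

text \<open>Convolving \<open>h\<close> three times with \<open>1\<close> is convolving it once with the ternary divisor function.\<close>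

lemma summatory_triple_dirichlet:
  assumes "x \<ge> 0"
  shows "dilate_sum (dilate_sum (dilate_sum (summatory h))) x
       = (\<Sum>d\<in>{1..nat \<lfloor>x\<rfloor>}. h d * ternary_divisor_sum (x / real d))"
proof -
  have 0: "summatory h x = (\<Sum>d\<in>{1..nat \<lfloor>x\<rfloor>}. h d * unit_step (x / real d))" if "x \<ge> 0" for x
    unfolding summatory_def
  proof (intro sum.cong refl)
    fix d assume d: "d \<in> {1..nat \<lfloor>x\<rfloor>}"
    then show "h d = h d * unit_step (x / real d)"
      using nat_floor_ge_iff[of d x] by (auto simp: unit_step_def field_simps)
  qed
  have 1: "dilate_sum (summatory h) x = (\<Sum>d\<in>{1..nat \<lfloor>x\<rfloor>}. h d * dilate_sum unit_step (x / real d))"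
    if "x \<ge> 0" for x
    by (rule dilate_sum_superposition[OF 0 _ that]) (auto simp: unit_step_def)
  have 2: "dilate_sum (dilate_sum (summatory h)) x
      = (\<Sum>d\<in>{1..nat \<lfloor>x\<rfloor>}. h d * dilate_sum (dilate_sum unit_step) (x / real d))"
    if "x \<ge> 0" for x
    by (rule dilate_sum_superposition[OF 1 _ that]) (auto simp: dilate_sum_less_1)
  show ?thesis unfolding ternary_divisor_sum_def
    by (rule dilate_sum_superposition[OF 2 _ assms]) (auto simp: dilate_sum_less_1)
qed

definition log_sum :: "nat \<Rightarrow> real" where "log_sum n = (\<Sum>a\<in>{1..n}. ln (real a) / real a)"

lemma ln_diff_bounds:
  assumes "n \<ge> (1::nat)"
  shows "1 / real (Suc n) \<le> ln (real (Suc n)) - ln (real n)"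
    "ln (real (Suc n)) - ln (real n) \<le> 1 / real n"
proof -
  have pos: "real n > 0" "real (Suc n) > 0" using assms by auto
  have "ln (real n / real (Suc n)) \<le> real n / real (Suc n) - 1"
    using pos by (intro ln_le_minus_one divide_pos_pos)
  moreover have "real n / real (Suc n) - 1 = - (1 / real (Suc n))"
    using pos by (simp add: divide_simps)
  ultimately show "1 / real (Suc n) \<le> ln (real (Suc n)) - ln (real n)"
    using ln_div[of "real n" "real (Suc n)"] pos by auto
  have "ln (real (Suc n) / real n) \<le> real (Suc n) / real n - 1"
    using pos by (intro ln_le_minus_one divide_pos_pos)
  moreover have "real (Suc n) / real n - 1 = 1 / real n"
    using pos by (simp add: divide_simps)
  ultimately show "ln (real (Suc n)) - ln (real n) \<le> 1 / real n"
    using ln_div[of "real (Suc n)" "real n"] pos by auto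
qed

lemma harm_eq_sum_divide: "harm n = (\<Sum>a\<in>{1..n}. 1 / real a)"
  by (simp add: harm_def inverse_eq_divide)

lemma harm_le_ln:
  assumes "n \<ge> 1" shows "harm n \<le> 1 + ln (real n)"
proof -
  have "harm (Suc (n - 1)) - ln (real (Suc (n - 1))) \<le> harm (Suc 0) - ln (real (Suc 0))"
    by (rule decseqD[OF decseq_harm_diff_ln]) simp
  then show ?thesis using assms by (simp add: harm_def)
qed

text \<open>Increments are compared: with \<open>e = ln (n + 1) - ln n\<close> half of the square grows by
  \<open>e (ln (n + 1) + ln n) / 2\<close>, and \<open>1/(n+1) \<le> e \<le> 1/n\<close> shows that the error of one step is at most \<open>1/(n+1)\<close>,
  the increment of the harmonic sum.\<close>

lemma log_sum_bounds:
  assumes "n \<ge> 1"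
  shows "\<bar>log_sum n - (ln (real n))\<^sup>2 / 2\<bar> \<le> harm n"
  using assms
proof (induction n rule: nat_induct_at_least)
  case base
  then show ?case by (simp add: harm_eq_sum_divide log_sum_def)
next
  case (Suc n)
  define L where "L = ln (real n)"
  define L' where "L' = ln (real (Suc n))"
  define u where "u = 1 / real (Suc n)"
  define v where "v = 1 / real n"
  define e where "e = L' - L"
  have e: "u \<le> e" "e \<le> v" using ln_diff_bounds[of n] Suc by (auto simp: e_def L_def L'_def u_def v_def)
  have u0: "u > 0" "v \<le> 1" using Suc by (auto simp: u_def v_def)
  have L'0: "0 \<le> L'" "L' \<le> real n"
    using ln_le_minus_one[of "real (Suc n)"] by (auto simp: L'_def)
  have v: "v * v \<le> 2 * u" 
  proof -
    have "n \<le> n * n" "1 \<le> n * n" using Suc by simp_all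
    then have "real (n + 1) \<le> real (2 * (n * n))" by (intro of_nat_mono) linarith
    then show ?thesis using Suc by (simp add: v_def u_def field_simps)
  qed
  have vu: "v - u = v * u" using Suc by (simp add: v_def u_def field_simps)
  have Lv: "L' * v \<le> 1" using L'0 Suc by (simp add: v_def field_simps)
  have step: "log_sum (Suc n) - L'\<^sup>2 / 2 = (log_sum n - L\<^sup>2 / 2) + (L' * u - e * (L' + L) / 2)"
    by (simp add: log_sum_def L'_def L_def e_def u_def field_simps power2_eq_square)
  have Le: "L = L' - e" by (simp add: e_def)
  have "L' * u - e * (L' + L) / 2 = L' * (u - e) + e * e / 2"
    unfolding Le by (simp add: field_simps)
  moreover have "L' * (u - e) \<le> 0" using L'0 e by (simp add: mult_nonneg_nonpos)
  moreover have "e * e \<le> v * v" using e u0 by (intro mult_mono) auto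
  moreover have "L' * (u - e) \<ge> - u"
  proof -
    have "L' * (e - u) \<le> L' * (v - u)" using L'0 e by (intro mult_left_mono) auto
    also have "\<dots> = (L' * v) * u" by (simp add: vu)
    also have "\<dots> \<le> 1 * u" using Lv u0 by (intro mult_right_mono) auto
    finally show ?thesis by (simp add: algebra_simps)
  qed
  ultimately have "\<bar>L' * u - e * (L' + L) / 2\<bar> \<le> u"
    using v u0 zero_le_square[of e] unfolding abs_le_iff by linarith
  moreover have "harm (Suc n) = harm n + u" by (simp add: harm_eq_sum_divide u_def)
  ultimately show ?case using step Suc.IH by (simp add: L'_def L_def)
qed

lemma nat_floor_props:
  assumes "x \<ge> 1"
  shows "nat \<lfloor>x\<rfloor> \<ge> 1" "real (nat \<lfloor>x\<rfloor>) \<le> x" "x < real (Suc (nat \<lfloor>x\<rfloor>))"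
  using assms by linarith+

lemma harm_real_bounds:
  fixes x :: real
  assumes "x \<ge> 1"
  shows "ln x \<le> harm (nat \<lfloor>x\<rfloor>)" "harm (nat \<lfloor>x\<rfloor>) \<le> 1 + ln x"
proof -
  note n = nat_floor_props[OF assms]
  have "ln x \<le> ln (real (nat \<lfloor>x\<rfloor>) + 1)" using n assms by (intro ln_mono) auto
  then show "ln x \<le> harm (nat \<lfloor>x\<rfloor>)"
    using ln_le_harm[of "nat \<lfloor>x\<rfloor>"] by linarith
  have "ln (real (nat \<lfloor>x\<rfloor>)) \<le> ln x" using n assms by (intro ln_mono) auto
  then show "harm (nat \<lfloor>x\<rfloor>) \<le> 1 + ln x"
    using harm_le_ln[OF n(1)] by simp
qed

lemma log_sum_real_bound:
  assumes "x \<ge> 1"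
  shows "\<bar>log_sum (nat \<lfloor>x\<rfloor>) - (ln x)\<^sup>2 / 2\<bar> \<le> 2 * (1 + ln x)"
proof -
  let ?n = "nat \<lfloor>x\<rfloor>"
  note n = nat_floor_props[OF assms]
  have l: "0 \<le> ln (real ?n)" "ln (real ?n) \<le> ln x" "0 \<le> ln x" using n assms by (auto intro: ln_mono)
  have "ln x \<le> ln (real (Suc ?n))" using n assms by (intro ln_mono) auto
  also have "\<dots> \<le> ln (real ?n) + 1 / real ?n" using ln_diff_bounds(2)[OF n(1)] by simp
  also have "1 / real ?n \<le> 1" using n by simp
  finally have d: "ln x - ln (real ?n) \<le> 1" by simp
  have "(ln x)\<^sup>2 - (ln (real ?n))\<^sup>2 = (ln x - ln (real ?n)) * (ln x + ln (real ?n))"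
    by (simp add: power2_eq_square algebra_simps)
  also have "\<dots> \<le> 1 * (2 * ln x)" using d l by (intro mult_mono) auto
  finally have "(ln x)\<^sup>2 - (ln (real ?n))\<^sup>2 \<le> 2 * ln x" by simp
  moreover have "(ln (real ?n))\<^sup>2 \<le> (ln x)\<^sup>2" using l by (intro power_mono) auto
  moreover have "\<bar>L - b / 2\<bar> \<le> 2 * (1 + l)"
    if "b - a \<le> 2 * l" "a \<le> b" "\<bar>L - a / 2\<bar> \<le> H" "H \<le> 1 + l" "0 \<le> l" for L a b H l :: real
    using that unfolding abs_le_iff by (auto simp: field_simps)
  ultimately show ?thesis
    using log_sum_bounds[OF n(1)] harm_real_bounds(2)[OF assms] l(3) by blast
qed

lemma dilate_sum_unit_step: "x \<ge> 0 \<Longrightarrow> dilate_sum unit_step x = real (nat \<lfloor>x\<rfloor>)"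
proof -
  assume "x \<ge> 0"
  have "dilate_sum unit_step x = (\<Sum>a\<in>{1..nat \<lfloor>x\<rfloor>}. 1)"
    unfolding dilate_sum_def
  proof (intro sum.cong refl)
    fix a assume "a \<in> {1..nat \<lfloor>x\<rfloor>}"
    then show "unit_step (x / real a) = 1" using nat_floor_ge_iff[of a x] by (auto simp: unit_step_def field_simps)
  qed
  then show ?thesis by simp
qed

text \<open>Dropping the floors from \<open>\<Sum>a\<le>x. \<lfloor>x / a\<rfloor>\<close> costs at most \<open>1\<close> per term, and what remains is
  \<open>x\<close> times a harmonic sum.\<close>

lemma binary_divisor_sum_bound:
  assumes "x \<ge> 1"
  shows "\<bar>dilate_sum (dilate_sum unit_step) x - x * ln x\<bar> \<le> 2 * x"
proof -
  let ?n = "nat \<lfloor>x\<rfloor>"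
  note n = nat_floor_props[OF assms]
  have "\<bar>dilate_sum (dilate_sum unit_step) x - x * harm ?n\<bar>
      = \<bar>\<Sum>a\<in>{1..?n}. real (nat \<lfloor>x / real a\<rfloor>) - x / real a\<bar>"
    using assms by (simp add: dilate_sum_def[of "dilate_sum unit_step"] harm_eq_sum_divide sum_distrib_left
        dilate_sum_unit_step sum_subtractf)
  also have "\<dots> \<le> (\<Sum>a\<in>{1..?n}. 1)"
    using assms by (intro order_trans[OF sum_abs] sum_mono) (simp, linarith)
  also have "\<dots> \<le> x" using n by simp
  finally have 1: "\<bar>dilate_sum (dilate_sum unit_step) x - x * harm ?n\<bar> \<le> x" .
  have "x * ln x \<le> x * harm ?n" "x * harm ?n \<le> x * (1 + ln x)"
    using harm_real_bounds[OF assms] assms by (auto intro!: mult_left_mono)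
  then show ?thesis using 1 unfolding abs_le_iff by (simp add: algebra_simps)
qed

text \<open>Summing the bound for binary divisor sums over \<open>x / a\<close> leads to \<open>\<Sum>a\<le>x. ln (x / a) / a\<close>, whose main
  part is \<open>(ln x)\<^sup>2 - (ln x)\<^sup>2 / 2\<close>.\<close>

lemma ternary_divisor_sum_bound:
  assumes "x \<ge> 1"
  shows "\<bar>ternary_divisor_sum x - x * (ln x)\<^sup>2 / 2\<bar> \<le> 5 * x * (1 + ln x)"
proof -
  let ?n = "nat \<lfloor>x\<rfloor>"
  note n = nat_floor_props[OF assms]
  have lx: "ln x \<ge> 0" using assms by simp
  have D: "\<bar>dilate_sum (dilate_sum unit_step) (x / real a) - x / real a * ln (x / real a)\<bar> \<le> 2 * (x / real a)"
    if "a \<in> {1..?n}" for a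
    using that nat_floor_ge_iff[of a x] by (intro binary_divisor_sum_bound) (auto simp: field_simps)
  have "(\<Sum>a\<in>{1..?n}. x / real a * ln (x / real a))
      = (\<Sum>a\<in>{1..?n}. x * ln x * (1 / real a) - x * (ln (real a) / real a))"
    using assms by (intro sum.cong refl) (auto simp: ln_div field_simps)
  also have "\<dots> = x * (ln x * harm ?n - log_sum ?n)"
    by (simp add: sum_subtractf harm_eq_sum_divide log_sum_def sum_distrib_left algebra_simps)
  finally have S: "(\<Sum>a\<in>{1..?n}. x / real a * ln (x / real a)) = x * (ln x * harm ?n - log_sum ?n)" .
  have "\<bar>ternary_divisor_sum x - (\<Sum>a\<in>{1..?n}. x / real a * ln (x / real a))\<bar>
      = \<bar>\<Sum>a\<in>{1..?n}. dilate_sum (dilate_sum unit_step) (x / real a) - x / real a * ln (x / real a)\<bar>"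
    by (simp add: ternary_divisor_sum_def dilate_sum_def[of "dilate_sum (dilate_sum unit_step)"] sum_subtractf)
  also have "\<dots> \<le> (\<Sum>a\<in>{1..?n}. 2 * (x / real a))"
    using D by (intro order_trans[OF sum_abs] sum_mono) blast
  also have "\<dots> = 2 * x * harm ?n" by (simp add: harm_eq_sum_divide sum_distrib_left)
  also have "\<dots> \<le> 2 * x * (1 + ln x)" using harm_real_bounds[OF assms] assms by (intro mult_left_mono) auto
  finally have 1: "\<bar>ternary_divisor_sum x - x * (ln x * harm ?n - log_sum ?n)\<bar> \<le> 2 * x * (1 + ln x)"
    unfolding S .
  have "ln x * ln x \<le> ln x * harm ?n" "ln x * harm ?n \<le> ln x * (1 + ln x)"
    using harm_real_bounds[OF assms] lx by (auto intro!: mult_left_mono)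
  then have "\<bar>(ln x * harm ?n - log_sum ?n) - (ln x)\<^sup>2 / 2\<bar> \<le> 3 * (1 + ln x)"
    using log_sum_real_bound[OF assms] lx unfolding abs_le_iff power2_eq_square by (simp add: algebra_simps)
  then have "x * \<bar>(ln x * harm ?n - log_sum ?n) - (ln x)\<^sup>2 / 2\<bar> \<le> x * (3 * (1 + ln x))"
    using assms by (intro mult_left_mono) auto
  moreover have "x * \<bar>(ln x * harm ?n - log_sum ?n) - (ln x)\<^sup>2 / 2\<bar>
     = \<bar>x * (ln x * harm ?n - log_sum ?n) - x * (ln x)\<^sup>2 / 2\<bar>"
    using assms by (simp add: abs_mult[of x, symmetric, simplified] abs_of_pos abs_mult_pos' algebra_simps)
  moreover have "5 * x * (1 + ln x) = 2 * x * (1 + ln x) + x * (3 * (1 + ln x))"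
    by (simp add: algebra_simps)
  ultimately show ?thesis using 1 by linarith
qed

section \<open>Mean value of a multiplicative coefficient\<close>

text \<open>Coefficients of \<open>(1 - t)\<^sup>3 (1 + 3 t)\<close>, and of \<open>(1 - t)\<^sup>3\<close> when \<open>p = 2\<close>: the local series of the
  function that turns the ternary divisor function into \<open>mult_fun lcm_coeff\<close>.\<close>

definition corr_coeff :: "nat \<Rightarrow> nat \<Rightarrow> real" where
  "corr_coeff p k = (if k = 0 then 1
     else if p = 2 then (if k = 1 then -3 else if k = 2 then 3 else if k = 3 then -1 else 0)
     else (if k = 2 then -6 else if k = 3 then 8 else if k = 4 then -3 else 0))"

text \<open>Coefficients of \<open>1 + 3 t\<close>, and of \<open>1\<close> when \<open>p = 2\<close>; \<open>mult_fun lcm_coeff r\<close> is the number of pairs of odd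
  squarefree numbers with least common multiple \<open>r\<close> (\<open>card_lcm_pairs\<close>).\<close>

definition lcm_coeff :: "nat \<Rightarrow> nat \<Rightarrow> real" where
  "lcm_coeff p k = (if k = 0 then 1 else if k = 1 \<and> p \<noteq> 2 then 3 else 0)"

lemma corr_coeff_0 [simp]: "corr_coeff p 0 = 1" by (simp add: corr_coeff_def)

text \<open>Taking partial sums divides a power series by \<open>1 - t\<close>, so doing it three times cancels \<open>(1 - t)\<^sup>3\<close>.\<close>

lemma partial_sums_corr_coeff:
  "(\<Sum>i\<le>k. \<Sum>j\<le>i. \<Sum>l\<le>j. corr_coeff p l) = lcm_coeff p k"
proof -
  have 1: "(\<Sum>l\<le>k. corr_coeff p l) = (if k = 0 then 1
      else if p = 2 then (if k = 1 then -2 else if k = 2 then 1 else 0)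
      else (if k = 1 then 1 else if k = 2 then -5 else if k = 3 then 3 else 0))" for k
    by (induction k) (auto simp: corr_coeff_def)
  have 2: "(\<Sum>j\<le>k. \<Sum>l\<le>j. corr_coeff p l) = (if k = 0 then 1
      else if p = 2 then (if k = 1 then -1 else 0)
      else (if k = 1 then 2 else if k = 2 then -3 else 0))" for k
    by (induction k) (auto simp: 1)
  show ?thesis by (induction k) (auto simp: 2 lcm_coeff_def)
qed

lemma summatory_cong: "(\<And>n. n > 0 \<Longrightarrow> f n = g n) \<Longrightarrow> summatory f x = summatory g x"
  unfolding summatory_def by (intro sum.cong refl) auto

lemma summatory_mult_fun_partial_sums:
  assumes "\<And>p. prime p \<Longrightarrow> \<phi> p 0 = 1"
  shows "summatory (mult_fun (\<lambda>p k. \<Sum>i\<le>k. \<phi> p i)) = dilate_sum (summatory (mult_fun \<phi>))"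
proof
  fix x
  show "summatory (mult_fun (\<lambda>p k. \<Sum>i\<le>k. \<phi> p i)) x = dilate_sum (summatory (mult_fun \<phi>)) x"
    unfolding summatory_dirichlet[symmetric]
    by (rule summatory_cong) (simp add: mult_fun_dirichlet assms)
qed

lemma summatory_mult_fun_lcm_coeff:
  assumes "x \<ge> 0"
  shows "summatory (mult_fun lcm_coeff) x
       = (\<Sum>d\<in>{1..nat \<lfloor>x\<rfloor>}. mult_fun corr_coeff d * ternary_divisor_sum (x / real d))"
proof -
  have "lcm_coeff = (\<lambda>p k. \<Sum>i\<le>k. \<Sum>j\<le>i. \<Sum>l\<le>j. corr_coeff p l)"
    by (intro ext) (simp add: partial_sums_corr_coeff)
  moreover have "summatory (mult_fun (\<lambda>p k. \<Sum>i\<le>k. \<Sum>j\<le>i. \<Sum>l\<le>j. corr_coeff p l))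
      = dilate_sum (summatory (mult_fun (\<lambda>p k. \<Sum>j\<le>k. \<Sum>l\<le>j. corr_coeff p l)))"
    by (rule summatory_mult_fun_partial_sums) simp
  moreover have "summatory (mult_fun (\<lambda>p k. \<Sum>j\<le>k. \<Sum>l\<le>j. corr_coeff p l))
      = dilate_sum (summatory (mult_fun (\<lambda>p k. \<Sum>l\<le>k. corr_coeff p l)))"
    by (rule summatory_mult_fun_partial_sums) simp
  moreover have "summatory (mult_fun (\<lambda>p k. \<Sum>l\<le>k. corr_coeff p l)) = dilate_sum (summatory (mult_fun corr_coeff))"
    by (rule summatory_mult_fun_partial_sums) simp
  ultimately have "summatory (mult_fun lcm_coeff) = dilate_sum (dilate_sum (dilate_sum (summatory (mult_fun corr_coeff))))"
    by metis
  then show ?thesis using summatory_triple_dirichlet[OF assms] by simp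
qed

lemma corr_coeff_eq_0: "k > 4 \<Longrightarrow> corr_coeff p k = 0"
  by (simp add: corr_coeff_def)

lemma mult_fun_corr_coeff_eq_0:
  assumes "prime p" "multiplicity p n > 4"
  shows "mult_fun corr_coeff n = 0"
proof -
  have "n \<noteq> 0" using assms by (intro notI) simp
  moreover have "p dvd n" using assms by (metis not_dvd_imp_multiplicity_0 not_less0)
  ultimately have "p \<in> prime_factors n" using assms by (auto simp: in_prime_factors_iff)
  then show ?thesis unfolding mult_fun_def using corr_coeff_eq_0[OF assms(2)]
    by (intro prod_zero) auto
qed

text \<open>For odd \<open>p\<close> all positive exponents that occur are at least \<open>2\<close>, and \<open>6 + 8 + 3 = 17\<close> bounds the coefficients. At
  \<open>p = 2\<close> the linear term is present and the sum is at most \<open>8\<close>; the factor \<open>34\<close> is large enough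
  for \<open>1 + 34 \<cdot> 2 powr (-3/2)\<close> to exceed this.\<close>

lemma sum_powr_corr_coeff_le:
  assumes "prime (p::nat)"
  shows "(\<Sum>k\<le>4. \<bar>corr_coeff p k\<bar> * (real p ^ k) powr (- (3 / 4))) \<le> 1 + 34 * real p powr (- (3 / 2))"
proof -
  have p: "real p \<ge> 2" using prime_ge_2_nat[OF assms] by simp
  have sum: "(\<Sum>k\<le>4. f k) = f 0 + f 1 + f 2 + f 3 + f 4" for f :: "nat \<Rightarrow> real"
    by (simp add: eval_nat_numeral)
  have p2: "(real p ^ 2) powr (- (3 / 4)) = real p powr (- (3 / 2))"
  proof -
    have "(real p ^ 2) powr (- (3 / 4)) = (real p powr 2) powr (- (3 / 4))" using p by simp
    also have "\<dots> = real p powr (2 * (- (3 / 4)))" by (rule powr_powr)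
    finally show ?thesis by simp
  qed
  have le: "(real p ^ k) powr (- (3 / 4)) \<le> real p powr (- (3 / 2))" if "k \<ge> 2" for k
    unfolding p2[symmetric] using p that by (intro powr_mono2') (auto intro: power_increasing)
  have le': "(real p ^ k) powr (- (3 / 4)) \<le> 2 * real p powr (- (3 / 2))" if "k \<ge> 2" for k
    using le[OF that] powr_ge_zero[of "real p" "- (3 / 2)"] by linarith
  show ?thesis
  proof (cases "p = 2")
    case True
    have "(2 ^ k) powr (- (3 / 4)) \<le> (1 :: real)" for k
      using powr_mono2'[of "-(3/4)" 1 "2 ^ k :: real"] by simp
    from this[of 1] this[of 2] this[of 3] have
      "(\<Sum>k\<le>4. \<bar>corr_coeff 2 k\<bar> * (2 ^ k) powr (- (3 / 4))) \<le> (8 :: real)"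
      by (simp add: sum corr_coeff_def)
    moreover have "(2::real) powr (- 2) \<le> 2 powr (- (3 / 2))" by (intro powr_mono) auto
    moreover have "(2::real) powr (- 2) = 1 / 4" by (simp add: powr_minus)
    ultimately show ?thesis unfolding True by simp
  next
    case False
    then show ?thesis using le'[of 2] le'[of 3] le'[of 4] by (simp add: sum corr_coeff_def)
  qed
qed

definition primes_upto :: "nat \<Rightarrow> nat set" where "primes_upto N = {p. prime p \<and> p \<le> N}"

lemma primes_upto_prime: "\<forall>p\<in>primes_upto N. prime p"
  unfolding primes_upto_def by blast

lemma finite_primes_upto [simp]: "finite (primes_upto N)"
  by (rule finite_subset[of _ "{..N}"]) (auto simp: primes_upto_def)

lemma smooth_bounded_primes_upto:
  assumes "n \<in> {1..N}" "n \<notin> smooth_bounded 4 (primes_upto N)"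
  shows "mult_fun corr_coeff n = 0"
proof -
  have "prime_factors n \<subseteq> primes_upto N"
  proof
    fix p assume "p \<in> prime_factors n"
    then have "prime p" "p dvd n" by (auto simp: in_prime_factors_iff)
    then show "p \<in> primes_upto N"
      using assms(1) dvd_imp_le[of p n] by (simp add: primes_upto_def)
  qed
  then have "\<not> (\<forall>p. prime p \<longrightarrow> multiplicity p n \<le> 4)"
    using assms by (simp add: smooth_bounded_def)
  then obtain p where "prime p" "multiplicity p n > 4" using not_le by blast
  then show ?thesis by (rule mult_fun_corr_coeff_eq_0)
qed

definition corr_weight :: "nat \<Rightarrow> real" where "corr_weight n = \<bar>mult_fun corr_coeff n\<bar> * real n powr (- (3 / 4))"

lemma corr_weight_nonneg [simp]: "corr_weight n \<ge> 0" by (simp add: corr_weight_def)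

text \<open>The sum is an Euler product with factors \<open>1 + O(p powr (-3/2))\<close>. The exponent \<open>3/4\<close> can be any
  number strictly between \<open>1/2\<close> and \<open>1\<close>: above \<open>1/2\<close> the product converges, below \<open>1\<close> there is room for
  logarithms and for tails.\<close>

lemma sum_weight_bounded:
  obtains M where "M \<ge> 0" "\<And>N. (\<Sum>n\<in>smooth_bounded 4 (primes_upto N). corr_weight n) \<le> M"
proof
  define S where "S = (\<Sum>n. real n powr (- (3 / 2)))"
  have sm: "summable (\<lambda>n. real n powr (- (3 / 2)))" by (simp add: summable_real_powr_iff)
  (* 1 + u is at most exp u, so the Euler product is at most the exponential of a convergent sum *)
  show "exp (34 * S) \<ge> 0" by simp
  fix N
  have "corr_weight n = mult_fun (\<lambda>p k. \<bar>corr_coeff p k\<bar> * (real p ^ k) powr (- (3 / 4))) n"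
    if "n \<in> smooth_bounded 4 (primes_upto N)" for n
    using that by (simp add: corr_weight_def mult_fun_times mult_fun_abs mult_fun_powr smooth_bounded_def)
  then have "(\<Sum>n\<in>smooth_bounded 4 (primes_upto N). corr_weight n)
     = (\<Sum>n\<in>smooth_bounded 4 (primes_upto N). mult_fun (\<lambda>p k. \<bar>corr_coeff p k\<bar> * (real p ^ k) powr (- (3 / 4))) n)"
    by (intro sum.cong refl)
  also have "\<dots> = (\<Prod>p\<in>primes_upto N. \<Sum>k\<le>4. \<bar>corr_coeff p k\<bar> * (real p ^ k) powr (- (3 / 4)))"
    by (rule sum_mult_fun_smooth_bounded[OF finite_primes_upto primes_upto_prime]) (auto simp: prime_gt_0_nat)
  also have "\<dots> \<le> (\<Prod>p\<in>primes_upto N. exp (34 * real p powr (- (3 / 2))))"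
  proof (rule prod_mono, safe)
    fix p assume "p \<in> primes_upto N"
    then have "(\<Sum>k\<le>4. \<bar>corr_coeff p k\<bar> * (real p ^ k) powr (- (3 / 4))) \<le> 1 + 34 * real p powr (- (3 / 2))"
      by (intro sum_powr_corr_coeff_le) (simp add: primes_upto_def)
    also have "\<dots> \<le> exp (34 * real p powr (- (3 / 2)))" by (rule exp_ge_add_one_self)
    finally show "(\<Sum>k\<le>4. \<bar>corr_coeff p k\<bar> * (real p ^ k) powr (- (3 / 4))) \<le> exp (34 * real p powr (- (3 / 2)))" .
  qed (auto intro!: sum_nonneg)
  also have "\<dots> = exp (34 * (\<Sum>p\<in>primes_upto N. real p powr (- (3 / 2))))"
    by (simp add: exp_sum sum_distrib_left)
  also have "\<dots> \<le> exp (34 * S)"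
    using sum_le_suminf[OF sm, of "primes_upto N"] by (simp add: S_def)
  finally show "(\<Sum>n\<in>smooth_bounded 4 (primes_upto N). corr_weight n) \<le> exp (34 * S)" .
qed

definition euler_factor :: "nat \<Rightarrow> real" where
  "euler_factor p = (if prime p then (1 - 1 / real p) ^ 3 * (1 + 3 / real p) else 1)"

lemma euler_factor_poly: "(1 - t) ^ 3 * (1 + 3 * t) = 1 - 6 * t ^ 2 + 8 * t ^ 3 - 3 * t ^ 4" for t :: real
  by (simp add: eval_nat_numeral algebra_simps)

lemma local_factor_corr_coeff:
  assumes "prime p"
  shows "(\<Sum>k\<le>4. corr_coeff p k * (real p ^ k) powr (- 1)) = (if p = 2 then 2 / 5 else 1) * euler_factor p"
proof -
  define t where "t = 1 / real p"
  have sum: "(\<Sum>k\<le>4. f k) = f 0 + f 1 + f 2 + f 3 + f 4" for f :: "nat \<Rightarrow> real"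
    by (simp add: eval_nat_numeral)
  have "(\<Sum>k\<le>4. corr_coeff p k * (real p ^ k) powr (- 1)) = (\<Sum>k\<le>4. corr_coeff p k * t ^ k)"
    by (intro sum.cong refl) (simp add: t_def powr_minus divide_inverse power_inverse)
  also have "\<dots> = (if p = 2 then 2 / 5 else 1) * ((1 - t) ^ 3 * (1 + 3 * t))"
  proof (cases "p = 2")
    case True
    then have t: "t = 1 / 2" by (simp add: t_def)
    show ?thesis unfolding t sum True by (simp add: corr_coeff_def power_divide)
  next
    case False
    then show ?thesis unfolding euler_factor_poly by (simp add: sum corr_coeff_def)
  qed
  also have "(1 - t) ^ 3 * (1 + 3 * t) = euler_factor p"
    using assms by (simp add: euler_factor_def t_def)
  finally show ?thesis .
qed

lemma euler_product_converges: "(\<lambda>N. \<Prod>p\<le>N. euler_factor p) \<longlonglongrightarrow> (\<Prod>p. euler_factor p)"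
proof -
  have le: "norm (euler_factor p - 1) \<le> 17 * real p powr (- 2)" for p
  proof (cases "prime p")
    case True
    then have p: "real p \<ge> 1" using prime_ge_1_nat[OF True] by simp
    define t where "t = 1 / real p"
    have t: "0 \<le> t" "t \<le> 1" using p by (auto simp: t_def)
    have "euler_factor p = (1 - t) ^ 3 * (1 + 3 * t)"
      using True by (simp add: euler_factor_def t_def)
    also have "\<dots> - 1 = t\<^sup>2 * (- 6 + 8 * t - 3 * t\<^sup>2)"
      unfolding euler_factor_poly by (simp add: eval_nat_numeral algebra_simps)
    finally have "norm (euler_factor p - 1) = t\<^sup>2 * \<bar>- 6 + 8 * t - 3 * t\<^sup>2\<bar>"
      by (simp add: abs_mult)
    also have "\<dots> \<le> t\<^sup>2 * 17"
    proof (rule mult_left_mono)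
      have "t\<^sup>2 \<le> 1" using t by (simp add: power_le_one)
      then show "\<bar>- 6 + 8 * t - 3 * t\<^sup>2\<bar> \<le> 17" using t zero_le_power2[of t] unfolding abs_le_iff by linarith
    qed simp
    also have "t\<^sup>2 = real p powr (- 2)"
      using p by (simp add: t_def powr_minus_divide power_divide)
    finally show ?thesis by simp
  qed (simp add: euler_factor_def)
  have "summable (\<lambda>p. 17 * real p powr (- 2))"
    by (intro summable_mult) (simp add: summable_real_powr_iff)
  then have "summable (\<lambda>p. norm (euler_factor p - 1))"
    by (rule summable_comparison_test'[where N = 0]) (use le in simp)
  then have "convergent_prod euler_factor"
    by (intro abs_convergent_prod_imp_convergent_prod) (simp add: abs_convergent_prod_conv_summable)
  then show ?thesis by (rule convergent_prod_LIMSEQ)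
qed

lemma prod_local_factor_corr_coeff:
  assumes "N \<ge> 2"
  shows "(\<Prod>p\<in>primes_upto N. \<Sum>k\<le>4. corr_coeff p k * (real p ^ k) powr (- 1)) = 2 / 5 * (\<Prod>p\<le>N. euler_factor p)"
proof -
  have "(\<Prod>p\<in>primes_upto N. \<Sum>k\<le>4. corr_coeff p k * (real p ^ k) powr (- 1))
      = (\<Prod>p\<in>primes_upto N. (if p = 2 then 2 / 5 else 1) * euler_factor p)"
    by (intro prod.cong refl local_factor_corr_coeff) (simp add: primes_upto_def)
  also have "\<dots> = (\<Prod>p\<in>primes_upto N. (if p = 2 then 2 / 5 else 1)) * (\<Prod>p\<in>primes_upto N. euler_factor p)"
    by (rule prod.distrib)
  also have "(\<Prod>p\<in>primes_upto N. (if p = 2 then 2 / 5 else 1)) = (2 / 5 :: real)"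
    using assms by (subst prod.delta) (auto simp: primes_upto_def)
  also have "(\<Prod>p\<in>primes_upto N. euler_factor p) = (\<Prod>p\<le>N. euler_factor p)"
    by (rule prod.mono_neutral_left) (auto simp: primes_upto_def euler_factor_def)
  finally show ?thesis .
qed

text \<open>The factor \<open>2/5\<close> exchanges the Euler factor \<open>5/16\<close> at \<open>2\<close> for \<open>1/8\<close>.\<close>

definition pair_density :: real where "pair_density = 2 / 5 * (\<Prod>p. euler_factor p)"

lemma sum_weight_upto:
  assumes "\<And>N. (\<Sum>n\<in>smooth_bounded 4 (primes_upto N). corr_weight n) \<le> M"
  shows "(\<Sum>n\<in>{1..N}. corr_weight n) \<le> M"
proof -
  have fin: "finite (smooth_bounded 4 (primes_upto N))" by (rule finite_smooth_bounded[OF finite_primes_upto primes_upto_prime])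
  have "(\<Sum>n\<in>{1..N}. corr_weight n) = (\<Sum>n\<in>{1..N} \<inter> smooth_bounded 4 (primes_upto N). corr_weight n)"
    using smooth_bounded_primes_upto[of _ N]
    by (intro sum.mono_neutral_right) (auto simp: corr_weight_def)
  also have "\<dots> \<le> (\<Sum>n\<in>smooth_bounded 4 (primes_upto N). corr_weight n)"
    using fin by (intro sum_mono2) auto
  finally show ?thesis using assms[of N] by linarith
qed

lemma corr_coeff_term_le_weight:
  assumes "n \<ge> N" "N \<ge> 1"
  shows "\<bar>mult_fun corr_coeff n / real n\<bar> \<le> real N powr (- (1 / 4)) * corr_weight n"
proof -
  have n: "real n > 0" using assms by simp
  have "real n powr (- (3 / 4)) * real n powr (- (1 / 4)) = real n powr (- 1)"
    by (simp flip: powr_add)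
  also have "\<dots> = 1 / real n" using n by (simp add: powr_minus_divide)
  finally have "\<bar>mult_fun corr_coeff n / real n\<bar> = \<bar>mult_fun corr_coeff n\<bar> * (real n powr (- (3 / 4)) * real n powr (- (1 / 4)))"
    by simp
  also have "\<dots> \<le> \<bar>mult_fun corr_coeff n\<bar> * (real n powr (- (3 / 4)) * real N powr (- (1 / 4)))"
    using assms by (intro mult_left_mono powr_mono2') auto
  finally show ?thesis by (simp add: corr_weight_def mult_ac)
qed

lemma powr_neg_tendsto_0: "(\<lambda>N. real N powr (- (1 / 4)) * M) \<longlonglongrightarrow> 0"
  by real_asymp

text \<open>The finite Euler product over the primes up to \<open>N\<close> sums \<open>h(n) / n\<close> over all smooth \<open>n\<close>, thus over all
  \<open>n \<le> N\<close> and some larger ones, which contribute \<open>O(N powr (-1/4))\<close>. This identifies the limit of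
  the partial sums, and the same tail bound gives the rate of convergence.\<close>

lemma partial_sums_to_density:
  assumes M: "\<And>N. (\<Sum>n\<in>smooth_bounded 4 (primes_upto N). corr_weight n) \<le> M" and N: "N \<ge> 1"
  shows "\<bar>(\<Sum>n\<in>{1..N}. mult_fun corr_coeff n / real n) - pair_density\<bar> \<le> real N powr (- (1 / 4)) * M"
proof -
  define c where "c N = (\<Sum>n\<in>{1..N}. mult_fun corr_coeff n / real n)" for N
  define P where "P N = (\<Sum>n\<in>smooth_bounded 4 (primes_upto N). mult_fun corr_coeff n / real n)" for N
  have "P N = 2 / 5 * (\<Prod>p\<le>N. euler_factor p)" if "N \<ge> 2" for N
  proof -
    have "P N = (\<Sum>n\<in>smooth_bounded 4 (primes_upto N). mult_fun (\<lambda>p k. corr_coeff p k * (real p ^ k) powr (- 1)) n)"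
      unfolding P_def
    proof (intro sum.cong refl)
      fix n assume "n \<in> smooth_bounded 4 (primes_upto N)"
      then have n: "n > 0" by (simp add: smooth_bounded_def)
      then have "mult_fun corr_coeff n / real n = mult_fun corr_coeff n * real n powr (- 1)"
        by (simp add: powr_minus_divide)
      then show "mult_fun corr_coeff n / real n = mult_fun (\<lambda>p k. corr_coeff p k * (real p ^ k) powr (- 1)) n"
        unfolding mult_fun_times mult_fun_powr[OF n] .
    qed
    also have "\<dots> = (\<Prod>p\<in>primes_upto N. \<Sum>k\<le>4. corr_coeff p k * (real p ^ k) powr (- 1))"
      by (rule sum_mult_fun_smooth_bounded[OF finite_primes_upto primes_upto_prime]) (auto simp: prime_gt_0_nat)
    finally show ?thesis using prod_local_factor_corr_coeff[OF that] by simp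
  qed
  then have "\<forall>\<^sub>F N in sequentially. 2 / 5 * (\<Prod>p\<le>N. euler_factor p) = P N"
    by (intro eventually_sequentiallyI[of 2]) auto
  moreover have "(\<lambda>N. 2 / 5 * (\<Prod>p\<le>N. euler_factor p)) \<longlonglongrightarrow> pair_density"
    unfolding pair_density_def by (intro tendsto_mult_left euler_product_converges)
  ultimately have Plim: "P \<longlonglongrightarrow> pair_density" by (rule Lim_transform_eventually[rotated])
  have diff: "norm (P N - c N) \<le> real N powr (- (1 / 4)) * M" if "N \<ge> 1" for N
  proof -
    let ?S = "smooth_bounded 4 (primes_upto N)"
    have fin: "finite ?S" by (rule finite_smooth_bounded[OF finite_primes_upto primes_upto_prime])
    have "c N = (\<Sum>n\<in>{1..N} \<inter> ?S. mult_fun corr_coeff n / real n)"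
      unfolding c_def using smooth_bounded_primes_upto[of _ N]
      by (intro sum.mono_neutral_right) auto
    then have "P N - c N = (\<Sum>n\<in>?S - {1..N} \<inter> ?S. mult_fun corr_coeff n / real n)"
      unfolding P_def using fin by (subst sum_diff) auto
    also have "norm \<dots> \<le> (\<Sum>n\<in>?S - {1..N} \<inter> ?S. real N powr (- (1 / 4)) * corr_weight n)"
      using that unfolding real_norm_def
      by (intro order_trans[OF sum_abs] sum_mono corr_coeff_term_le_weight) (auto simp: smooth_bounded_def)
    also have "\<dots> \<le> (\<Sum>n\<in>?S. real N powr (- (1 / 4)) * corr_weight n)"
      using fin by (intro sum_mono2) auto
    also have "\<dots> \<le> real N powr (- (1 / 4)) * M"
      using M by (simp flip: sum_distrib_left add: mult_left_mono)
    finally show ?thesis .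
  qed
  have "(\<lambda>N. P N - c N) \<longlonglongrightarrow> 0"
    using eventually_sequentiallyI[of 1, OF diff] powr_neg_tendsto_0[of M] by (rule Lim_null_comparison)
  from tendsto_diff[OF Plim this] have clim: "c \<longlonglongrightarrow> pair_density" by simp
  have "\<bar>c N - c N'\<bar> \<le> real N powr (- (1 / 4)) * M" if "N' \<ge> N" for N'
  proof -
    have "c N' = c N + (\<Sum>n\<in>{N<..N'}. mult_fun corr_coeff n / real n)"
      unfolding c_def using that N by (subst sum.union_disjoint[symmetric]) (auto intro!: sum.cong)
    then have "\<bar>c N - c N'\<bar> = \<bar>\<Sum>n\<in>{N<..N'}. mult_fun corr_coeff n / real n\<bar>" by simp
    also have "\<dots> \<le> (\<Sum>n\<in>{N<..N'}. real N powr (- (1 / 4)) * corr_weight n)"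
      using N by (intro order_trans[OF sum_abs] sum_mono corr_coeff_term_le_weight) auto
    also have "\<dots> \<le> (\<Sum>n\<in>{1..N'}. real N powr (- (1 / 4)) * corr_weight n)"
      by (intro sum_mono2) auto
    also have "\<dots> \<le> real N powr (- (1 / 4)) * M"
      using sum_weight_upto[OF M, of N'] by (simp flip: sum_distrib_left add: mult_left_mono)
    finally show ?thesis .
  qed
  then have "\<forall>\<^sub>F N' in sequentially. \<bar>c N - c N'\<bar> \<le> real N powr (- (1 / 4)) * M"
    by (intro eventually_sequentiallyI[of N]) auto
  moreover have "(\<lambda>N'. \<bar>c N - c N'\<bar>) \<longlonglongrightarrow> \<bar>c N - pair_density\<bar>"
    by (intro tendsto_intros clim)
  ultimately show ?thesis unfolding c_def[of N, symmetric]
    by (intro tendsto_upperbound) auto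
qed

lemma ln_le_powr_quarter: "x \<ge> 1 \<Longrightarrow> ln x \<le> 4 * x powr (1 / 4)" for x :: real
  using ln_powr_bound[of x "1 / 4"] by simp

text \<open>In \<open>\<Sum>d\<le>x. h(d) D(x / d)\<close>, with \<open>D\<close> the ternary divisor sum, replace \<open>D(x / d)\<close> by
  \<open>(x / d) (ln x)\<^sup>2 / 2\<close>. The error per term is at most \<open>9 x (1 + ln x)\<close> times the weight of \<open>d\<close>, because
  \<open>ln d \<le> 4 d powr (1/4)\<close>. Completing the series of \<open>h(d) / d\<close> costs a further \<open>4 x ln x\<close>, so
  \<open>13\<close> times the bound for the weights is an admissible constant.\<close>

theorem summatory_mult_fun_lcm_coeff_asymptotic:
  obtains K where "\<And>x. x \<ge> 1 \<Longrightarrow>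
    \<bar>summatory (mult_fun lcm_coeff) x - pair_density * x * (ln x)\<^sup>2 / 2\<bar> \<le> K * x * (1 + ln x)"
proof -
  obtain M where M0: "M \<ge> 0" and M: "\<And>N. (\<Sum>n\<in>smooth_bounded 4 (primes_upto N). corr_weight n) \<le> M"
    using sum_weight_bounded by blast
  show thesis
  proof (rule that[of "13 * M"])
    fix x :: real assume x: "x \<ge> 1"
    define N where "N = nat \<lfloor>x\<rfloor>"
    have N: "N \<ge> 1" "real N \<le> x" "x < real N + 1" using nat_floor_props[OF x] by (auto simp: N_def)
    have lx: "ln x \<ge> 0" using x by simp
    define c where "c = (\<Sum>n\<in>{1..N}. mult_fun corr_coeff n / real n)"
    have bd: "\<bar>mult_fun corr_coeff d * ternary_divisor_sum (x / real d) - mult_fun corr_coeff d / real d * (x * (ln x)\<^sup>2 / 2)\<bar>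
        \<le> 9 * x * (1 + ln x) * corr_weight d" if d: "d \<in> {1..N}" for d
    proof -
      have d1: "real d \<ge> 1" "real d \<le> x" using d N by auto
      define y where "y = x / real d"
      have y: "y \<ge> 1" "y > 0" using d1 by (auto simp: y_def)
      have lny: "ln y = ln x - ln (real d)" using d1 x by (simp add: y_def ln_div)
      have ld: "0 \<le> ln (real d)" "ln (real d) \<le> ln x" using d1 by auto
      define q where "q = real d powr (1 / 4)"
      have q: "q \<ge> 1" "ln (real d) \<le> 4 * q"
        using d1 ge_one_powr_ge_zero[of "real d" "1/4"] ln_le_powr_quarter[of "real d"] by (auto simp: q_def)
      have "(ln x)\<^sup>2 - (ln y)\<^sup>2 = ln (real d) * (2 * ln x - ln (real d))"
        by (simp add: lny power2_eq_square algebra_simps)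
      moreover have "ln (real d) * (2 * ln x - ln (real d)) \<le> ln (real d) * (2 * ln x)"
        "0 \<le> ln (real d) * (2 * ln x - ln (real d))" using ld lx by (auto intro!: mult_left_mono)
      moreover have "ln (real d) * (2 * ln x) \<le> 4 * q * (2 * ln x)" using q lx by (intro mult_right_mono) auto
      ultimately have sq: "\<bar>(ln y)\<^sup>2 / 2 - (ln x)\<^sup>2 / 2\<bar> \<le> 4 * q * ln x" by linarith
      have "\<bar>ternary_divisor_sum y - y * (ln x)\<^sup>2 / 2\<bar>
          \<le> \<bar>ternary_divisor_sum y - y * (ln y)\<^sup>2 / 2\<bar> + y * \<bar>(ln y)\<^sup>2 / 2 - (ln x)\<^sup>2 / 2\<bar>"
      proof -
        have "y * \<bar>(ln y)\<^sup>2 / 2 - (ln x)\<^sup>2 / 2\<bar> = \<bar>y * ((ln y)\<^sup>2 / 2 - (ln x)\<^sup>2 / 2)\<bar>"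
          using y by (simp add: abs_mult)
        also have "\<dots> = \<bar>y * (ln y)\<^sup>2 / 2 - y * (ln x)\<^sup>2 / 2\<bar>" by (simp add: right_diff_distrib)
        finally show ?thesis by linarith
      qed
      also have "\<dots> \<le> 5 * y * (1 + ln y) + y * (4 * q * ln x)"
        using ternary_divisor_sum_bound[OF y(1)] sq y by (intro add_mono mult_left_mono) auto
      also have "\<dots> \<le> y * (9 * q * (1 + ln x))"
      proof -
        have "1 * (1 + ln y) \<le> q * (1 + ln x)" using q lny ld y lx by (intro mult_mono) auto
        then have "5 * (1 + ln y) + 4 * q * ln x \<le> 9 * q * (1 + ln x)" using q by (simp add: algebra_simps)
        then have "y * (5 * (1 + ln y) + 4 * q * ln x) \<le> y * (9 * q * (1 + ln x))"
          using y by (intro mult_left_mono) auto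
        then show ?thesis by (simp add: algebra_simps)
      qed
      finally have T: "\<bar>ternary_divisor_sum y - y * (ln x)\<^sup>2 / 2\<bar> \<le> y * (9 * q * (1 + ln x))" .
      have "mult_fun corr_coeff d * ternary_divisor_sum y - mult_fun corr_coeff d / real d * (x * (ln x)\<^sup>2 / 2)
         = mult_fun corr_coeff d * (ternary_divisor_sum y - y * (ln x)\<^sup>2 / 2)"
        by (simp add: y_def algebra_simps)
      then have "\<bar>mult_fun corr_coeff d * ternary_divisor_sum y - mult_fun corr_coeff d / real d * (x * (ln x)\<^sup>2 / 2)\<bar>
         \<le> \<bar>mult_fun corr_coeff d\<bar> * (y * (9 * q * (1 + ln x)))"
        using mult_left_mono[OF T, of "\<bar>mult_fun corr_coeff d\<bar>"] by (simp add: abs_mult)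
      also have "y * q = x * real d powr (- (3 / 4))"
        using d1 by (simp add: y_def q_def powr_diff[of "real d" "1/4" 1, simplified])
      then have "\<bar>mult_fun corr_coeff d\<bar> * (y * (9 * q * (1 + ln x))) = 9 * x * (1 + ln x) * corr_weight d"
        by (simp add: corr_weight_def mult_ac)
      finally show ?thesis by (simp add: y_def)
    qed
    have "\<bar>summatory (mult_fun lcm_coeff) x - c * (x * (ln x)\<^sup>2 / 2)\<bar>
       = \<bar>\<Sum>d\<in>{1..N}. mult_fun corr_coeff d * ternary_divisor_sum (x / real d) - mult_fun corr_coeff d / real d * (x * (ln x)\<^sup>2 / 2)\<bar>"
      using x by (simp only: summatory_mult_fun_lcm_coeff c_def N_def sum_subtractf sum_distrib_right)
    also have "\<dots> \<le> (\<Sum>d\<in>{1..N}. 9 * x * (1 + ln x) * corr_weight d)"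
      by (intro order_trans[OF sum_abs] sum_mono bd)
    also have "\<dots> = 9 * x * (1 + ln x) * (\<Sum>d\<in>{1..N}. corr_weight d)" by (simp add: sum_distrib_left)
    also have "\<dots> \<le> 9 * x * (1 + ln x) * M"
      using sum_weight_upto[OF M, of N] x lx by (intro mult_left_mono) auto
    finally have A: "\<bar>summatory (mult_fun lcm_coeff) x - c * (x * (ln x)\<^sup>2 / 2)\<bar> \<le> 9 * x * (1 + ln x) * M" .
    have "\<bar>c - pair_density\<bar> \<le> real N powr (- (1 / 4)) * M"
      using partial_sums_to_density[OF M N(1)] by (simp add: c_def)
    also have "real N powr (- (1 / 4)) \<le> (x / 2) powr (- (1 / 4))"
    proof (rule powr_mono2')
      have "real N \<ge> 1" using N by simp
      then show "x / 2 \<le> real N" using N by linarith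
    qed (use x in auto)
    also have "(x / 2) powr (- (1 / 4)) = x powr (- (1 / 4)) * 2 powr (1 / 4)"
      using x by (simp add: powr_divide powr_minus field_simps)
    also have "(2 :: real) powr (1 / 4) \<le> 2 powr 1" by (intro powr_mono) auto
    finally have c: "\<bar>c - pair_density\<bar> \<le> x powr (- (1 / 4)) * 2 * M"
      using M0 by (simp add: mult_right_mono mult_left_mono)
    have "\<bar>c * (x * (ln x)\<^sup>2 / 2) - pair_density * x * (ln x)\<^sup>2 / 2\<bar> = \<bar>c - pair_density\<bar> * (x * (ln x)\<^sup>2 / 2)"
    proof -
      have "c * (x * (ln x)\<^sup>2 / 2) - pair_density * x * (ln x)\<^sup>2 / 2 = (c - pair_density) * (x * (ln x)\<^sup>2 / 2)"
        by (simp add: algebra_simps)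
      then show ?thesis using x by (simp only: abs_mult) simp
    qed
    also have "\<dots> \<le> (x powr (- (1 / 4)) * 2 * M) * (x * (ln x)\<^sup>2 / 2)"
      using c x by (intro mult_right_mono) auto
    also have "\<dots> = M * x * ln x * (x powr (- (1 / 4)) * ln x)" by (simp add: power2_eq_square)
    also have "x powr (- (1 / 4)) * ln x \<le> x powr (- (1 / 4)) * (4 * x powr (1 / 4))"
      using ln_le_powr_quarter[OF x] by (intro mult_left_mono) auto
    also have "\<dots> = 4" using x by (simp flip: powr_add)
    finally have B: "\<bar>c * (x * (ln x)\<^sup>2 / 2) - pair_density * x * (ln x)\<^sup>2 / 2\<bar> \<le> M * x * ln x * 4"
      using M0 x lx by (simp add: mult_left_mono)
    have "M * x * ln x * 4 \<le> 4 * x * (1 + ln x) * M" using M0 x by (simp add: algebra_simps)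
    then show "\<bar>summatory (mult_fun lcm_coeff) x - pair_density * x * (ln x)\<^sup>2 / 2\<bar> \<le> 13 * M * x * (1 + ln x)"
      using A B by (simp add: algebra_simps)
  qed
qed

section \<open>Pairs of odd squarefree numbers with given lcm\<close>

definition odd_squarefree :: "nat set" where "odd_squarefree = {n. odd n \<and> squarefree n}"

definition lcm_pairs :: "nat \<Rightarrow> (nat \<times> nat) set" where
  "lcm_pairs r = {(M, N). M \<in> odd_squarefree \<and> N \<in> odd_squarefree \<and> lcm M N = r}"

lemma odd_squarefree_pos: "M \<in> odd_squarefree \<Longrightarrow> M > 0"
  by (auto simp: odd_squarefree_def intro!: Nat.gr0I)

lemma lcm_prime_power_mult:
  fixes p M N :: nat
  assumes "prime p" "\<not> p dvd M" "\<not> p dvd N"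
  shows "lcm (p ^ i * M) (p ^ j * N) = p ^ max i j * lcm M N"
proof (rule dvd_antisym)
  show "lcm (p ^ i * M) (p ^ j * N) dvd p ^ max i j * lcm M N"
    by (intro lcm_least mult_dvd_mono le_imp_power_dvd) auto
  have "p ^ max i j dvd lcm (p ^ i * M) (p ^ j * N)"
    by (cases "i \<le> j") (auto simp: max_def intro: dvd_trans[OF dvd_triv_left dvd_lcm1] dvd_trans[OF dvd_triv_left dvd_lcm2])
  moreover have "lcm M N dvd lcm (p ^ i * M) (p ^ j * N)"
    by (intro lcm_mono) auto
  moreover have "\<not> p dvd lcm M N"
    using assms prime_dvd_mult_iff[of p M N] dvd_trans[OF _ lcm_least[of M "M * N" N]] by auto
  then have "coprime (p ^ max i j) (lcm M N)"
    using assms by (simp add: prime_imp_coprime)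
  ultimately show "p ^ max i j * lcm M N dvd lcm (p ^ i * M) (p ^ j * N)"
    by (rule divides_mult)
qed

lemma odd_squarefree_prime_power_mult:
  fixes p M :: nat
  assumes "prime p" "\<not> p dvd M"
  shows "p ^ i * M \<in> odd_squarefree \<longleftrightarrow> M \<in> odd_squarefree \<and> i \<le> 1 \<and> (p = 2 \<longrightarrow> i = 0)"
proof -
  have cop: "coprime (p ^ i) M" using assms by (simp add: prime_imp_coprime)
  have sq: "squarefree (p ^ i * M) \<longleftrightarrow> squarefree (p ^ i) \<and> squarefree M"
    using squarefree_mult_coprime[OF cop] squarefree_multD by blast
  have "squarefree (p ^ i) \<longleftrightarrow> i \<le> 1"
    using assms(1) squarefree_prime[of p] by (auto simp: squarefree_power_iff le_Suc_eq not_prime_unit)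
  moreover have "odd (p ^ i * M) \<longleftrightarrow> odd M \<and> (p = 2 \<longrightarrow> i = 0)"
    using assms by (cases "i = 0") (auto simp: dest: primes_dvd_imp_eq[OF two_is_prime_nat])
  ultimately show ?thesis using sq by (auto simp: odd_squarefree_def)
qed

definition exponent_pairs :: "nat \<Rightarrow> nat \<Rightarrow> (nat \<times> nat) set" where
  "exponent_pairs p k = {(i, j). i \<le> 1 \<and> j \<le> 1 \<and> max i j = k \<and> (p = 2 \<longrightarrow> k = 0)}"

lemma card_exponent_pairs: "real (card (exponent_pairs p k)) = lcm_coeff p k"
proof -
  have "exponent_pairs p k = (if k = 0 then {(0, 0)} else if k = 1 \<and> p \<noteq> 2 then {(0, 1), (1, 0), (1, 1)} else {})"
    by (auto simp: exponent_pairs_def max_def le_Suc_eq split: if_splits)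
  then show ?thesis by (simp add: lcm_coeff_def)
qed

lemma bij_betw_lcm_pairs:
  assumes p: "prime p" and m: "m > 0" "\<not> p dvd m"
  shows "bij_betw (\<lambda>((i, j), (M, N)). (p ^ i * M, p ^ j * N)) (exponent_pairs p k \<times> lcm_pairs m) (lcm_pairs (p ^ k * m))"
proof (rule bij_betw_byWitness[where f' = "\<lambda>(M, N). ((multiplicity p M, multiplicity p N),
        (M div p ^ multiplicity p M, N div p ^ multiplicity p N))"])
  have nd: "\<not> p dvd M" "\<not> p dvd N" "M > 0" "N > 0" if "(M, N) \<in> lcm_pairs m" for M N
    using that m odd_squarefree_pos dvd_trans[of p M m] dvd_trans[of p N m] by (auto simp: lcm_pairs_def)
  have mult: "multiplicity p (p ^ i * M) = i" if "\<not> p dvd M" "M > 0" for i M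
    using multiplicity_prime_power_mult[OF p p] that by simp
  show "\<forall>a\<in>exponent_pairs p k \<times> lcm_pairs m.
      (case case a of (x, y) \<Rightarrow> (case x of (i, j) \<Rightarrow> \<lambda>(M, N). (p ^ i * M, p ^ j * N)) y of
        (M, N) \<Rightarrow> ((multiplicity p M, multiplicity p N), M div p ^ multiplicity p M, N div p ^ multiplicity p N)) = a"
    using nd p by (auto simp: mult prime_gt_0_nat)
  show "\<forall>a'\<in>lcm_pairs (p ^ k * m).
      (case case a' of (M, N) \<Rightarrow> ((multiplicity p M, multiplicity p N), M div p ^ multiplicity p M, N div p ^ multiplicity p N) of
        (x, y) \<Rightarrow> (case x of (i, j) \<Rightarrow> \<lambda>(M, N). (p ^ i * M, p ^ j * N)) y) = a'"
    by (auto simp: multiplicity_dvd)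
  show "(\<lambda>((i, j), (M, N)). (p ^ i * M, p ^ j * N)) ` (exponent_pairs p k \<times> lcm_pairs m) \<subseteq> lcm_pairs (p ^ k * m)"
  proof safe
    fix i j M N assume ij: "(i, j) \<in> exponent_pairs p k" and MN: "(M, N) \<in> lcm_pairs m"
    then show "(p ^ i * M, p ^ j * N) \<in> lcm_pairs (p ^ k * m)"
      using nd[OF MN] p
      by (auto simp: lcm_pairs_def lcm_prime_power_mult odd_squarefree_prime_power_mult exponent_pairs_def max_def split: if_splits)
  qed
  show "(\<lambda>(M, N). ((multiplicity p M, multiplicity p N), M div p ^ multiplicity p M, N div p ^ multiplicity p N))
      ` lcm_pairs (p ^ k * m) \<subseteq> exponent_pairs p k \<times> lcm_pairs m"
  proof (rule subsetI)
    fix z assume "z \<in> (\<lambda>(M, N). ((multiplicity p M, multiplicity p N), M div p ^ multiplicity p M, N div p ^ multiplicity p N))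
      ` lcm_pairs (p ^ k * m)"
    then obtain M' N' where MN': "(M', N') \<in> lcm_pairs (p ^ k * m)"
      and z: "z = ((multiplicity p M', multiplicity p N'), M' div p ^ multiplicity p M', N' div p ^ multiplicity p N')"
      by auto
    define i where "i = multiplicity p M'"
    define j where "j = multiplicity p N'"
    define M where "M = M' div p ^ i"
    define N where "N = N' div p ^ j"
    have M': "M' = p ^ i * M" and N': "N' = p ^ j * N"
      by (simp_all add: M_def N_def i_def j_def multiplicity_dvd)
    have pos: "M' > 0" "N' > 0" using MN' odd_squarefree_pos by (auto simp: lcm_pairs_def)
    have nM: "\<not> p dvd M" "\<not> p dvd N"
      unfolding M_def N_def i_def j_def using pos not_prime_unit[of p] p
        multiplicity_decompose[of M' p] multiplicity_decompose[of N' p] by blast+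
    have eq: "p ^ max i j * lcm M N = p ^ k * m"
      using MN' nM p by (simp add: lcm_pairs_def M' N' lcm_prime_power_mult)
    have "lcm M N > 0" using pos M' N' by (auto simp: lcm_pos_nat)
    moreover have "\<not> p dvd lcm M N"
      using nM p prime_dvd_mult_iff[of p M N] dvd_trans[OF _ lcm_least[of M "M * N" N]] by auto
    ultimately have k: "max i j = k"
      using multiplicity_prime_power_mult[OF p p, of "lcm M N" "max i j"] multiplicity_prime_power_mult[OF p p m, of k] eq
      by simp
    then have "lcm M N = m" using eq p by (simp add: prime_gt_0_nat)
    then have "(M, N) \<in> lcm_pairs m" "(i, j) \<in> exponent_pairs p k"
      using MN' k nM p by (auto simp: lcm_pairs_def M' N' odd_squarefree_prime_power_mult exponent_pairs_def)
    then show "z \<in> exponent_pairs p k \<times> lcm_pairs m"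
      by (simp add: z M_def N_def i_def j_def)
  qed
qed

text \<open>At each odd prime dividing \<open>r\<close> there are three choices, as the prime divides \<open>M\<close>, \<open>N\<close> or both.\<close>

lemma card_lcm_pairs:
  assumes "r > 0" shows "real (card (lcm_pairs r)) = mult_fun lcm_coeff r"
  using assms
proof (induction r rule: prime_power_cofactor_induct)
  case one
  have "lcm_pairs 1 = {(1, 1)}"
    by (auto simp: lcm_pairs_def odd_squarefree_def)
  then show ?case by simp
next
  case (prime_power p k m)
  have "card (lcm_pairs (p ^ k * m)) = card (exponent_pairs p k) * card (lcm_pairs m)"
    using bij_betw_same_card[OF bij_betw_lcm_pairs[OF prime_power(1,3,4), of k]]
    by (simp add: card_cartesian_product)
  then show ?case
    using prime_power by (simp add: card_exponent_pairs mult_fun_prime_power_mult lcm_coeff_def[of _ 0])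
qed

definition bounded_lcm_pairs :: "real \<Rightarrow> (nat \<times> nat) set" where
  "bounded_lcm_pairs y = {(M, N). M \<in> odd_squarefree \<and> N \<in> odd_squarefree \<and> real (lcm M N) \<le> y}"

lemma finite_lcm_pairs: "r > 0 \<Longrightarrow> finite (lcm_pairs r)"
  by (rule finite_subset[of _ "{..r} \<times> {..r}"])
    (auto simp: lcm_pairs_def dest: dvd_imp_le[OF dvd_lcm1] dvd_imp_le[OF dvd_lcm2] intro!: dvd_imp_le)

lemma bounded_lcm_pairs_eq: "bounded_lcm_pairs y = (\<Union>r\<in>{1..nat \<lfloor>y\<rfloor>}. lcm_pairs r)"
proof -
  have "lcm M N > 0" if "M \<in> odd_squarefree" "N \<in> odd_squarefree" for M N
    using that odd_squarefree_pos by (simp add: lcm_pos_nat)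
  then show ?thesis
    by (fastforce simp: bounded_lcm_pairs_def lcm_pairs_def nat_floor_ge_iff Suc_le_eq)
qed

lemma finite_bounded_lcm_pairs: "finite (bounded_lcm_pairs y)"
  unfolding bounded_lcm_pairs_eq by (intro finite_UN_I finite_lcm_pairs) auto

lemma card_bounded_lcm_pairs: "real (card (bounded_lcm_pairs y)) = summatory (mult_fun lcm_coeff) y"
proof -
  have "card (bounded_lcm_pairs y) = (\<Sum>r\<in>{1..nat \<lfloor>y\<rfloor>}. card (lcm_pairs r))"
    unfolding bounded_lcm_pairs_eq
  proof (rule card_UN_disjoint)
    show "\<forall>i\<in>{1..nat \<lfloor>y\<rfloor>}. finite (lcm_pairs i)" by (auto intro: finite_lcm_pairs)
  qed (auto simp: lcm_pairs_def)
  then show ?thesis by (simp add: summatory_def card_lcm_pairs)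
qed

section \<open>The ring of algebraic integers\<close>

text \<open>The characteristic polynomial of an integer matrix is monic with integer coefficients.\<close>

lemma algebraic_int_eigenvalue:
  fixes B :: "int mat" and x :: complex
  assumes B: "B \<in> carrier_mat n n" and ev: "eigenvalue (map_mat of_int B) x"
  shows "algebraic_int x"
proof -
  have C: "(map_mat of_int B :: complex mat) \<in> carrier_mat n n" using B by simp
  have hom: "char_poly (map_mat of_int B :: complex mat) = map_poly of_int (char_poly B)"
    by (rule of_int_hom.char_poly_hom[OF B])
  show ?thesis
  proof (rule algebraic_int.intros)
    show "lead_coeff (char_poly (map_mat of_int B :: complex mat)) = 1"
      using degree_monic_char_poly[OF C] by simp
    show "\<forall>i. coeff (char_poly (map_mat of_int B :: complex mat)) i \<in> \<int>"
      unfolding hom by (simp add: coeff_map_poly)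
    show "poly (char_poly (map_mat of_int B)) x = (0 :: complex)"
      using eigenvalue_root_char_poly[OF C] ev by simp
  qed
qed

definition integer_span :: "'i set \<Rightarrow> ('i \<Rightarrow> complex) \<Rightarrow> complex set" where
  "integer_span I w = {\<Sum>j\<in>I. of_int (c j) * w j |c. True}"

lemma integer_spanI: "x = (\<Sum>j\<in>I. of_int (c j) * w j) \<Longrightarrow> x \<in> integer_span I w"
  by (auto simp: integer_span_def)

lemma integer_span_0: "0 \<in> integer_span I w"
  by (rule integer_spanI[where c = "\<lambda>_. 0"]) simp

lemma integer_span_add:
  assumes "x \<in> integer_span I w" "y \<in> integer_span I w"
  shows "x + y \<in> integer_span I w"
proof -
  obtain c d where "x = (\<Sum>j\<in>I. of_int (c j) * w j)" "y = (\<Sum>j\<in>I. of_int (d j) * w j)"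
    using assms by (auto simp: integer_span_def)
  then show ?thesis
    by (intro integer_spanI[where c = "\<lambda>j. c j + d j"]) (simp add: sum.distrib distrib_right)
qed

lemma integer_span_scale:
  assumes "x \<in> integer_span I w"
  shows "of_int k * x \<in> integer_span I w"
proof -
  obtain c where "x = (\<Sum>j\<in>I. of_int (c j) * w j)"
    using assms by (auto simp: integer_span_def)
  then show ?thesis
    by (intro integer_spanI[where c = "\<lambda>j. k * c j"]) (simp add: sum_distrib_left mult_ac)
qed

lemma integer_span_sum:
  assumes "\<And>a. a \<in> A \<Longrightarrow> f a \<in> integer_span I w"
  shows "sum f A \<in> integer_span I w"
  using assms by (induction A rule: infinite_finite_induct) (auto intro: integer_span_0 integer_span_add)

lemma integer_span_gen:
  assumes "finite I" "i \<in> I" shows "w i \<in> integer_span I w"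
proof (rule integer_spanI[where c = "\<lambda>j. if j = i then 1 else 0"])
  have "(\<Sum>j\<in>I. of_int (if j = i then 1 else 0) * w j) = (\<Sum>j\<in>I. if j = i then w j else 0)"
    by (intro sum.cong) auto
  then show "w i = (\<Sum>j\<in>I. of_int (if j = i then 1 else 0) * w j)" using assms by simp
qed

text \<open>Invariance of the group generated by the \<open>w i\<close> under multiplication by \<open>x\<close>; by linearity it is enough to
  ask for it on the generators (\<open>stabilizes_span\<close>).\<close>

definition stabilizes :: "'i set \<Rightarrow> ('i \<Rightarrow> complex) \<Rightarrow> complex \<Rightarrow> bool" where
  "stabilizes I w x \<longleftrightarrow> (\<forall>i\<in>I. x * w i \<in> integer_span I w)"

lemma stabilizes_span:
  assumes "stabilizes I w x" "y \<in> integer_span I w"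
  shows "x * y \<in> integer_span I w"
proof -
  obtain c where "y = (\<Sum>j\<in>I. of_int (c j) * w j)"
    using assms(2) by (auto simp: integer_span_def)
  then have "x * y = (\<Sum>j\<in>I. of_int (c j) * (x * w j))"
    by (simp add: sum_distrib_left mult_ac)
  then show ?thesis
    using assms(1) by (auto simp: stabilizes_def intro!: integer_span_sum integer_span_scale)
qed

lemma stabilizes_add: "stabilizes I w x \<Longrightarrow> stabilizes I w y \<Longrightarrow> stabilizes I w (x + y)"
  by (auto simp: stabilizes_def distrib_right intro: integer_span_add)

lemma stabilizes_mult: "stabilizes I w x \<Longrightarrow> stabilizes I w y \<Longrightarrow> stabilizes I w (x * y)"
  using stabilizes_span[of I w x] by (auto simp: stabilizes_def mult.assoc)

text \<open>The number \<open>x\<close> is an eigenvalue of the integer matrix of multiplication by \<open>x\<close>, with eigenvector \<open>w\<close>.\<close>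

lemma stabilizes_imp_algebraic_int:
  assumes fin: "finite I" and st: "stabilizes I w x" and nz: "i0 \<in> I" "w i0 \<noteq> 0"
  shows "algebraic_int x"
proof -
  define n where "n = card I"
  obtain e where e: "bij_betw e {0..<n} I"
    using ex_bij_betw_nat_finite[OF fin] n_def by blast
  have "\<forall>i\<in>I. \<exists>c. x * w i = (\<Sum>j\<in>I. of_int (c j) * w j)"
    using st by (auto simp: stabilizes_def integer_span_def)
  then obtain c where c: "\<And>i. i \<in> I \<Longrightarrow> x * w i = (\<Sum>j\<in>I. of_int (c i j) * w j)" by metis
  define B where "B = mat n n (\<lambda>(i, j). c (e i) (e j))"
  define v where "v = vec n (\<lambda>i. w (e i))"
  have B: "B \<in> carrier_mat n n" by (simp add: B_def)
  have eI: "e i \<in> I" if "i < n" for i using e that by (auto simp: bij_betw_def)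
  have "map_mat of_int B *\<^sub>v v = x \<cdot>\<^sub>v v"
  proof (rule eq_vecI)
    fix i assume "i < dim_vec (x \<cdot>\<^sub>v v)"
    then have i: "i < n" by (simp add: v_def)
    have "(map_mat of_int B *\<^sub>v v) $ i = (\<Sum>j\<in>{0..<n}. of_int (c (e i) (e j)) * w (e j))"
      using i by (simp add: B_def v_def scalar_prod_def)
    also have "\<dots> = (\<Sum>j\<in>I. of_int (c (e i) j) * w j)"
      by (rule sum.reindex_bij_betw[OF e])
    also have "\<dots> = x * w (e i)" using c[OF eI[OF i]] by simp
    finally show "(map_mat of_int B *\<^sub>v v) $ i = (x \<cdot>\<^sub>v v) $ i" using i by (simp add: v_def)
  qed (use B in \<open>simp add: v_def\<close>)
  moreover have "v \<noteq> 0\<^sub>v n"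
  proof
    assume v0: "v = 0\<^sub>v n"
    obtain i where i: "i < n" "e i = i0" using e nz by (auto simp: bij_betw_def)
    then have "v $ i = w i0" by (simp add: v_def)
    then show False using v0 i nz by simp
  qed
  ultimately have "eigenvalue (map_mat of_int B) x"
    unfolding eigenvalue_def eigenvector_def using B by (intro exI[of _ v]) (simp add: v_def)
  then show ?thesis by (rule algebraic_int_eigenvalue[OF B])
qed

lemma algebraic_int_power_reduction:
  fixes x :: complex
  assumes "algebraic_int x"
  obtains d c where "d > 0" "x ^ d = (\<Sum>k<d. of_int (c k) * x ^ k)"
proof -
  obtain p where p: "lead_coeff p = 1" "\<And>i. coeff p i \<in> \<int>" "poly p x = 0"
    using assms by (cases) auto
  define d where "d = degree p"
  have "\<forall>i. \<exists>k. coeff p i = of_int k" using p(2) Ints_cases by metis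
  then obtain c where c: "\<And>i. coeff p i = of_int (c i)" by metis
  have d0: "d > 0"
  proof (rule ccontr)
    assume "\<not> d > 0"
    then have "degree p = 0" by (simp add: d_def)
    then obtain a where "p = [:a:]" using degree_eq_zeroE by blast
    then show False using p by simp
  qed
  have "0 = (\<Sum>k\<le>d. coeff p k * x ^ k)" using p(3) by (simp add: poly_altdef d_def)
  also have "\<dots> = (\<Sum>k<d. coeff p k * x ^ k) + x ^ d"
    using p(1) by (simp add: lessThan_Suc_atMost[symmetric] d_def)
  finally have "x ^ d = (\<Sum>k<d. of_int (- c k) * x ^ k)"
    by (simp add: c sum_negf eq_neg_iff_add_eq_0 add.commute)
  then show thesis using that[of d "\<lambda>k. - c k"] d0 by blast
qed

text \<open>The products \<open>x ^ i * y ^ j\<close> with exponents below the degrees of monic integer polynomials with roots \<open>x\<close> and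
  \<open>y\<close> generate a group that both numbers stabilize. Their sum and their product then stabilize it as well.\<close>

lemma algebraic_int_common_module:
  fixes x y :: complex
  assumes "algebraic_int x" "algebraic_int y"
  obtains I :: "(nat \<times> nat) set" and w where
    "finite I" "(0, 0) \<in> I" "w (0, 0) = 1" "stabilizes I w x" "stabilizes I w y"
proof -
  obtain d c where d: "d > 0" "x ^ d = (\<Sum>k<d. of_int (c k) * x ^ k)"
    using algebraic_int_power_reduction[OF assms(1)] by blast
  obtain e b where e: "e > 0" "y ^ e = (\<Sum>k<e. of_int (b k) * y ^ k)"
    using algebraic_int_power_reduction[OF assms(2)] by blast
  define I where "I = {..<d} \<times> {..<e}"
  define w where "w = (\<lambda>(i, j). x ^ i * y ^ j)"
  have fin: "finite I" by (simp add: I_def)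
  have gen: "x ^ i * y ^ j \<in> integer_span I w" if "i < d" "j < e" for i j
    using integer_span_gen[OF fin, of "(i, j)" w] that by (simp add: I_def w_def)
  have "stabilizes I w x"
    unfolding stabilizes_def
  proof
    fix p assume "p \<in> I"
    then obtain i j where p: "p = (i, j)" "i < d" "j < e" by (auto simp: I_def)
    show "x * w p \<in> integer_span I w"
    proof (cases "Suc i < d")
      case True
      then show ?thesis using gen[of "Suc i" j] p by (simp add: w_def mult_ac)
    next
      case False
      then have "x * w p = x ^ d * y ^ j" using p by (simp add: w_def flip: power_Suc) (metis Suc_lessI)
      also have "\<dots> = (\<Sum>k<d. of_int (c k) * (x ^ k * y ^ j))"
        unfolding d(2) by (simp add: sum_distrib_left sum_distrib_right mult_ac)
      also have "\<dots> \<in> integer_span I w"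
        using p gen by (intro integer_span_sum integer_span_scale) auto
      finally show ?thesis .
    qed
  qed
  moreover have "stabilizes I w y"
    unfolding stabilizes_def
  proof
    fix p assume "p \<in> I"
    then obtain i j where p: "p = (i, j)" "i < d" "j < e" by (auto simp: I_def)
    show "y * w p \<in> integer_span I w"
    proof (cases "Suc j < e")
      case True
      then show ?thesis using gen[of i "Suc j"] p by (simp add: w_def mult_ac)
    next
      case False
      then have "Suc j = e" using p by simp
      then have "y * w p = x ^ i * y ^ e" using p by (auto simp: w_def)
      also have "\<dots> = (\<Sum>k<e. of_int (b k) * (x ^ i * y ^ k))"
        unfolding e(2) by (simp add: sum_distrib_left mult_ac)
      also have "\<dots> \<in> integer_span I w"
        using p gen by (intro integer_span_sum integer_span_scale) auto
      finally show ?thesis .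
    qed
  qed
  ultimately show thesis
    using that[of I w] d e fin by (simp add: I_def w_def)
qed

lemma algebraic_int_add:
  fixes x y :: complex
  assumes "algebraic_int x" "algebraic_int y"
  shows "algebraic_int (x + y)"
proof -
  obtain I :: "(nat \<times> nat) set" and w where
    "finite I" "(0, 0) \<in> I" "w (0, 0) = 1" "stabilizes I w x" "stabilizes I w y"
    using algebraic_int_common_module[OF assms] by blast
  then show ?thesis
    using stabilizes_imp_algebraic_int[of I w "x + y" "(0, 0)"] stabilizes_add by auto
qed

lemma algebraic_int_mult:
  fixes x y :: complex
  assumes "algebraic_int x" "algebraic_int y"
  shows "algebraic_int (x * y)"
proof -
  obtain I :: "(nat \<times> nat) set" and w where
    "finite I" "(0, 0) \<in> I" "w (0, 0) = 1" "stabilizes I w x" "stabilizes I w y"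
    using algebraic_int_common_module[OF assms] by blast
  then show ?thesis
    using stabilizes_imp_algebraic_int[of I w "x * y" "(0, 0)"] stabilizes_mult by auto
qed

lemma algebraic_int_diff:
  fixes x y :: complex
  assumes "algebraic_int x" "algebraic_int y"
  shows "algebraic_int (x - y)"
  using algebraic_int_add[of x "- y"] assms by auto

lemma algebraic_int_of_rat_int:
  assumes "algebraic_int (of_rat q :: complex)"
  shows "\<exists>k::int. q = of_int k"
proof -
  have "(of_rat q :: complex) \<in> \<int>"
    using assms by (intro rational_algebraic_int_is_int) auto
  then obtain k where "(of_rat q :: complex) = of_int k" by (auto elim: Ints_cases)
  then have "(of_rat q :: complex) = of_rat (of_int k)" by simp
  then show ?thesis by (auto simp only: of_rat_eq_iff)
qed

lemma squarefree_mult_square_int: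
  fixes j :: int and r :: rat
  assumes "squarefree j" "of_int j * (r * r) = of_int N"
  shows "\<exists>k::int. r = of_int k"
proof -
  obtain a b where q: "r = of_int a / of_int b" "b > 0" "coprime a b"
    using quotient_of_div[of r] quotient_of_denom_pos[of r] quotient_of_coprime[of r]
    by (metis surj_pair)
  have "of_int (j * a ^ 2) = (of_int (N * b ^ 2) :: rat)"
    using assms(2) q by (simp add: field_simps power2_eq_square)
  then have eq: "j * a ^ 2 = N * b ^ 2" by (simp only: of_int_eq_iff)
  have cop: "coprime (b ^ 2) (a ^ 2)" using q by (simp add: coprime_commute)
  have "b ^ 2 dvd j * a ^ 2" unfolding eq by simp
  then have "b ^ 2 dvd j" using cop by (simp add: coprime_dvd_mult_left_iff)
  then have "b = 1" using assms(1) q(2) squarefreeD[of j b] by simp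
  then show ?thesis using q by auto
qed

text \<open>As \<open>q\<^sup>2 n\<close> is an integer and \<open>n\<close> is squarefree, \<open>q\<close> is an integer; its square divides the squarefree \<open>m\<close>.\<close>

lemma squarefree_int_square_ratio:
  fixes m n :: int and q :: rat
  assumes "squarefree m" "squarefree n" "of_int m = q ^ 2 * of_int n"
  shows "m = n"
proof -
  have "of_int n * (q * q) = of_int m" using assms(3) by (simp add: power2_eq_square)
  then obtain a :: int where a: "q = of_int a" using squarefree_mult_square_int[OF assms(2)] by blast
  have "of_int m = (of_int (a ^ 2 * n) :: rat)" using assms(3) by (simp add: a)
  then have eq: "m = a ^ 2 * n" by (simp only: of_int_eq_iff)
  then have "is_unit a" using squarefreeD[OF assms(1)] by simp
  then have "a ^ 2 = 1" by (auto simp: zdvd1_eq power2_eq_square abs_if split: if_splits)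
  then show ?thesis using eq by simp
qed

section \<open>Fields generated by two square roots\<close>

lemma complex_ring_sel [simp]:
  "carrier complex_ring = UNIV" "x \<otimes>\<^bsub>complex_ring\<^esub> y = x * y" "\<one>\<^bsub>complex_ring\<^esub> = 1"
  "\<zero>\<^bsub>complex_ring\<^esub> = 0" "x \<oplus>\<^bsub>complex_ring\<^esub> y = x + y"
  by (simp_all add: ring_of_type_algebra_def)

lemma field_complex_ring: "Ring.field complex_ring"
  by (rule field_from_type_algebra)

lemma a_inv_complex_ring: "\<ominus>\<^bsub>complex_ring\<^esub> x = - x"
proof -
  interpret Ring.field complex_ring by (rule field_complex_ring)
  show ?thesis using minus_equality[of "- x" x] by simp
qed

lemma m_inv_complex_ring: "x \<noteq> 0 \<Longrightarrow> inv\<^bsub>complex_ring\<^esub> x = inverse x"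
proof -
  interpret Ring.field complex_ring by (rule field_complex_ring)
  assume "x \<noteq> 0"
  then show ?thesis using comm_inv_char[of x "inverse x"] by simp
qed

lemma subfield_complexI:
  assumes "1 \<in> K" "\<And>x. x \<in> K \<Longrightarrow> - x \<in> K"
    "\<And>x y. x \<in> K \<Longrightarrow> y \<in> K \<Longrightarrow> x + y \<in> K" "\<And>x y. x \<in> K \<Longrightarrow> y \<in> K \<Longrightarrow> x * y \<in> K"
    "\<And>x. x \<in> K \<Longrightarrow> x \<noteq> 0 \<Longrightarrow> inverse x \<in> K"
  shows "subfield K complex_ring"
proof -
  interpret Ring.field complex_ring by (rule field_complex_ring)
  show ?thesis
    by (intro subfieldI' subringI) (use assms in \<open>auto simp: a_inv_complex_ring m_inv_complex_ring\<close>)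
qed

lemma subfield_complexD:
  assumes "subfield K complex_ring"
  shows "1 \<in> K" "0 \<in> K" "\<And>x. x \<in> K \<Longrightarrow> - x \<in> K"
    "\<And>x y. x \<in> K \<Longrightarrow> y \<in> K \<Longrightarrow> x + y \<in> K" "\<And>x y. x \<in> K \<Longrightarrow> y \<in> K \<Longrightarrow> x * y \<in> K"
    "\<And>x. x \<in> K \<Longrightarrow> inverse x \<in> K" "\<And>x y. x \<in> K \<Longrightarrow> y \<in> K \<Longrightarrow> x - y \<in> K"
    "\<And>x y. x \<in> K \<Longrightarrow> y \<in> K \<Longrightarrow> x / y \<in> K" "\<And>q. of_rat q \<in> K"
proof -
  interpret F: Ring.field complex_ring by (rule field_complex_ring)
  note sr = subfieldE(2)[OF assms]
  note c = subcringE[OF sr]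
  show one: "1 \<in> K" and zero: "0 \<in> K" using c(2,3) by auto
  show uminus: "- x \<in> K" if "x \<in> K" for x using c(5)[OF that] by (simp add: a_inv_complex_ring)
  show mult: "x * y \<in> K" if "x \<in> K" "y \<in> K" for x y using c(6)[OF that] by simp
  show add: "x + y \<in> K" if "x \<in> K" "y \<in> K" for x y using c(7)[OF that] by simp
  show inv: "inverse x \<in> K" if "x \<in> K" for x
  proof (cases "x = 0")
    case False
    then show ?thesis using F.subfield_m_inv(1)[OF assms, of x] that by (simp add: m_inv_complex_ring)
  qed (use zero in simp)
  show "x - y \<in> K" if "x \<in> K" "y \<in> K" for x y using add[OF that(1) uminus[OF that(2)]] by simp
  show div: "x / y \<in> K" if "x \<in> K" "y \<in> K" for x y
    using mult[OF that(1) inv[OF that(2)]] by (simp add: divide_inverse)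
  have nat: "of_nat k \<in> K" for k by (induction k) (auto intro: zero one add)
  have int: "of_int k \<in> K" for k by (cases k rule: int_cases2) (auto intro: nat uminus)
  show "of_rat q \<in> K" for q
    by (cases q) (auto simp: of_rat_rat intro: div int)
qed

lemma subfield_Rats: "subfield \<rat> complex_ring"
  by (rule subfield_complexI) auto

lemma ring_hom_as_ringD:
  assumes "f \<in> Ring.ring_hom (as_ring K) S" "S = as_ring L \<or> S = complex_ring"
  shows "\<And>x y. x \<in> K \<Longrightarrow> y \<in> K \<Longrightarrow> f (x + y) = f x + f y"
    "\<And>x y. x \<in> K \<Longrightarrow> y \<in> K \<Longrightarrow> f (x * y) = f x * f y" "f 1 = 1"
  using assms by (auto simp: Ring.ring_hom_def)

lemma ring_hom_of_rat:
  assumes K: "subfield K complex_ring"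
    and add: "\<And>x y. x \<in> K \<Longrightarrow> y \<in> K \<Longrightarrow> f (x + y) = f x + f y"
    and mult: "\<And>x y. x \<in> K \<Longrightarrow> y \<in> K \<Longrightarrow> f (x * y) = f x * f y" and one: "f 1 = (1::complex)"
  shows "f (of_rat q) = of_rat q"
proof -
  note KD = subfield_complexD[OF K]
  have zero: "f 0 = 0" using add[of 0 0] KD by simp
  have natK: "of_nat k \<in> K" for k using KD(9)[of "of_nat k"] by simp
  have intK: "of_int k \<in> K" for k using KD(9)[of "of_int k"] by simp
  have nat: "f (of_nat k) = of_nat k" for k
    by (induction k) (auto simp: zero one add natK KD)
  have uminus: "f (- x) = - f x" if "x \<in> K" for x
    using add[of x "- x"] that KD zero by (simp add: eq_neg_iff_add_eq_0 add.commute)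
  have int: "f (of_int k) = of_int k" for k
    by (cases k rule: int_cases2) (auto simp: nat uminus natK)
  obtain a b where q: "q = Rat.Fract a b" "b > 0" by (cases q) auto
  have "of_int b * of_rat q = (of_int a :: complex)" using q by (simp add: of_rat_rat)
  then have "f (of_int b * of_rat q) = of_int a" using int by simp
  then have "of_int b * f (of_rat q) = of_int a" using mult[OF intK KD(9)] int by simp
  then show ?thesis using q by (simp add: of_rat_rat field_simps)
qed

text \<open>If \<open>\<alpha>\<close> and \<open>\<beta>\<close> are square roots of rational numbers, this is the field generated by them.\<close>

definition qspan :: "complex \<Rightarrow> complex \<Rightarrow> complex set" where
  "qspan \<alpha> \<beta> = {of_rat a + of_rat b * \<alpha> + of_rat c * \<beta> + of_rat d * (\<alpha> * \<beta>) |a b c d. True}"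

definition signs :: "rat set" where "signs = {1, -1}"

lemma signs_square [simp]: "s \<in> signs \<Longrightarrow> s * s = 1" "s \<in> signs \<Longrightarrow> s * (s * x) = x" "1 \<in> signs" "-1 \<in> signs"
  and signs_nz: "s \<in> signs \<Longrightarrow> s \<noteq> 0" and signs_mult: "s \<in> signs \<Longrightarrow> t \<in> signs \<Longrightarrow> s * t \<in> signs"
  and finite_signs [simp]: "finite signs"
  by (auto simp: signs_def)

text \<open>Any square roots are allowed, not only the principal ones, so that the roles of \<open>m\<close>, \<open>n\<close> and the third
  radicand can be exchanged and signs can be adjusted later.\<close>

locale sqrt_pair =
  fixes m n :: int and \<alpha> \<beta> :: complex
  assumes sqfree: "squarefree m" "squarefree n"
    and ne: "m \<noteq> 1" "n \<noteq> 1" "m \<noteq> n"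
    and square: "\<alpha> * \<alpha> = of_int m" "\<beta> * \<beta> = of_int n"
begin

definition elt :: "rat \<Rightarrow> rat \<Rightarrow> rat \<Rightarrow> rat \<Rightarrow> complex" where
  "elt a b c d = of_rat a + of_rat b * \<alpha> + of_rat c * \<beta> + of_rat d * (\<alpha> * \<beta>)"

abbreviation K :: "complex set" where "K \<equiv> qspan \<alpha> \<beta>"

lemma K_iff: "x \<in> K \<longleftrightarrow> (\<exists>a b c d. x = elt a b c d)"
  by (auto simp: qspan_def elt_def)

lemma elt_in_K [simp]: "elt a b c d \<in> K"
  by (auto simp: K_iff)

lemma K_cases [consumes 1]:
  assumes "x \<in> K" obtains a b c d where "x = elt a b c d"
  using assms by (auto simp: K_iff)

lemma m_nz [simp]: "m \<noteq> 0" "n \<noteq> 0" using sqfree by auto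

lemma rat_alpha_indep:
  assumes "of_rat p + of_rat q * \<alpha> = 0" shows "p = 0" "q = 0"
proof -
  show q: "q = 0"
  proof (rule ccontr)
    assume q: "q \<noteq> 0"
    define r where "r = - p / q"
    have "of_rat p = (- (of_rat q * of_rat r) :: complex)"
      using q by (simp add: r_def flip: of_rat_mult of_rat_minus)
    then have "of_rat q * (\<alpha> - of_rat r) = 0" using assms by (simp add: algebra_simps)
    then have \<alpha>: "\<alpha> = of_rat r" using q by simp
    have "(of_rat (of_int m) :: complex) = of_rat (r * r)"
      using square(1) unfolding \<alpha> by (simp add: of_rat_mult)
    then have "of_int m = r ^ 2 * of_int 1" by (simp only: of_rat_eq_iff) (simp add: power2_eq_square)
    then show False using squarefree_int_square_ratio[OF sqfree(1), of 1 r] ne by simp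
  qed
  show "p = 0" using assms q by simp
qed

text \<open>If \<open>c + d \<alpha>\<close> were not zero, its norm \<open>e\<close> would be a nonzero rational and \<open>\<beta>\<close> would be of the form
  \<open>P + Q \<alpha>\<close>. Squaring shows \<open>P Q = 0\<close>, so \<open>n\<close> would be a square or \<open>m\<close> times a square.\<close>

lemma indep:
  assumes "elt a b c d = 0" shows "a = 0 \<and> b = 0 \<and> c = 0 \<and> d = 0"
proof -
  have "c = 0 \<and> d = 0"
  proof (rule ccontr)
    assume cd: "\<not> (c = 0 \<and> d = 0)"
    define e where "e = c * c - d * d * of_int m"
    have ee: "of_rat e = (of_rat c + of_rat d * \<alpha>) * (of_rat c + of_rat (- d) * \<alpha>)"
    proof -
      have "(of_rat c + of_rat d * \<alpha>) * (of_rat c + of_rat (- d) * \<alpha>) = of_rat c * of_rat c - of_rat d * of_rat d * (\<alpha> * \<alpha>)"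
        by (simp add: algebra_simps of_rat_minus)
      then show ?thesis by (simp add: square e_def of_rat_diff of_rat_mult)
    qed
    have e: "e \<noteq> 0"
    proof
      assume "e = 0"
      then have "of_rat c + of_rat d * \<alpha> = 0 \<or> of_rat c + of_rat (- d) * \<alpha> = 0" using ee by simp
      then show False using rat_alpha_indep[of c d] rat_alpha_indep[of c "- d"] cd
        by (metis neg_equal_0_iff_equal)
    qed
    define P where "P = - (a * c - b * d * of_int m) / e"
    define Q where "Q = - (b * c - a * d) / e"
    define u where "u = of_rat a + of_rat b * \<alpha>"
    define v where "v = of_rat c + of_rat d * \<alpha>"
    define w where "w = of_rat c + of_rat (- d) * \<alpha>"
    have "u + v * \<beta> = 0" using assms by (simp add: elt_def u_def v_def algebra_simps)
    moreover have "(u + v * \<beta>) * w = u * w + (v * w) * \<beta>" by (simp add: algebra_simps)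
    moreover have "v * w = of_rat e" unfolding ee v_def w_def ..
    ultimately have "of_rat e * \<beta> = - (u * w)" by (metis minus_unique mult_zero_left)
    also have "u * w = of_rat a * of_rat c - of_rat b * of_rat d * (\<alpha> * \<alpha>)
        + (of_rat b * of_rat c - of_rat a * of_rat d) * \<alpha>"
      by (simp add: u_def w_def of_rat_minus algebra_simps)
    also have "\<dots> = of_rat (a * c - b * d * of_int m) + of_rat (b * c - a * d) * \<alpha>"
      by (simp add: square of_rat_mult of_rat_diff)
    also have "- \<dots> = of_rat (- (a * c - b * d * of_int m)) + of_rat (- (b * c - a * d)) * \<alpha>"
      by (simp only: of_rat_minus) simp
    finally have "of_rat e * \<beta> = of_rat (- (a * c - b * d * of_int m)) + of_rat (- (b * c - a * d)) * \<alpha>" .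
    then have "of_rat e * \<beta> = of_rat (e * P) + of_rat (e * Q) * \<alpha>"
      using e by (simp add: P_def Q_def)
    then have "of_rat e * \<beta> = of_rat e * (of_rat P + of_rat Q * \<alpha>)"
      by (simp add: of_rat_mult algebra_simps)
    then have beta: "\<beta> = of_rat P + of_rat Q * \<alpha>" using e by simp
    have "\<beta> * \<beta> = of_rat P * of_rat P + of_rat Q * of_rat Q * (\<alpha> * \<alpha>) + 2 * of_rat P * of_rat Q * \<alpha>"
      unfolding beta by (simp add: algebra_simps)
    then have "of_rat (P * P + Q * Q * of_int m - of_int n) + of_rat (2 * P * Q) * \<alpha> = 0"
      unfolding square by (simp add: of_rat_mult of_rat_add of_rat_diff)
    then have "P * P + Q * Q * of_int m - of_int n = 0" "2 * P * Q = 0"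
      using rat_alpha_indep by blast+
    then have PQ: "P * P + Q * Q * of_int m = of_int n" "P = 0 \<or> Q = 0" by auto
    show False
    proof (cases "Q = 0")
      case True
      then show False using squarefree_int_square_ratio[of n 1 P] sqfree ne PQ by (simp add: power2_eq_square)
    next
      case False
      then show False using squarefree_int_square_ratio[of n m Q] sqfree ne PQ by (simp add: power2_eq_square)
    qed
  qed
  moreover from this have "of_rat a + of_rat b * \<alpha> = 0" using assms by (simp add: elt_def)
  ultimately show ?thesis using rat_alpha_indep by blast
qed

lemma elt_add: "elt a b c d + elt a' b' c' d' = elt (a + a') (b + b') (c + c') (d + d')"
  by (simp add: elt_def of_rat_add algebra_simps)

lemma elt_minus: "- elt a b c d = elt (- a) (- b) (- c) (- d)"
  by (simp add: elt_def of_rat_minus algebra_simps)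

lemma elt_diff: "elt a b c d - elt a' b' c' d' = elt (a - a') (b - b') (c - c') (d - d')"
  by (simp add: elt_def of_rat_diff algebra_simps)

lemma elt_mult: "elt a b c d * elt a' b' c' d' = elt
    (a * a' + of_int m * b * b' + of_int n * c * c' + of_int (m * n) * d * d')
    (a * b' + b * a' + of_int n * (c * d' + d * c'))
    (a * c' + c * a' + of_int m * (b * d' + d * b'))
    (a * d' + d * a' + b * c' + c * b')"
proof -
  have *: "\<alpha> * (\<alpha> * x) = of_int m * x" "\<beta> * (\<beta> * x) = of_int n * x" for x
    using square by (metis mult.assoc)+
  show ?thesis
    unfolding elt_def
    by (simp add: of_rat_add of_rat_mult algebra_simps * square)
qed

lemma elt_of_rat: "of_rat q = elt q 0 0 0" by (simp add: elt_def)

lemma elt_eq_iff [simp]: "elt a b c d = elt a' b' c' d' \<longleftrightarrow> a = a' \<and> b = b' \<and> c = c' \<and> d = d'"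
  using indep[of "a - a'" "b - b'" "c - c'" "d - d'"] by (auto simp: elt_diff[symmetric])

text \<open>Well defined by linear independence; this is how the automorphisms below become functions on complex numbers.\<close>

definition coords :: "complex \<Rightarrow> rat \<times> rat \<times> rat \<times> rat" where
  "coords x = (SOME (a, b, c, d). x = elt a b c d)"

lemma coords_elt [simp]: "coords (elt a b c d) = (a, b, c, d)"
proof -
  have "(case coords (elt a b c d) of (a', b', c', d') \<Rightarrow> elt a b c d = elt a' b' c' d')"
    unfolding coords_def by (rule someI[of _ "(a, b, c, d)"]) simp
  then show ?thesis by auto
qed

text \<open>The automorphism with \<open>\<alpha> \<mapsto> s \<alpha>\<close> and \<open>\<beta> \<mapsto> t \<beta>\<close>, for signs \<open>s\<close> and \<open>t\<close>.\<close>

definition conj :: "rat \<Rightarrow> rat \<Rightarrow> complex \<Rightarrow> complex" where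
  "conj s t x = (case coords x of (a, b, c, d) \<Rightarrow> elt a (s * b) (t * c) (s * t * d))"

lemma conj_elt [simp]: "conj s t (elt a b c d) = elt a (s * b) (t * c) (s * t * d)"
  by (simp add: conj_def)

lemma conj_in_K [simp]: "x \<in> K \<Longrightarrow> conj s t x \<in> K"
  by (auto simp: K_iff)

lemma conj_add: "x \<in> K \<Longrightarrow> y \<in> K \<Longrightarrow> conj s t (x + y) = conj s t x + conj s t y"
  by (auto simp: K_iff elt_add algebra_simps)

lemma conj_mult:
  assumes "s \<in> signs" "t \<in> signs" "x \<in> K" "y \<in> K"
  shows "conj s t (x * y) = conj s t x * conj s t y"
proof -
  have "s = 1 \<or> s = -1" "t = 1 \<or> t = -1" using assms by (auto simp: signs_def)
  then show ?thesis
    using assms by (auto simp: K_iff elt_mult algebra_simps)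
qed

lemma conj_1 [simp]: "conj s t 1 = 1"
proof -
  have "conj s t (elt 1 0 0 0) = elt 1 0 0 0" by simp
  moreover have "elt 1 0 0 0 = 1" by (simp add: elt_def)
  ultimately show ?thesis by simp
qed

lemma conj_of_rat [simp]: "conj s t (of_rat q) = of_rat q"
  by (simp add: elt_of_rat)

lemma conj_conj [simp]: "x \<in> K \<Longrightarrow> conj s t (conj s' t' x) = conj (s * s') (t * t') x"
  by (auto simp: K_iff mult_ac)

lemma conj_1_1 [simp]: "x \<in> K \<Longrightarrow> conj 1 1 x = x"
  by (auto simp: K_iff)

lemma elt_eq_0_iff [simp]: "elt a b c d = 0 \<longleftrightarrow> a = 0 \<and> b = 0 \<and> c = 0 \<and> d = 0"
  using indep[of a b c d] by (auto simp: elt_def)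

lemma conj_eq_0:
  assumes "x \<in> K" "s \<in> signs" "t \<in> signs"
  shows "conj s t x = 0 \<longleftrightarrow> x = 0"
  using assms(1)
proof (cases rule: K_cases)
  case (1 a b c d)
  show ?thesis unfolding 1 using assms by (simp add: signs_nz)
qed

lemma generators_in_K: "\<alpha> \<in> K" "\<beta> \<in> K" "\<alpha> * \<beta> \<in> K" "of_rat q \<in> K"
  using elt_in_K[of 0 1 0 0] elt_in_K[of 0 0 1 0] elt_in_K[of 0 0 0 1] elt_in_K[of q 0 0 0]
  by (simp_all add: elt_def)

lemma subfield_K: "subfield K complex_ring"
proof (rule subfield_complexI)
  show "1 \<in> K" using elt_of_rat[of 1] elt_in_K by (metis of_rat_1)
  show "- x \<in> K" if "x \<in> K" for x using that by (auto elim!: K_cases simp: elt_minus)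
  show "x + y \<in> K" if "x \<in> K" "y \<in> K" for x y using that by (auto elim!: K_cases simp: elt_add)
  show mult: "x * y \<in> K" if "x \<in> K" "y \<in> K" for x y using that by (auto elim!: K_cases simp: elt_mult)
  show "inverse x \<in> K" if x: "x \<in> K" "x \<noteq> 0" for x
  proof -
    (* x y is the norm of x to the subfield generated by alpha, and x y z its norm to the rationals *)
    define y where "y = conj 1 (-1) x"
    have y: "y \<in> K" "y \<noteq> 0" using x by (auto simp: y_def conj_eq_0)
    obtain A B where xy: "x * y = elt A B 0 0"
      using x by (auto elim!: K_cases simp: y_def elt_mult)
    define z where "z = conj (-1) 1 (x * y)"
    have "elt A B 0 0 \<noteq> 0" using x y xy by (metis mult_eq_0_iff)
    then have z: "z \<in> K" "z \<noteq> 0" by (auto simp: z_def xy)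
    have q: "x * y * z = of_rat (A * A - of_int m * B * B)"
      by (simp add: z_def xy elt_mult elt_of_rat)
    have "inverse x = y * z * of_rat (1 / (A * A - of_int m * B * B))"
    proof -
      define r where "r = A * A - of_int m * B * B"
      have q': "x * (y * z) = of_rat r" using q by (simp add: r_def mult.assoc)
      have "(of_rat r :: complex) \<noteq> 0" using x y z q' by (metis mult_eq_0_iff)
      then have "x * (y * z * of_rat (1 / r)) = 1" using q' by (simp add: of_rat_divide flip: mult.assoc)
      then show ?thesis by (simp add: r_def inverse_unique)
    qed
    then show ?thesis using y z mult by (simp add: elt_of_rat)
  qed
qed

lemma finite_dimension_K: "ring.finite_dimension complex_ring \<rat> K"
proof -
  interpret Ring.field complex_ring by (rule field_complex_ring)
  have step: "u \<in> line_extension \<rat> a E \<longleftrightarrow> (\<exists>q. \<exists>v\<in>E. u = of_rat q * a + v)" for u a E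
    by (auto simp: line_extension_mem_iff Rats_def)
  have "x \<in> Span \<rat> [1, \<alpha>, \<beta>, \<alpha> * \<beta>] \<longleftrightarrow> x \<in> K" for x
  proof
    assume "x \<in> Span \<rat> [1, \<alpha>, \<beta>, \<alpha> * \<beta>]"
    then obtain a b c d where "x = of_rat a * 1 + (of_rat b * \<alpha> + (of_rat c * \<beta> + (of_rat d * (\<alpha> * \<beta>) + 0)))"
      by (auto simp: step)
    then have "x = elt a b c d" by (simp add: elt_def)
    then show "x \<in> K" by simp
  next
    assume "x \<in> K"
    then obtain a b c d where "x = elt a b c d" by (auto simp: K_iff)
    then have "x = of_rat a * 1 + (of_rat b * \<alpha> + (of_rat c * \<beta> + (of_rat d * (\<alpha> * \<beta>) + 0)))"
      by (simp add: elt_def)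
    moreover have ext: "of_rat q * a + v \<in> line_extension \<rat> a E" if "v \<in> E" for q a v E
      using that step by blast
    have "of_rat a * 1 + (of_rat b * \<alpha> + (of_rat c * \<beta> + (of_rat d * (\<alpha> * \<beta>) + 0)))
        \<in> line_extension \<rat> 1 (line_extension \<rat> \<alpha> (line_extension \<rat> \<beta> (line_extension \<rat> (\<alpha> * \<beta>) {0})))"
      by (intro ext) simp
    ultimately show "x \<in> Span \<rat> [1, \<alpha>, \<beta>, \<alpha> * \<beta>]" by simp
  qed
  then have "Span \<rat> [1, \<alpha>, \<beta>, \<alpha> * \<beta>] = K" by blast
  then show ?thesis using Span_finite_dimension[OF subfield_Rats, of "[1, \<alpha>, \<beta>, \<alpha> * \<beta>]"] by simp
qed

lemma number_field_K: "number_field K"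
  using subfield_K finite_dimension_K by (simp add: number_field_def)

text \<open>A homomorphism fixes the rationals, so it permutes the two square roots of \<open>m\<close> and those of \<open>n\<close>, and it is
  determined by the images of \<open>\<alpha>\<close> and \<open>\<beta>\<close>.\<close>

lemma hom_is_conj:
  assumes f: "f \<in> Ring.ring_hom (as_ring K) S" "S = as_ring K \<or> S = complex_ring"
  obtains s t where "s \<in> signs" "t \<in> signs" "\<And>x. x \<in> K \<Longrightarrow> f x = conj s t x"
proof -
  note h = ring_hom_as_ringD[OF f]
  have rat: "f (of_rat q) = of_rat q" for q
    by (rule ring_hom_of_rat[OF subfield_K]) (auto simp: h)
  have root: "\<exists>s\<in>signs. y = of_rat s * x" if "y * y = x * x" for x y :: complex
    using that by (auto simp: signs_def square_eq_iff)
  note in_K = generators_in_K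
  note KD = subfield_complexD[OF subfield_K]
  have "f \<alpha> * f \<alpha> = f (of_rat (of_int m))" using h(2)[OF in_K(1,1)] square by simp
  then have "f \<alpha> * f \<alpha> = \<alpha> * \<alpha>" unfolding rat by (simp add: square)
  then obtain s where s: "s \<in> signs" "f \<alpha> = of_rat s * \<alpha>" using root by blast
  have "f \<beta> * f \<beta> = f (of_rat (of_int n))" using h(2)[OF in_K(2,2)] square by simp
  then have "f \<beta> * f \<beta> = \<beta> * \<beta>" unfolding rat by (simp add: square)
  then obtain t where t: "t \<in> signs" "f \<beta> = of_rat t * \<beta>" using root by blast
  have f: "f (elt a b c d) = conj s t (elt a b c d)" for a b c d
  proof -
    have "f (elt a b c d) = of_rat a + of_rat b * (of_rat s * \<alpha>) + of_rat c * (of_rat t * \<beta>)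
        + of_rat d * ((of_rat s * \<alpha>) * (of_rat t * \<beta>))"
      unfolding elt_def by (simp only: h rat s t in_K KD)
    also have "\<dots> = elt a (s * b) (t * c) (s * t * d)" by (simp add: elt_def of_rat_mult)
    finally show ?thesis by simp
  qed
  have "f x = conj s t x" if "x \<in> K" for x
    using that by (cases rule: K_cases) (simp only: f)
  then show thesis using that s t by blast
qed

definition aut :: "rat \<times> rat \<Rightarrow> complex \<Rightarrow> complex" where
  "aut = (\<lambda>(s, t). restrict (conj s t) K)"

lemma aut_hom:
  assumes "s \<in> signs" "t \<in> signs" "S = as_ring K \<or> S = complex_ring"
  shows "aut (s, t) \<in> Ring.ring_hom (as_ring K) S"
  using assms subfield_complexD[OF subfield_K]
  by (auto simp: Ring.ring_hom_def aut_def conj_add conj_mult)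

lemma embeddings_K: "embeddings K = aut ` (signs \<times> signs)"
proof (intro equalityI subsetI)
  fix f assume f: "f \<in> embeddings K"
  then have "f \<in> Ring.ring_hom (as_ring K) complex_ring" and exl: "f \<in> extensional K"
    by (auto simp: embeddings_def)
  then obtain s t where st: "s \<in> signs" "t \<in> signs" "\<And>x. x \<in> K \<Longrightarrow> f x = conj s t x"
    using hom_is_conj[of f complex_ring] by blast
  have "f = aut (s, t)"
    using exl st(3) by (intro ext) (auto simp: aut_def extensional_def)
  then show "f \<in> aut ` (signs \<times> signs)" using st by auto
next
  fix f assume "f \<in> aut ` (signs \<times> signs)"
  then show "f \<in> embeddings K"
    using aut_hom by (auto simp: embeddings_def) (auto simp: aut_def)
qed

lemma inj_on_aut: "inj_on aut (signs \<times> signs)"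
proof (rule inj_onI, safe)
  fix s t s' t' assume eq: "aut (s, t) = aut (s', t')"
  have "aut (s, t) (elt 0 1 1 0) = aut (s', t') (elt 0 1 1 0)" by (simp only: eq)
  then show "s = s'" "t = t'" by (simp_all add: aut_def)
qed

text \<open>The four conjugates of \<open>\<alpha>\<close>, of \<open>\<beta>\<close> and of \<open>\<alpha> \<beta>\<close> cancel in pairs.\<close>

lemma field_trace_elt: "field_trace K (elt a b c d) = of_rat (4 * a)"
proof -
  have "field_trace K (elt a b c d) = (\<Sum>p\<in>signs \<times> signs. aut p (elt a b c d))"
    unfolding field_trace_def embeddings_K by (simp add: sum.reindex[OF inj_on_aut])
  also have "\<dots> = elt (4 * a) 0 0 0"
    by (simp add: signs_def sum.cartesian_product[symmetric] aut_def elt_add)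
  finally show ?thesis by (simp add: elt_of_rat)
qed

lemma bij_aut: "s \<in> signs \<Longrightarrow> t \<in> signs \<Longrightarrow> aut (s, t) \<in> Bij K"
  unfolding Bij_def aut_def
  by (auto intro!: bij_betwI[where g = "conj s t"])

lemma carrier_galois_group: "carrier (galois_group K) = aut ` (signs \<times> signs)"
proof (intro equalityI subsetI)
  fix f assume f: "f \<in> carrier (galois_group K)"
  then have "f \<in> Ring.ring_hom (as_ring K) (as_ring K)" and exl: "f \<in> extensional K"
    by (auto simp: galois_group_def Bij_def)
  then obtain s t where st: "s \<in> signs" "t \<in> signs" "\<And>x. x \<in> K \<Longrightarrow> f x = conj s t x"
    using hom_is_conj[of f "as_ring K"] by blast
  have "f = aut (s, t)"
    using exl st(3) by (intro ext) (auto simp: aut_def extensional_def)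
  then show "f \<in> aut ` (signs \<times> signs)" using st by auto
next
  fix f assume "f \<in> aut ` (signs \<times> signs)"
  then obtain s t where f: "f = aut (s, t)" "s \<in> signs" "t \<in> signs" by auto
  moreover have "aut (s, t) q = q" if "q \<in> \<rat>" for q
    using that by (auto simp: Rats_def aut_def elt_of_rat)
  ultimately show "f \<in> carrier (galois_group K)"
    using aut_hom[of s t "as_ring K"] bij_aut by (auto simp: galois_group_def)
qed

lemma galois_K: "galois_over_rat K"
proof -
  have "x \<in> \<rat>" if xK: "x \<in> K" and fixed: "\<forall>\<sigma>\<in>carrier (galois_group K). \<sigma> x = x" for x
  proof -
    obtain a b c d where x: "x = elt a b c d" using xK K_iff by blast
    have "aut (-1, 1) x = x" "aut (1, -1) x = x"
      using fixed by (auto simp: carrier_galois_group)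
    then have "x = of_rat a" unfolding elt_of_rat by (auto simp: x aut_def)
    then show ?thesis by simp
  qed
  moreover have "q \<in> K \<and> (\<forall>\<sigma>\<in>carrier (galois_group K). \<sigma> q = q)" if "q \<in> \<rat>" for q
    using that by (auto simp: carrier_galois_group aut_def Rats_def elt_of_rat)
  ultimately show ?thesis using number_field_K by (auto simp: galois_over_rat_def)
qed

lemma aut_compose:
  assumes "s \<in> signs" "t \<in> signs" "s' \<in> signs" "t' \<in> signs"
  shows "compose K (aut (s, t)) (aut (s', t')) = aut (s * s', t * t')"
  using assms by (auto simp: compose_def aut_def fun_eq_iff)

lemma galois_group_mult:
  assumes "f \<in> Bij K" "g \<in> Bij K"
  shows "f \<otimes>\<^bsub>galois_group K\<^esub> g = compose K f g"
  using assms by (simp add: galois_group_def BijGroup_def)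

lemma biquadratic_K: "biquadratic K"
proof -
  let ?Z = "integer_mod_group 2"
  have cZ: "carrier ?Z = {0, 1}" by (auto simp: carrier_integer_mod_group)
  define e :: "rat \<Rightarrow> int" where "e s = (if s = 1 then 0 else 1)" for s
  define h where "h f = (let p = inv_into (signs \<times> signs) aut f in (e (fst p), e (snd p)))" for f
  have h: "h (aut (s, t)) = (e s, e t)" if "s \<in> signs" "t \<in> signs" for s t
    using that inv_into_f_f[OF inj_on_aut, of "(s, t)"] by (simp add: h_def)
  have e: "e (s * s') = (e s + e s') mod 2" if "s \<in> signs" "s' \<in> signs" for s s'
    using that by (auto simp: signs_def e_def)
  have "h \<in> hom (galois_group K) (?Z \<times>\<times> ?Z)"
  proof (rule homI)
    show "h x \<in> carrier (?Z \<times>\<times> ?Z)" if "x \<in> carrier (galois_group K)" for x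
    proof -
      have "e s \<in> carrier ?Z" for s by (simp add: e_def cZ)
      then show ?thesis using that by (auto simp: carrier_galois_group h)
    qed
    show "h (x \<otimes>\<^bsub>galois_group K\<^esub> y) = h x \<otimes>\<^bsub>?Z \<times>\<times> ?Z\<^esub> h y"
      if xy: "x \<in> carrier (galois_group K)" "y \<in> carrier (galois_group K)" for x y
      using xy by (auto simp: carrier_galois_group galois_group_mult bij_aut aut_compose h signs_mult e)
  qed
  moreover have "bij_betw h (carrier (galois_group K)) (carrier (?Z \<times>\<times> ?Z))"
  proof -
    have "inj_on h (aut ` (signs \<times> signs))"
    proof -
      have einj: "s = s'" if "e s = e s'" "s \<in> signs" "s' \<in> signs" for s s'
        using that by (auto simp: e_def signs_def split: if_splits)
      show ?thesis
      proof (intro inj_onI)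
        fix f g assume "f \<in> aut ` (signs \<times> signs)" "g \<in> aut ` (signs \<times> signs)" "h f = h g"
        then obtain s t s' t' where "f = aut (s, t)" "g = aut (s', t')" "e s = e s'" "e t = e t'"
          "s \<in> signs" "t \<in> signs" "s' \<in> signs" "t' \<in> signs"
          by (auto simp: h)
        then show "f = g" using einj[of s s'] einj[of t t'] by simp
      qed
    qed
    moreover have "h ` aut ` (signs \<times> signs) = {0, 1} \<times> {0, 1}"
      by (auto simp: image_image h e_def signs_def)
    ultimately show ?thesis by (simp add: bij_betw_def carrier_galois_group cZ)
  qed
  ultimately have "galois_group K \<cong> ?Z \<times>\<times> ?Z" by (auto simp: is_iso_def iso_def)
  then show ?thesis using galois_K by (simp add: biquadratic_def)
qed

end

section \<open>Independence of the discriminant from the integral basis\<close>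

lemma field_trace_add:
  assumes "x \<in> K" "y \<in> K" shows "field_trace K (x + y) = field_trace K x + field_trace K y"
  unfolding field_trace_def sum.distrib[symmetric]
  using assms by (intro sum.cong refl) (auto simp: embeddings_def ring_hom_as_ringD(1))

lemma field_trace_of_int_mult:
  assumes K: "subfield K complex_ring" and x: "x \<in> K"
  shows "field_trace K (of_int c * x) = of_int c * field_trace K x"
  unfolding field_trace_def sum_distrib_left
proof (rule sum.cong[OF refl])
  fix \<sigma> assume s: "\<sigma> \<in> embeddings K"
  then have "\<sigma> \<in> Ring.ring_hom (as_ring K) complex_ring" by (simp add: embeddings_def)
  note h = ring_hom_as_ringD[OF this]
  have cK: "of_int c \<in> K" using subfield_complexD(9)[OF K, of "of_int c"] by simp
  have "\<sigma> (of_int c) = of_int c"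
    using ring_hom_of_rat[OF K, of \<sigma> "of_int c"] h by simp
  then show "\<sigma> (of_int c * x) = of_int c * \<sigma> x" using h(2)[OF _ cK x] by simp
qed

lemma field_trace_int_comb:
  assumes K: "subfield K complex_ring" and f: "\<And>i. i \<in> I \<Longrightarrow> f i \<in> K"
  shows "field_trace K (\<Sum>i\<in>I. of_int (c i) * f i) = (\<Sum>i\<in>I. of_int (c i) * field_trace K (f i))"
proof -
  note KD = subfield_complexD[OF K]
  have intK: "of_int c \<in> K" for c using KD(9)[of "of_int c"] by simp
  have sumK: "(\<Sum>i\<in>J. of_int (c i) * f i) \<in> K" if "J \<subseteq> I" for J
    using that by (induction J rule: infinite_finite_induct) (auto intro!: KD intK f)
  have "field_trace K 0 = 0" using field_trace_of_int_mult[OF K KD(2), of 0] by simp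
  then have "J \<subseteq> I \<Longrightarrow> field_trace K (\<Sum>i\<in>J. of_int (c i) * f i) = (\<Sum>i\<in>J. of_int (c i) * field_trace K (f i))" for J
    by (induction J rule: infinite_finite_induct)
      (auto simp: field_trace_add field_trace_of_int_mult[OF K] f sumK KD intK)
  then show ?thesis by blast
qed

lemma integral_basis_comb_unique:
  assumes ib: "integral_basis K ws"
    and eq: "(\<Sum>i<length ws. of_int (a i) * ws ! i) = (\<Sum>i<length ws. of_int (b i) * ws ! i)"
    and mem: "(\<Sum>i<length ws. of_int (a i) * ws ! i) \<in> ring_of_integers K"
    and j: "j < length ws"
  shows "a j = b j"
proof -
  let ?x = "\<Sum>i<length ws. of_int (a i) * ws ! i"
  have ex: "\<exists>!c. c \<in> extensional {..<length ws} \<and> ?x = (\<Sum>i<length ws. of_int (c i) * ws ! i)"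
    using ib mem unfolding integral_basis_def by blast
  have "restrict a {..<length ws} = restrict b {..<length ws}"
    using ex1_implies_ex[OF ex] ex
    by (rule_tac ex1E[OF ex]) (metis (mono_tags, lifting) eq lessThan_iff restrict_apply' restrict_extensional sum.cong)
  then show ?thesis using j by (metis lessThan_iff restrict_apply')
qed

lemma integral_basis_base_change:
  assumes ws: "integral_basis K ws" and vs: "integral_basis K vs"
  obtains P where "P \<in> carrier_mat (length ws) (length vs)"
    "\<And>i. i < length ws \<Longrightarrow> ws ! i = (\<Sum>j<length vs. of_int (P $$ (i, j)) * vs ! j)"
proof -
  have "\<forall>i<length ws. \<exists>c. ws ! i = (\<Sum>j<length vs. of_int (c j) * vs ! j)"
  proof safe
    fix i assume "i < length ws"
    then have "ws ! i \<in> ring_of_integers K"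
      using ws unfolding integral_basis_def by (meson nth_mem subsetD)
    then show "\<exists>c. ws ! i = (\<Sum>j<length vs. of_int (c j) * vs ! j)"
      using vs unfolding integral_basis_def by blast
  qed
  then obtain c where c: "\<And>i. i < length ws \<Longrightarrow> ws ! i = (\<Sum>j<length vs. of_int (c i j) * vs ! j)" by metis
  show thesis
    by (rule that[of "mat (length ws) (length vs) (\<lambda>(i, j). c i j)"]) (auto simp: c)
qed

lemma integral_basis_base_change_inverse:
  assumes ws: "integral_basis K ws"
    and P: "P \<in> carrier_mat (length ws) (length vs)"
      "\<And>i. i < length ws \<Longrightarrow> ws ! i = (\<Sum>j<length vs. of_int (P $$ (i, j)) * vs ! j)"
    and Q: "Q \<in> carrier_mat (length vs) (length ws)"
      "\<And>i. i < length vs \<Longrightarrow> vs ! i = (\<Sum>j<length ws. of_int (Q $$ (i, j)) * ws ! j)"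
  shows "P * Q = 1\<^sub>m (length ws)"
proof (rule eq_matI)
  fix i j assume ij: "i < dim_row (1\<^sub>m (length ws))" "j < dim_col (1\<^sub>m (length ws))"
  then have i: "i < length ws" and j: "j < length ws" by auto
  have PQ: "(P * Q) $$ (i, l) = (\<Sum>k<length vs. P $$ (i, k) * Q $$ (k, l))" if "l < length ws" for l
    using P(1) Q(1) i that by (simp add: scalar_prod_def lessThan_atLeast0)
  have "ws ! i = (\<Sum>k<length vs. of_int (P $$ (i, k)) * (\<Sum>l<length ws. of_int (Q $$ (k, l)) * ws ! l))"
    using P(2)[OF i] Q(2) by simp
  also have "\<dots> = (\<Sum>k<length vs. \<Sum>l<length ws. of_int (P $$ (i, k) * Q $$ (k, l)) * ws ! l)"
    by (simp add: sum_distrib_left mult.assoc)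
  also have "\<dots> = (\<Sum>l<length ws. \<Sum>k<length vs. of_int (P $$ (i, k) * Q $$ (k, l)) * ws ! l)"
    by (rule sum.swap)
  also have "\<dots> = (\<Sum>l<length ws. of_int ((P * Q) $$ (i, l)) * ws ! l)"
    by (intro sum.cong refl) (simp add: PQ sum_distrib_right)
  finally have 1: "ws ! i = (\<Sum>l<length ws. of_int ((P * Q) $$ (i, l)) * ws ! l)" .
  have "(\<Sum>l<length ws. of_int (if l = i then 1 else 0) * ws ! l) = (\<Sum>l<length ws. if l = i then ws ! l else 0)"
    by (intro sum.cong refl) auto
  then have 2: "(\<Sum>l<length ws. of_int (if l = i then 1 else 0) * ws ! l) = ws ! i" using i by simp
  have mem: "ws ! i \<in> ring_of_integers K"
    using ws i unfolding integral_basis_def by (meson nth_mem subsetD)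
  have "(P * Q) $$ (i, j) = (if j = i then 1 else 0)"
    using integral_basis_comb_unique[OF ws, of "\<lambda>l. (P * Q) $$ (i, l)" "\<lambda>l. if l = i then 1 else 0" j]
      1 2 mem j by simp
  then show "(P * Q) $$ (i, j) = 1\<^sub>m (length ws) $$ (i, j)" using i j by auto
qed (use P Q in auto)

text \<open>Both dimensions are the trace of \<open>P Q\<close>, which is also that of \<open>Q P\<close>. This spares a comparison with the
  degree of the field.\<close>

lemma inverse_int_mats_same_dim:
  fixes P Q :: "int mat"
  assumes P: "P \<in> carrier_mat m n" and Q: "Q \<in> carrier_mat n m"
    and PQ: "P * Q = 1\<^sub>m m" "Q * P = 1\<^sub>m n"
  shows "m = n"
proof -
  have "int m = (\<Sum>i<m. (P * Q) $$ (i, i))" using PQ by simp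
  also have "\<dots> = (\<Sum>i<m. \<Sum>j<n. P $$ (i, j) * Q $$ (j, i))"
    using P Q by (intro sum.cong refl) (simp add: scalar_prod_def lessThan_atLeast0)
  also have "\<dots> = (\<Sum>j<n. \<Sum>i<m. Q $$ (j, i) * P $$ (i, j))"
    by (subst sum.swap) (simp add: mult.commute)
  also have "\<dots> = (\<Sum>j<n. (Q * P) $$ (j, j))"
    using P Q by (intro sum.cong refl) (simp add: scalar_prod_def lessThan_atLeast0)
  also have "\<dots> = int n" using PQ by simp
  finally show ?thesis by simp
qed

lemma trace_matrix_base_change:
  assumes K: "subfield K complex_ring" and vs: "set vs \<subseteq> K"
    and P: "P \<in> carrier_mat (length ws) (length vs)"
      "\<And>i. i < length ws \<Longrightarrow> ws ! i = (\<Sum>j<length vs. of_int (P $$ (i, j)) * vs ! j)"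
  shows "trace_matrix K ws = map_mat of_int P * trace_matrix K vs * transpose_mat (map_mat of_int P)"
    (is "?L = ?R")
proof (rule eq_matI)
  let ?m = "length ws" and ?n = "length vs"
  note KD = subfield_complexD[OF K]
  have vK: "vs ! j \<in> K" if "j < ?n" for j using vs that by (meson nth_mem subsetD)
  fix i k assume "i < dim_row ?R" "k < dim_col ?R"
  then have i: "i < ?m" and k: "k < ?m" using P by auto
  have "?L $$ (i, k) = field_trace K (ws ! i * ws ! k)" using i k by (simp add: trace_matrix_def)
  also have "ws ! i * ws ! k = (\<Sum>p\<in>{..<?n} \<times> {..<?n}. of_int (P $$ (i, fst p) * P $$ (k, snd p)) * (vs ! fst p * vs ! snd p))"
    unfolding P(2)[OF i] P(2)[OF k] sum_product sum.cartesian_product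
    by (intro sum.cong refl) (auto simp: mult_ac)
  also have "field_trace K \<dots> = (\<Sum>p\<in>{..<?n} \<times> {..<?n}. of_int (P $$ (i, fst p) * P $$ (k, snd p)) * field_trace K (vs ! fst p * vs ! snd p))"
    by (rule field_trace_int_comb[OF K]) (auto intro!: KD vK)
  also have "\<dots> = (\<Sum>j<?n. \<Sum>l<?n. of_int (P $$ (i, j) * P $$ (k, l)) * field_trace K (vs ! j * vs ! l))"
    by (simp add: sum.cartesian_product case_prod_beta)
  also have "\<dots> = (\<Sum>l<?n. (\<Sum>j<?n. of_int (P $$ (i, j)) * field_trace K (vs ! j * vs ! l)) * of_int (P $$ (k, l)))"
    by (subst sum.swap) (simp add: sum_distrib_left sum_distrib_right mult_ac)
  also have "\<dots> = ?R $$ (i, k)"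
    using i k P(1) by (simp add: scalar_prod_def lessThan_atLeast0 trace_matrix_def)
  finally show "?L $$ (i, k) = ?R $$ (i, k)" .
qed (use P in \<open>auto simp: trace_matrix_def\<close>)

text \<open>A change of basis multiplies the determinant by the square of the determinant of an invertible integer
  matrix, which is \<open>1\<close>.\<close>

lemma integral_basis_det_unique:
  assumes K: "subfield K complex_ring" and ws: "integral_basis K ws" and vs: "integral_basis K vs"
  shows "Determinant.det (trace_matrix K ws) = Determinant.det (trace_matrix K vs)"
proof -
  obtain P where P: "P \<in> carrier_mat (length ws) (length vs)"
    "\<And>i. i < length ws \<Longrightarrow> ws ! i = (\<Sum>j<length vs. of_int (P $$ (i, j)) * vs ! j)"
    using integral_basis_base_change[OF ws vs] by blast
  obtain Q where Q: "Q \<in> carrier_mat (length vs) (length ws)"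
    "\<And>i. i < length vs \<Longrightarrow> vs ! i = (\<Sum>j<length ws. of_int (Q $$ (i, j)) * ws ! j)"
    using integral_basis_base_change[OF vs ws] by blast
  have PQ: "P * Q = 1\<^sub>m (length ws)" by (rule integral_basis_base_change_inverse[OF ws P Q])
  have QP: "Q * P = 1\<^sub>m (length vs)" by (rule integral_basis_base_change_inverse[OF vs Q P])
  have len: "length ws = length vs" by (rule inverse_int_mats_same_dim[OF P(1) Q(1) PQ QP])
  define n where "n = length vs"
  have P': "P \<in> carrier_mat n n" and Q': "Q \<in> carrier_mat n n" using P Q len by (simp_all add: n_def)
  have "Determinant.det P * Determinant.det Q = 1"
    using det_mult[OF P' Q'] PQ len by (simp add: n_def)
  then have dP: "Determinant.det P * Determinant.det P = 1" by (auto simp: zmult_eq_1_iff)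
  have T: "trace_matrix K vs \<in> carrier_mat n n" by (simp add: trace_matrix_def n_def)
  have C: "map_mat of_int P \<in> carrier_mat n n" using P' by simp
  have vsK: "set vs \<subseteq> K" using vs by (auto simp: integral_basis_def ring_of_integers_def)
  have "Determinant.det (trace_matrix K ws)
     = Determinant.det (map_mat of_int P) * Determinant.det (trace_matrix K vs) * Determinant.det (map_mat of_int P)"
  proof -
    have "Determinant.det (map_mat of_int P * trace_matrix K vs * transpose_mat (map_mat of_int P))
        = Determinant.det (map_mat of_int P * trace_matrix K vs) * Determinant.det (transpose_mat (map_mat of_int P))"
      by (rule det_mult[OF mult_carrier_mat[OF C T]]) (use C in simp)
    also have "\<dots> = Determinant.det (map_mat of_int P) * Determinant.det (trace_matrix K vs) * Determinant.det (map_mat of_int P)"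
      by (simp only: det_mult[OF C T] det_transpose[OF C])
    finally show ?thesis using trace_matrix_base_change[OF K vsK P] by (simp only:)
  qed
  also have "Determinant.det (map_mat of_int P :: complex mat) = of_int (Determinant.det P)"
    by (rule of_int_hom.hom_det)
  also have "of_int (Determinant.det P) * Determinant.det (trace_matrix K vs) * of_int (Determinant.det P)
     = of_int (Determinant.det P * Determinant.det P) * Determinant.det (trace_matrix K vs)" by simp
  finally show ?thesis unfolding dP by simp
qed

lemma field_discriminant_eqI:
  assumes "subfield K complex_ring" "integral_basis K ws" "of_int d = Determinant.det (trace_matrix K ws)"
  shows "field_discriminant K = d"
  unfolding field_discriminant_def
proof (rule the_equality)
  show "\<exists>ws. integral_basis K ws \<and> of_int d = Determinant.det (trace_matrix K ws)" using assms by blast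
  fix d' assume "\<exists>ws. integral_basis K ws \<and> of_int d' = Determinant.det (trace_matrix K ws)"
  then show "d' = d"
    using integral_basis_det_unique[OF assms(1) assms(2)] assms(3) by (metis of_int_eq_iff)
qed

section \<open>Algebraic integers in biquadratic fields\<close>

lemma four_not_dvd_squarefree: "squarefree (j::int) \<Longrightarrow> j mod 4 \<noteq> 0"
  using squarefreeD[of j 2] by auto

lemma even_square_mod_4: "even (a::int) \<Longrightarrow> (a * a) mod 4 = 0"
  by (auto elim!: evenE)

lemma odd_square_mod_4: "odd (a::int) \<Longrightarrow> (a * a) mod 4 = 1"
proof -
  assume "odd a"
  then obtain b where "a = 2 * b + 1" by (rule oddE)
  then have "a * a = 4 * (b * b + b) + 1" by (simp add: algebra_simps)
  then show ?thesis by presburger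
qed

text \<open>Trace and norm \<open>2 p\<close> and \<open>p\<^sup>2 - j q\<^sup>2\<close> are rational algebraic integers. So \<open>j (2 q)\<^sup>2\<close> is an integer,
  whence \<open>2 q\<close> is one as \<open>j\<close> is squarefree, and the parities follow from \<open>P\<^sup>2 \<equiv> j Q\<^sup>2 (mod 4)\<close>.\<close>

lemma quadratic_integer_coords:
  fixes \<delta> :: complex and p q :: rat
  assumes sq: "squarefree j" "\<delta> * \<delta> = of_int j"
    and int: "algebraic_int (of_rat p + of_rat q * \<delta>)" "algebraic_int (of_rat p - of_rat q * \<delta>)"
  obtains P Q :: int where "p = of_int P / 2" "q = of_int Q / 2"
    "even P \<and> even Q \<or> odd P \<and> odd Q \<and> j mod 4 = 1"
proof -
  have "algebraic_int (of_rat (2 * p) :: complex)"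
    using algebraic_int_add[OF int] by (simp add: of_rat_mult)
  then obtain P where P: "2 * p = of_int P" using algebraic_int_of_rat_int by blast
  have "(of_rat p + of_rat q * \<delta>) * (of_rat p - of_rat q * \<delta>) = of_rat p * of_rat p - of_rat q * of_rat q * (\<delta> * \<delta>)"
    by (simp add: algebra_simps)
  also have "\<dots> = of_rat (p * p - of_int j * (q * q))" by (simp add: sq of_rat_diff of_rat_mult)
  finally have "algebraic_int (of_rat (p * p - of_int j * (q * q)) :: complex)"
    using algebraic_int_mult[OF int] by simp
  then obtain N where N: "p * p - of_int j * (q * q) = of_int N" using algebraic_int_of_rat_int by blast
  have "of_int j * ((2 * q) * (2 * q)) = (2 * p) * (2 * p) - 4 * (p * p - of_int j * (q * q))"
    by (simp add: algebra_simps)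
  then have jq: "of_int j * ((2 * q) * (2 * q)) = of_int (P * P - 4 * N)" unfolding P N by simp
  then obtain Q where Q: "2 * q = of_int Q" using squarefree_mult_square_int[OF sq(1)] by blast
  have eq: "j * (Q * Q) = P * P - 4 * N"
    using jq unfolding Q by (simp only: of_int_mult[symmetric] of_int_eq_iff)
  have parity: "even P \<and> even Q \<or> odd P \<and> odd Q \<and> j mod 4 = 1"
  proof (cases "even Q")
    case True
    then have "even (P * P - 4 * N)" using eq by (metis even_mult_iff)
    then show ?thesis using True by simp
  next
    case False
    then obtain r where "Q * Q = 4 * r + 1" using odd_square_mod_4[of Q] by (metis mod_mult_div_eq add.commute)
    then have PP: "P * P = j + 4 * (j * r + N)" using eq by (simp add: algebra_simps)
    then have "(P * P) mod 4 = j mod 4" by (simp only: mod_mult_self2)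
    then have "odd P" "j mod 4 = 1"
      using four_not_dvd_squarefree[OF sq(1)] even_square_mod_4[of P] odd_square_mod_4[of P] by auto
    then show ?thesis using False by simp
  qed
  show thesis
    by (rule that[of P Q]) (use P Q parity in \<open>auto simp: field_simps\<close>)
qed

text \<open>The factors \<open>x, y, z\<close> are \<open>gcd(m, n)\<close>, \<open>m / gcd(m, n)\<close> and \<open>n / gcd(m, n)\<close> up to a common sign. The
  description is symmetric: the three radicands are the products of two of the factors, and the
  product of two of the square roots is the common factor times the third one.\<close>

locale sqrt_triple = sqrt_pair m n \<alpha> \<beta> for m n :: int and \<alpha> \<beta> :: complex +
  fixes x y z :: int and \<gamma> :: complex
  assumes m_eq: "m = x * y" and n_eq: "n = x * z" and sqfree_k: "squarefree (y * z)"
    and alpha_beta: "\<alpha> * \<beta> = of_int x * \<gamma>"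
begin

abbreviation k :: int where "k \<equiv> y * z"

lemma xyz_nz [simp]: "x \<noteq> 0" "y \<noteq> 0" "z \<noteq> 0"
  using m_nz m_eq n_eq by auto

lemma gamma_square: "\<gamma> * \<gamma> = of_int k"
proof -
  have "of_int x * \<gamma> * (of_int x * \<gamma>) = (\<alpha> * \<alpha>) * (\<beta> * \<beta>)"
    unfolding alpha_beta[symmetric] by (simp add: mult_ac)
  then have "of_int x * of_int x * (\<gamma> * \<gamma>) = of_int x * of_int x * (of_int k :: complex)"
    unfolding square m_eq n_eq by (simp add: mult_ac)
  then show ?thesis by simp
qed

lemma alpha_gamma: "\<alpha> * \<gamma> = of_int y * \<beta>"
proof -
  have "of_int x * (\<alpha> * \<gamma>) = \<alpha> * \<alpha> * \<beta>" using alpha_beta by (metis mult.assoc mult.left_commute)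
  also have "\<dots> = of_int x * (of_int y * \<beta>)" unfolding square m_eq by (simp add: mult_ac)
  finally show ?thesis by simp
qed

lemma beta_gamma: "\<beta> * \<gamma> = of_int z * \<alpha>"
proof -
  have "of_int x * (\<beta> * \<gamma>) = \<beta> * \<beta> * \<alpha>" using alpha_beta by (metis mult.assoc mult.commute)
  also have "\<dots> = of_int x * (of_int z * \<alpha>)" unfolding square n_eq by (simp add: mult_ac)
  finally show ?thesis by simp
qed

lemma k_ne: "k \<noteq> 1" "k \<noteq> m" "k \<noteq> n"
proof -
  show "k \<noteq> 1"
  proof
    assume "k = 1"
    then have "y = z" by (auto simp: zmult_eq_1_iff)
    then show False using ne m_eq n_eq by simp
  qed
  show "k \<noteq> m"
  proof
    assume "k = m"
    then have "x = z" by (simp add: m_eq mult.commute)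
    then have "squarefree (z * z)" using sqfree n_eq by simp
    then have "is_unit z" by (metis squarefreeD power2_eq_square dvd_refl)
    then have "n = 1" using \<open>x = z\<close> n_eq by (auto simp: zdvd1_eq abs_if split: if_splits)
    then show False using ne by simp
  qed
  show "k \<noteq> n"
  proof
    assume "k = n"
    then have "x = y" by (simp add: n_eq)
    then have "squarefree (y * y)" using sqfree m_eq by simp
    then have "is_unit y" by (metis squarefreeD power2_eq_square dvd_refl)
    then have "m = 1" using \<open>x = y\<close> m_eq by (auto simp: zdvd1_eq abs_if split: if_splits)
    then show False using ne by simp
  qed
qed

text \<open>Coordinates with respect to the square roots of all three radicands; \<open>elt\<close> uses \<open>\<alpha> \<beta>\<close> instead
  of \<open>\<gamma>\<close>.\<close>

definition elt3 :: "rat \<Rightarrow> rat \<Rightarrow> rat \<Rightarrow> rat \<Rightarrow> complex" where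
  "elt3 a b c d = of_rat a + of_rat b * \<alpha> + of_rat c * \<beta> + of_rat d * \<gamma>"

lemma elt3_elt: "elt3 a b c d = elt a b c (d / of_int x)"
  unfolding elt3_def elt_def alpha_beta by (simp add: of_rat_divide)

lemma elt_elt3: "elt a b c d = elt3 a b c (d * of_int x)"
  unfolding elt3_elt by simp

lemma elt3_in_K [simp]: "elt3 a b c d \<in> K" by (simp add: elt3_elt)

lemma K_cases3: assumes "w \<in> K" obtains a b c d where "w = elt3 a b c d"
  using assms elt_elt3 by (auto simp: K_iff)

lemma elt3_eq_iff [simp]: "elt3 a b c d = elt3 a' b' c' d' \<longleftrightarrow> a = a' \<and> b = b' \<and> c = c' \<and> d = d'"
  by (simp add: elt3_elt)

lemma conj_elt3 [simp]: "conj s t (elt3 a b c d) = elt3 a (s * b) (t * c) (s * t * d)"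
  by (simp add: elt3_elt)

lemma trace_elt3: "field_trace K (elt3 a b c d) = of_rat (4 * a)"
  by (simp add: elt3_elt field_trace_elt)

lemma elt3_add: "elt3 a b c d + elt3 a' b' c' d' = elt3 (a + a') (b + b') (c + c') (d + d')"
  by (simp add: elt3_def of_rat_add algebra_simps)

lemma elt3_diff: "elt3 a b c d - elt3 a' b' c' d' = elt3 (a - a') (b - b') (c - c') (d - d')"
  by (simp add: elt3_def of_rat_diff algebra_simps)

lemma elt3_scale: "of_rat r * elt3 a b c d = elt3 (r * a) (r * b) (r * c) (r * d)"
  by (simp add: elt3_def of_rat_mult algebra_simps)

lemma elt3_scale_int: "of_int r * elt3 a b c d = elt3 (of_int r * a) (of_int r * b) (of_int r * c) (of_int r * d)"
  using elt3_scale[of "of_int r"] by simp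

lemma elt3_mult: "elt3 a b c d * elt3 a' b' c' d' = elt3
    (a * a' + of_int m * b * b' + of_int n * c * c' + of_int k * d * d')
    (a * b' + b * a' + of_int z * (c * d' + d * c'))
    (a * c' + c * a' + of_int y * (b * d' + d * b'))
    (a * d' + d * a' + of_int x * (b * c' + c * b'))"
proof -
  have *: "\<alpha> * (\<alpha> * w) = of_int m * w" "\<beta> * (\<beta> * w) = of_int n * w" "\<gamma> * (\<gamma> * w) = of_int y * (of_int z * w)"
    "\<alpha> * (\<beta> * w) = of_int x * (\<gamma> * w)" "\<alpha> * (\<gamma> * w) = of_int y * (\<beta> * w)" "\<beta> * (\<gamma> * w) = of_int z * (\<alpha> * w)" for w
    using square alpha_beta alpha_gamma beta_gamma gamma_square by (metis mult.assoc of_int_mult)+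
  have **: "\<gamma> * \<gamma> = of_int y * of_int z" using gamma_square by simp
  show ?thesis
    unfolding elt3_def
    by (simp add: of_rat_add of_rat_mult algebra_simps * ** square alpha_beta alpha_gamma beta_gamma)
qed

text \<open>Every automorphism maps \<open>w\<close> to \<open>w\<close> or \<open>-w\<close>, so \<open>w\<close> has only one nonzero coordinate. Then \<open>j\<close> is in the
  square class of \<open>1\<close>, \<open>m\<close>, \<open>n\<close> or \<open>k\<close>.\<close>

lemma sqrt_in_K:
  assumes w: "w \<in> K" "w * w = of_int j" "squarefree j"
  shows "j \<in> {1, m, n, k}"
proof -
  obtain a b c d where w': "w = elt3 a b c d" using w(1) by (rule K_cases3)
  have one: "of_int j = elt3 (of_int j) 0 0 0" by (simp add: elt3_def)
  have ev: "conj s t w = w \<or> conj s t w = - w" if "s \<in> signs" "t \<in> signs" for s t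
  proof -
    have "conj s t w * conj s t w = conj s t (w * w)" using conj_mult[OF that w(1) w(1)] by simp
    also have "\<dots> = w * w" unfolding w(2) one by simp
    finally show ?thesis by (simp add: square_eq_iff)
  qed
  have minus: "- w = elt3 (- a) (- b) (- c) (- d)" by (simp add: w' elt3_def of_rat_minus)
  have 1: "c = 0 \<and> d = 0 \<or> a = 0 \<and> b = 0" using ev[of 1 "-1"] minus by (auto simp: w')
  have 2: "b = 0 \<and> d = 0 \<or> a = 0 \<and> c = 0" using ev[of "-1" 1] minus by (auto simp: w')
  have j: "of_int j = a * a + of_int m * b * b + of_int n * c * c + of_int k * d * d"
  proof -
    have "elt3 (of_int j) 0 0 0 = w * w" using w(2) one by simp
    then show ?thesis unfolding w' elt3_mult by simp
  qed
  from 1 2 have "b = 0 \<and> c = 0 \<and> d = 0 \<or> a = 0 \<and> c = 0 \<and> d = 0 \<or> a = 0 \<and> b = 0 \<and> d = 0 \<or> a = 0 \<and> b = 0 \<and> c = 0"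
    by auto
  then consider "of_int j = a ^ 2 * of_int 1" | "of_int j = b ^ 2 * of_int m" | "of_int j = c ^ 2 * of_int n"
    | "of_int j = d ^ 2 * of_int k"
    using j by (auto simp: power2_eq_square mult_ac)
  then show ?thesis
    using squarefree_int_square_ratio[OF w(3)] sqfree sqfree_k squarefree_1 by cases blast+
qed

lemma conj_algebraic_int:
  assumes "algebraic_int w" "w \<in> K" "s \<in> signs" "t \<in> signs"
  shows "algebraic_int (conj s t w)"
proof -
  obtain p where p: "lead_coeff p = 1" "\<And>i. coeff p i \<in> \<int>" "poly p w = 0"
    using assms(1) by cases auto
  note KD = subfield_complexD[OF subfield_K]
  have "\<forall>i. \<exists>k. coeff p i = of_int k" using p(2) Ints_cases by metis
  then obtain c where c: "\<And>i. coeff p i = of_int (c i)" by metis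
  have intK: "of_int c \<in> K" for c using KD(9)[of "of_int c"] by simp
  have cint: "conj s t (of_int c) = of_int c" for c using conj_of_rat[of s t "of_int c"] by simp
  have powK: "w ^ i \<in> K" for i by (induction i) (auto intro: KD assms)
  have pow: "conj s t (w ^ i) = conj s t w ^ i" for i
    by (induction i) (auto simp: conj_mult assms powK)
  have sumK: "(\<Sum>i<d. of_int (c i) * w ^ i) \<in> K" for d by (induction d) (auto intro!: KD intK powK)
  have "conj s t (\<Sum>i<d. of_int (c i) * w ^ i) = (\<Sum>i<d. of_int (c i) * conj s t w ^ i)" for d
  proof (induction d)
    case 0
    then show ?case using cint[of 0] by simp
  next
    case (Suc d)
    then show ?case by (simp add: conj_add sumK KD intK powK conj_mult assms cint pow)
  qed
  from this[of "Suc (degree p)"] have "conj s t (poly p w) = poly p (conj s t w)"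
    by (simp add: poly_altdef c lessThan_Suc_atMost)
  then have "poly p (conj s t w) = 0" using p(3) cint[of 0] by simp
  then show ?thesis using p by (intro algebraic_int.intros) auto
qed

text \<open>Adding to an algebraic integer its conjugate over one of the three quadratic subfields gives an
  integer of that subfield, whose coordinates are known.\<close>

lemma half_trace_parity:
  assumes "algebraic_int (elt3 a b c d)"
  obtains A B C D :: int where "a = of_int A / 4" "b = of_int B / 4" "c = of_int C / 4" "d = of_int D / 4"
    "even A \<and> even B \<and> even C \<and> even D \<or>
     odd A \<and> odd B \<and> odd C \<and> odd D \<and> m mod 4 = 1 \<and> n mod 4 = 1 \<and> k mod 4 = 1"
proof -
  define w where "w = elt3 a b c d"
  have w: "w \<in> K" "algebraic_int w" using assms by (simp_all add: w_def)
  have ci: "algebraic_int (conj s t w)" if "s \<in> signs" "t \<in> signs" for s t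
    by (rule conj_algebraic_int[OF w(2,1) that])
  note ci = ci[of 1 "-1"] ci[of "-1" 1] ci[of "-1" "-1"]
  have "algebraic_int (w + conj 1 (-1) w)" "algebraic_int (conj (-1) 1 w + conj (-1) (-1) w)"
    by (intro algebraic_int_add w ci; simp)+
  then have "algebraic_int (of_rat (2 * a) + of_rat (2 * b) * \<alpha>)" "algebraic_int (of_rat (2 * a) - of_rat (2 * b) * \<alpha>)"
    by (simp_all add: w_def elt3_add) (simp_all add: elt3_def of_rat_minus)
  from quadratic_integer_coords[OF sqfree(1) square(1) this]
  obtain A B where AB: "2 * a = of_int A / 2" "2 * b = of_int B / 2" "even A \<and> even B \<or> odd A \<and> odd B \<and> m mod 4 = 1"
    by metis
  have "algebraic_int (w + conj (-1) 1 w)" "algebraic_int (conj 1 (-1) w + conj (-1) (-1) w)"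
    by (intro algebraic_int_add w ci; simp)+
  then have "algebraic_int (of_rat (2 * a) + of_rat (2 * c) * \<beta>)" "algebraic_int (of_rat (2 * a) - of_rat (2 * c) * \<beta>)"
    by (simp_all add: w_def elt3_add) (simp_all add: elt3_def of_rat_minus)
  from quadratic_integer_coords[OF sqfree(2) square(2) this]
  obtain A' C where AC: "2 * a = of_int A' / 2" "2 * c = of_int C / 2" "even A' \<and> even C \<or> odd A' \<and> odd C \<and> n mod 4 = 1"
    by metis
  have "algebraic_int (w + conj (-1) (-1) w)" "algebraic_int (conj 1 (-1) w + conj (-1) 1 w)"
    by (intro algebraic_int_add w ci; simp)+
  then have "algebraic_int (of_rat (2 * a) + of_rat (2 * d) * \<gamma>)" "algebraic_int (of_rat (2 * a) - of_rat (2 * d) * \<gamma>)"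
    by (simp_all add: w_def elt3_add) (simp_all add: elt3_def of_rat_minus)
  from quadratic_integer_coords[OF sqfree_k gamma_square this]
  obtain A'' D where AD: "2 * a = of_int A'' / 2" "2 * d = of_int D / 2" "even A'' \<and> even D \<or> odd A'' \<and> odd D \<and> k mod 4 = 1"
    by metis
  have "A' = A" "A'' = A" using AB AC AD by simp_all
  then show thesis using that[of A B C D] AB AC AD by auto
qed

text \<open>The norm of the algebraic integer to the subfield generated by \<open>\<alpha>\<close> is an integer of that subfield.\<close>

lemma relative_norm_parity:
  fixes A B C D :: int
  assumes "algebraic_int (elt3 (of_int A / 4) (of_int B / 4) (of_int C / 4) (of_int D / 4))"
  obtains P Q :: int where "A * A + B * B * m - C * C * n - D * D * k = 8 * P" "A * B - C * D * z = 4 * Q"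
    "even P \<and> even Q \<or> odd P \<and> odd Q \<and> m mod 4 = 1"
proof -
  define w where "w = elt3 (of_int A / 4) (of_int B / 4) (of_int C / 4) (of_int D / 4)"
  have w: "w \<in> K" "algebraic_int w" using assms by (simp_all add: w_def)
  have ci: "algebraic_int (conj s t w)" if "s \<in> signs" "t \<in> signs" for s t
    by (rule conj_algebraic_int[OF w(2,1) that])
  define p where "p = (of_int (A * A + B * B * m - C * C * n - D * D * k) / 16 :: rat)"
  define q where "q = (of_int (A * B - C * D * z) / 8 :: rat)"
  have "w * conj 1 (-1) w = elt3 p q 0 0"
    by (simp add: w_def elt3_mult p_def q_def field_simps)
  moreover have "conj (-1) 1 w * conj (-1) (-1) w = elt3 p (- q) 0 0"
    by (simp add: w_def elt3_mult p_def q_def field_simps)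
  moreover have "algebraic_int (w * conj 1 (-1) w)" "algebraic_int (conj (-1) 1 w * conj (-1) (-1) w)"
    by (intro algebraic_int_mult w ci; simp)+
  ultimately have "algebraic_int (of_rat p + of_rat q * \<alpha>)" "algebraic_int (of_rat p - of_rat q * \<alpha>)"
    by (simp_all add: elt3_def of_rat_minus)
  from quadratic_integer_coords[OF sqfree(1) square(1) this]
  obtain P Q where PQ: "p = of_int P / 2" "q = of_int Q / 2" "even P \<and> even Q \<or> odd P \<and> odd Q \<and> m mod 4 = 1"
    by metis
  have "of_int (A * A + B * B * m - C * C * n - D * D * k) = (of_int (8 * P) :: rat)"
    using PQ(1) unfolding p_def by (simp add: field_simps)
  moreover have "of_int (A * B - C * D * z) = (of_int (4 * Q) :: rat)"
    using PQ(2) unfolding q_def by (simp add: field_simps)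
  ultimately show thesis using that[of P Q] PQ(3) by (simp only: of_int_eq_iff)
qed

end

section \<open>Integral bases\<close>

text \<open>For squarefree \<open>j \<noteq> 1\<close> this is the discriminant of the quadratic field generated by \<open>\<surd>j\<close>.\<close>

definition disc_factor :: "int \<Rightarrow> int" where
  "disc_factor j = (if j mod 4 = 1 then j else 4 * j)"

lemma algebraic_int_quadratic:
  fixes w :: complex
  assumes "w * w = of_int p * w + of_int q"
  shows "algebraic_int w"
proof (rule algebraic_int.intros)
  show "lead_coeff [:- of_int q, - of_int p, 1 :: complex:] = 1" by simp
  show "\<forall>i. coeff [:- of_int q, - of_int p, 1 :: complex:] i \<in> \<int>"
    by (auto simp: coeff_pCons split: nat.splits)
  show "poly [:- of_int q, - of_int p, 1 :: complex:] w = 0" using assms by (simp add: algebra_simps)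
qed

lemma algebraic_int_half_one_plus_sqrt:
  fixes \<delta> :: complex
  assumes "\<delta> * \<delta> = of_int j" "j mod 4 = 1"
  shows "algebraic_int ((1 + \<delta>) / 2)"
proof -
  obtain r where r: "j = 4 * r + 1" using assms(2) by (metis mod_mult_div_eq add.commute)
  have "(1 + \<delta>) / 2 * ((1 + \<delta>) / 2) = (1 + \<delta>) / 2 + (\<delta> * \<delta> - 1) / 4" by (simp add: field_simps)
  also have "(\<delta> * \<delta> - 1) / 4 = of_int r" by (simp add: assms(1) r)
  finally have "(1 + \<delta>) / 2 * ((1 + \<delta>) / 2) = of_int 1 * ((1 + \<delta>) / 2) + of_int r" by simp
  then show ?thesis by (rule algebraic_int_quadratic)
qed

lemma algebraic_int_of_square:
  fixes w :: complex
  assumes "algebraic_int (w * w)" shows "algebraic_int w"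
proof (rule algebraic_int_root[OF assms, of "[:0, 0, 1:]"])
  show "poly [:0, 0, 1:] w = w * w" by simp
qed (auto simp: coeff_pCons split: nat.splits)

text \<open>Eliminating \<open>P\<close> and \<open>Q\<close> gives \<open>A\<^sup>2 + m B\<^sup>2 - n C\<^sup>2 - k D\<^sup>2 - 2 (A B - z C D) \<equiv> 0\<close> modulo \<open>4\<close>. Here
  \<open>A\<^sup>2 + m B\<^sup>2 - 2 A B \<equiv> (A - B)\<^sup>2\<close>, and the rest is \<open>(C + D)\<^sup>2\<close> or \<open>-2 (C\<^sup>2 + D\<^sup>2)\<close> in the two cases.\<close>

lemma odd_coset_parity:
  fixes A B C D m n k z P Q :: int
  assumes m: "m mod 4 = 1" and nk: "n mod 4 = 2 \<and> k mod 4 = 2 \<and> even z \<or> n mod 4 = 3 \<and> k mod 4 = 3 \<and> odd z"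
    and eq: "A * A + B * B * m - C * C * n - D * D * k = 2 * P" "A * B - C * D * z = Q" "even (P - Q)"
  shows "even (A - B)" "even (C - D)"
proof -
  define a where "a = A - B"
  have Aa: "A = B + a" by (simp add: a_def)
  obtain m' where m': "m = 4 * m' + 1" using m by (metis mod_mult_div_eq add.commute)
  obtain t where "P - Q = 2 * t" using eq(3) by (rule evenE)
  then have E: "A * A + B * B * m - C * C * n - D * D * k - 2 * (A * B - C * D * z) = 4 * t"
    unfolding eq by simp
  have "even a \<and> even (C - D)"
    using nk
  proof
    assume "n mod 4 = 2 \<and> k mod 4 = 2 \<and> even z"
    then obtain n' k' z' where nkz: "n = 4 * n' + 2" "k = 4 * k' + 2" "z = 2 * z'"
      by (metis mod_mult_div_eq add.commute evenE)
    have "a * a - 2 * (C * C + D * D) = 4 * (t - B * B * m' + C * C * n' + D * D * k' - C * D * z')"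
      using E unfolding m' nkz Aa by (simp add: algebra_simps)
    then have 1: "4 dvd a * a - 2 * (C * C + D * D)" by simp
    then have "even (a * a - 2 * (C * C + D * D))" by (rule dvd_trans[rotated]) simp
    then have a: "even a" by simp
    then have "4 dvd a * a" using even_square_mod_4 by (simp add: mod_eq_0_iff_dvd)
    then have "4 dvd 2 * (C * C + D * D)" using 1 by (metis dvd_diff_right_iff dvd_diff_commute)
    then obtain r where "2 * (C * C + D * D) = 4 * r" by (elim dvdE)
    then have "C * C + D * D = 2 * r" by simp
    then have "even (C * C + D * D)" by simp
    then show ?thesis using a by simp
  next
    assume "n mod 4 = 3 \<and> k mod 4 = 3 \<and> odd z"
    then obtain n' k' z' where nkz: "n = 4 * n' + 3" "k = 4 * k' + 3" "z = 2 * z' + 1"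
      by (metis mod_mult_div_eq add.commute oddE)
    have "a * a + (C + D) * (C + D) = 4 * (t - B * B * m' + C * C * n' + D * D * k' + C * C + D * D - C * D * z')"
      using E unfolding m' nkz Aa by (simp add: algebra_simps)
    then have 1: "(a * a + (C + D) * (C + D)) mod 4 = 0" by simp
    have "even a \<and> even (C + D)"
    proof (rule ccontr)
      assume "\<not> (even a \<and> even (C + D))"
      then have "(a * a) mod 4 + ((C + D) * (C + D)) mod 4 \<in> {1, 2}"
        using even_square_mod_4 odd_square_mod_4 by (cases "even a"; cases "even (C + D)") auto
      moreover have "((a * a) mod 4 + ((C + D) * (C + D)) mod 4) mod 4 = 0" using 1 by (simp only: mod_add_eq)
      ultimately show False by auto
    qed
    then show ?thesis by simp
  qed
  then show "even (A - B)" "even (C - D)" by (simp_all add: a_def)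
qed

context sqrt_triple
begin

text \<open>In the coordinates of \<open>elt3\<close> the trace form is diagonal with entries \<open>4, 4 m, 4 n, 4 k\<close>. The trace matrix is
  therefore \<open>M G M\<^sup>T\<close> with \<open>M\<close> the matrix of coordinates, and a triangular \<open>M\<close> makes both the uniqueness of
  the coefficients and the determinant immediate.\<close>

lemma field_discriminant_rows:
  fixes W :: "nat \<Rightarrow> nat \<Rightarrow> rat" and w :: "nat \<Rightarrow> complex"
  assumes w: "\<And>i. w i = elt3 (W i 0) (W i 1) (W i 2) (W i 3)"
    and tri: "\<And>i j. i < j \<Longrightarrow> j < 4 \<Longrightarrow> W i j = 0" and diag: "\<And>i. i < 4 \<Longrightarrow> W i i \<noteq> 0"
    and int: "\<And>i. i < 4 \<Longrightarrow> algebraic_int (w i)"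
    and span: "\<And>u. u \<in> K \<Longrightarrow> algebraic_int u \<Longrightarrow>
        \<exists>c0 c1 c2 c3. u = of_int c0 * w 0 + of_int c1 * w 1 + of_int c2 * w 2 + of_int c3 * w 3"
    and d: "of_int d = 256 * of_int (m * n * k) * (W 0 0 * W 1 1 * W 2 2 * W 3 3) ^ 2"
  shows "field_discriminant K = d"
proof (rule field_discriminant_eqI)
  let ?ws = "map w [0..<4]"
  have four: "{..<4::nat} = {0, 1, 2, 3}" by auto
  have comb: "(\<Sum>i<4. of_int (c i) * w i) = of_int (c 0) * w 0 + of_int (c 1) * w 1 + of_int (c 2) * w 2 + of_int (c 3) * w 3" for c
    by (simp add: four)
  have coord: "(\<Sum>i<4. of_int (c i) * w i)
     = elt3 (of_int (c 0) * W 0 0 + of_int (c 1) * W 1 0 + of_int (c 2) * W 2 0 + of_int (c 3) * W 3 0)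
         (of_int (c 1) * W 1 1 + of_int (c 2) * W 2 1 + of_int (c 3) * W 3 1)
         (of_int (c 2) * W 2 2 + of_int (c 3) * W 3 2) (of_int (c 3) * W 3 3)" for c
    unfolding comb unfolding w elt3_scale_int elt3_add by (simp add: tri del: One_nat_def)
  show "subfield K complex_ring" by (rule subfield_K)
  show "integral_basis K ?ws"
    unfolding integral_basis_def
  proof (intro conjI ballI)
    show "set ?ws \<subseteq> ring_of_integers K"
      using int by (auto simp: ring_of_integers_def) (simp add: w)
    fix u assume "u \<in> ring_of_integers K"
    then have "u \<in> K" "algebraic_int u" by (auto simp: ring_of_integers_def)
    from span[OF this] obtain c0 c1 c2 c3
      where u: "u = of_int c0 * w 0 + of_int c1 * w 1 + of_int c2 * w 2 + of_int c3 * w 3" by blast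
    define c where "c = restrict (\<lambda>i. if i = 0 then c0 else if i = 1 then c1 else if i = 2 then c2 else c3) {..<4::nat}"
    show "\<exists>!c. c \<in> extensional {..<length ?ws} \<and> u = (\<Sum>i<length ?ws. of_int (c i) * ?ws ! i)"
    proof (rule ex1I[of _ c])
      show "c \<in> extensional {..<length ?ws} \<and> u = (\<Sum>i<length ?ws. of_int (c i) * ?ws ! i)"
        using comb[of c] by (simp add: c_def u)
      fix c' assume c': "c' \<in> extensional {..<length ?ws} \<and> u = (\<Sum>i<length ?ws. of_int (c' i) * ?ws ! i)"
      have "(\<Sum>i<4. of_int (c' i) * w i) = (\<Sum>i<4. of_int (c i) * w i)"
        using c' comb[of c] by (simp add: c_def u)
      then have eq: "of_int (c' 3) * W 3 3 = of_int (c 3) * W 3 3"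
        "of_int (c' 2) * W 2 2 + of_int (c' 3) * W 3 2 = of_int (c 2) * W 2 2 + of_int (c 3) * W 3 2"
        "of_int (c' 1) * W 1 1 + of_int (c' 2) * W 2 1 + of_int (c' 3) * W 3 1 = of_int (c 1) * W 1 1 + of_int (c 2) * W 2 1 + of_int (c 3) * W 3 1"
        "of_int (c' 0) * W 0 0 + of_int (c' 1) * W 1 0 + of_int (c' 2) * W 2 0 + of_int (c' 3) * W 3 0 = of_int (c 0) * W 0 0 + of_int (c 1) * W 1 0 + of_int (c 2) * W 2 0 + of_int (c 3) * W 3 0"
        unfolding coord elt3_eq_iff by auto
      have 3: "c' 3 = c 3" using eq(1) diag[of 3] by simp
      have 2: "c' 2 = c 2" using eq(2) diag[of 2] by (simp add: 3)
      have 1: "c' 1 = c 1" using eq(3) diag[of 1] by (simp add: 2 3 del: One_nat_def)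
      have 0: "c' 0 = c 0" using eq(4) diag[of 0] by (simp add: 1 2 3 del: One_nat_def)
      show "c' = c"
      proof (rule extensionalityI[of _ "{..<4}"])
        show "c' \<in> extensional {..<4}" using c' by simp
        show "c \<in> extensional {..<4}" by (simp add: c_def)
        show "c' i = c i" if "i \<in> {..<4}" for i using that 0 1 2 3 unfolding four by auto
      qed
    qed
  qed
  define M where "M = mat 4 4 (\<lambda>(i, j). of_rat (W i j) :: complex)"
  define e where "e = (\<lambda>i::nat. if i = 0 then 1 else if i = 1 then m else if i = 2 then n else k)"
  define G where "G = mat 4 4 (\<lambda>(i, j). if i = j then 4 * of_int (e i) else 0 :: complex)"
  have M: "M \<in> carrier_mat 4 4" and G: "G \<in> carrier_mat 4 4" by (simp_all add: M_def G_def)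
  have sum4: "(\<Sum>i\<in>{0..<4}. f i) = f 0 + f 1 + f 2 + f 3" for f :: "nat \<Rightarrow> complex"
    by (simp add: eval_nat_numeral)
  have "trace_matrix K ?ws = M * G * transpose_mat M"
  proof (rule eq_matI)
    fix i j assume "i < dim_row (M * G * transpose_mat M)" "j < dim_col (M * G * transpose_mat M)"
    then have i: "i < 4" and j: "j < 4" using M by auto
    have "trace_matrix K ?ws $$ (i, j) = field_trace K (w i * w j)"
      using i j by (simp add: trace_matrix_def)
    also have "\<dots> = of_rat (4 * (W i 0 * W j 0 + of_int m * W i 1 * W j 1 + of_int n * W i 2 * W j 2 + of_int k * W i 3 * W j 3))"
      unfolding w elt3_mult trace_elt3 ..
    also have "\<dots> = (M * G * transpose_mat M) $$ (i, j)"
    proof -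
      have MG: "(M * G) $$ (i, l) = of_rat (W i l) * (4 * of_int (e l))" if l: "l < 4" for l
      proof -
        have "(M * G) $$ (i, l) = (\<Sum>r\<in>{0..<4}. of_rat (W i r) * (if r = l then 4 * of_int (e r) else 0))"
          using i l by (simp add: M_def G_def scalar_prod_def)
        also have "\<dots> = (\<Sum>r\<in>{0..<4}. if r = l then of_rat (W i r) * (4 * of_int (e r)) else 0)"
          by (intro sum.cong) auto
        finally show ?thesis using l by simp
      qed
      have "(M * G * transpose_mat M) $$ (i, j) = (\<Sum>l\<in>{0..<4}. (M * G) $$ (i, l) * of_rat (W j l))"
      proof -
        define H where "H = M * G"
        have "H \<in> carrier_mat 4 4" unfolding H_def using M G by simp
        then show ?thesis unfolding H_def[symmetric]
          using i j by (simp add: scalar_prod_def M_def)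
      qed
      also have "\<dots> = (\<Sum>l\<in>{0..<4}. of_rat (W i l) * (4 * of_int (e l)) * of_rat (W j l))"
        by (intro sum.cong refl) (simp add: MG)
      finally show ?thesis unfolding sum4 by (simp add: e_def of_rat_add of_rat_mult algebra_simps)
    qed
    finally show "trace_matrix K ?ws $$ (i, j) = (M * G * transpose_mat M) $$ (i, j)" .
  qed (use M in \<open>simp_all add: trace_matrix_def\<close>)
  then have "Determinant.det (trace_matrix K ?ws) = Determinant.det (M * G * transpose_mat M)" by simp
  also have "\<dots> = Determinant.det (M * G) * Determinant.det (transpose_mat M)"
    by (rule det_mult[OF mult_carrier_mat[OF M G]]) (use M in simp)
  also have "\<dots> = Determinant.det M * Determinant.det G * Determinant.det M"
    by (simp only: det_mult[OF M G] det_transpose[OF M])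
  also have "Determinant.det M = of_rat (W 0 0 * W 1 1 * W 2 2 * W 3 3)"
  proof -
    have "Determinant.det M = prod_list (diag_mat M)"
      by (rule det_lower_triangular[OF _ M]) (simp add: M_def tri)
    then show ?thesis by (simp add: diag_mat_def M_def upt_rec of_rat_mult eval_nat_numeral mult_ac)
  qed
  also have "Determinant.det G = 256 * of_int (m * n * k)"
  proof -
    have "Determinant.det G = prod_list (diag_mat G)"
      by (rule det_lower_triangular[OF _ G]) (simp add: G_def)
    then show ?thesis by (simp add: diag_mat_def G_def upt_rec e_def eval_nat_numeral)
  qed
  finally have "Determinant.det (trace_matrix K ?ws)
      = of_rat (256 * of_int (m * n * k) * (W 0 0 * W 1 1 * W 2 2 * W 3 3) ^ 2)"
    by (simp add: of_rat_mult power2_eq_square)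
  also have "\<dots> = of_rat (of_int d)" unfolding d ..
  finally show "of_int d = Determinant.det (trace_matrix K ?ws)" by simp
qed

lemma field_discriminant_triangular:
  assumes "pb \<noteq> 0" "qc \<noteq> 0" "rd \<noteq> 0"
    and int: "algebraic_int (elt3 pa pb 0 0)" "algebraic_int (elt3 qa qb qc 0)" "algebraic_int (elt3 ra rb rc rd)"
    and span: "\<And>u. u \<in> K \<Longrightarrow> algebraic_int u \<Longrightarrow> \<exists>c0 c1 c2 c3.
        u = of_int c0 + of_int c1 * elt3 pa pb 0 0 + of_int c2 * elt3 qa qb qc 0 + of_int c3 * elt3 ra rb rc rd"
    and d: "of_int d = 256 * of_int (m * n * k) * (pb * qc * rd) ^ 2"
  shows "field_discriminant K = d"
proof -
  define W where "W i j = [[1, 0, 0, 0], [pa, pb, 0, 0], [qa, qb, qc, 0], [ra, rb, rc, rd]] ! i ! j" for i j :: nat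
  define w where "w i = elt3 (W i 0) (W i 1) (W i 2) (W i 3)" for i
  have w: "w 0 = 1" "w 1 = elt3 pa pb 0 0" "w 2 = elt3 qa qb qc 0" "w 3 = elt3 ra rb rc rd"
    by (simp_all add: w_def W_def eval_nat_numeral) (simp add: elt3_def)
  have cases4: "i = 0 \<or> i = 1 \<or> i = 2 \<or> i = 3" if "i < 4" for i :: nat using that by auto
  show ?thesis
  proof (rule field_discriminant_rows[of w W])
    show "w i = elt3 (W i 0) (W i 1) (W i 2) (W i 3)" for i by (rule w_def)
    show "W i j = 0" if "i < j" "j < 4" for i j
      using cases4[of i] cases4[of j] that by (auto simp: W_def eval_nat_numeral)
    show "W i i \<noteq> 0" if "i < 4" for i
      using cases4[OF that] assms(1-3) by (auto simp: W_def eval_nat_numeral)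
    show "algebraic_int (w i)" if "i < 4" for i
      using cases4[OF that] int by (auto simp: w simp del: One_nat_def)
    show "\<exists>c0 c1 c2 c3. u = of_int c0 * w 0 + of_int c1 * w 1 + of_int c2 * w 2 + of_int c3 * w 3"
      if "u \<in> K" "algebraic_int u" for u
      using span[OF that] by (simp add: w del: One_nat_def)
    show "of_int d = 256 * of_int (m * n * k) * (W 0 0 * W 1 1 * W 2 2 * W 3 3) ^ 2"
      unfolding d by (simp add: W_def eval_nat_numeral)
  qed
qed

lemma of_int_elt3: "of_int c = elt3 (of_int c) 0 0 0"
  by (simp add: elt3_def)

text \<open>The fourth basis element differs from the product of the second and the third by \<open>(x - 1) / 4\<close> times
  \<open>\<gamma>\<close>, so it is an algebraic integer. Subtracting multiples of the
  fourth element leaves elements \<open>(A + B \<alpha> + C \<beta>) / 2\<close>, for which the relative norm forces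
  \<open>A + B + C\<close> to be even.\<close>

lemma discriminant_all_1:
  assumes "x mod 4 = 1" "y mod 4 = 1" "z mod 4 = 1"
  shows "field_discriminant K = m * n * k"
proof (rule field_discriminant_triangular[where pa = "1/2" and pb = "1/2" and qa = "1/2" and qb = 0 and qc = "1/2"
      and ra = "1/4" and rb = "1/4" and rc = "1/4" and rd = "1/4"])
  obtain x' where x': "x = 4 * x' + 1" using assms(1) by (metis mod_mult_div_eq add.commute)
  have mod1: "(a * b) mod 4 = 1" if "a mod 4 = 1" "b mod 4 = 1" for a b :: int
    using that mod_mult_eq[of a 4 b] by simp
  have m1: "m mod 4 = 1" and n1: "n mod 4 = 1" and k1: "k mod 4 = 1" using mod1 assms m_eq n_eq by simp_all
  have e1: "elt3 (1/2) (1/2) 0 0 = (1 + \<alpha>) / 2" by (simp add: elt3_def of_rat_divide field_simps)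
  have e2: "elt3 (1/2) 0 (1/2) 0 = (1 + \<beta>) / 2" by (simp add: elt3_def of_rat_divide field_simps)
  show i1: "algebraic_int (elt3 (1/2) (1/2) 0 0)"
    unfolding e1 by (rule algebraic_int_half_one_plus_sqrt[OF square(1) m1])
  show i2: "algebraic_int (elt3 (1/2) 0 (1/2) 0)"
    unfolding e2 by (rule algebraic_int_half_one_plus_sqrt[OF square(2) n1])
  have gam: "algebraic_int \<gamma>"
    by (rule algebraic_int_of_square) (unfold gamma_square, rule algebraic_int_of_int)
  have "elt3 (1/4) (1/4) (1/4) (1/4) = elt3 (1/2) (1/2) 0 0 * elt3 (1/2) 0 (1/2) 0 - of_int x' * \<gamma>"
  proof -
    have "\<gamma> = elt3 0 0 0 1" by (simp add: elt3_def)
    then have "of_int x' * \<gamma> = elt3 0 0 0 (of_int x')" using elt3_scale_int[of x' 0 0 0 1] by simp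
    then show ?thesis by (simp add: elt3_mult elt3_diff x')
  qed
  then show i3: "algebraic_int (elt3 (1/4) (1/4) (1/4) (1/4))"
    using algebraic_int_diff[OF algebraic_int_mult[OF i1 i2] algebraic_int_mult[OF algebraic_int_of_int gam]] by simp
  show "of_int (m * n * k) = 256 * of_int (m * n * k) * ((1/2) * (1/2) * (1/4) :: rat) ^ 2"
    by (simp add: power2_eq_square)
  fix u assume u: "u \<in> K" "algebraic_int u"
  obtain a b c d where u': "u = elt3 a b c d" using u(1) by (rule K_cases3)
  obtain A B C D :: int where ABCD: "a = of_int A / 4" "b = of_int B / 4" "c = of_int C / 4" "d = of_int D / 4"
    and par: "even A \<and> even B \<and> even C \<and> even D \<or> odd A \<and> odd B \<and> odd C \<and> odd D"
    using half_trace_parity[of a b c d] u(2) u' by metis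
  obtain A1 B1 C1 where A1: "A - D = 2 * A1" "B - D = 2 * B1" "C - D = 2 * C1"
  proof -
    have "even (A - D)" "even (B - D)" "even (C - D)" using par by auto
    then show thesis using that by (elim evenE) blast
  qed
  have ABC: "A = 2 * A1 + D" "B = 2 * B1 + D" "C = 2 * C1 + D" using A1 by auto
  have "algebraic_int (u - of_int D * elt3 (1/4) (1/4) (1/4) (1/4))"
    by (intro algebraic_int_diff u algebraic_int_mult i3) simp
  also have "u - of_int D * elt3 (1/4) (1/4) (1/4) (1/4)
      = elt3 (of_int (2 * A1) / 4) (of_int (2 * B1) / 4) (of_int (2 * C1) / 4) (of_int 0 / 4)"
    by (simp add: u' ABCD ABC elt3_scale_int elt3_diff add_divide_distrib)
  finally obtain P where "2 * A1 * (2 * A1) + 2 * B1 * (2 * B1) * m - 2 * C1 * (2 * C1) * n - 0 * 0 * k = 8 * P"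
    by (rule relative_norm_parity)
  then have "A1 * A1 + B1 * B1 * m - C1 * C1 * n = 2 * P" by simp
  then have "even (A1 * A1 + B1 * B1 * m - C1 * C1 * n)" by simp
  moreover have "odd m" "odd n" using m1 n1 by presburger+
  ultimately have "even (A1 - B1 - C1)" by simp
  then obtain E where "A1 - B1 - C1 = 2 * E" by (rule evenE)
  then have E: "A1 = 2 * E + B1 + C1" by simp
  (* in terms of the basis, (A1 + B1 alpha + C1 beta) / 2 has the coefficients E, B1, C1, 0 *)
  have "u = of_int E + of_int B1 * elt3 (1/2) (1/2) 0 0 + of_int C1 * elt3 (1/2) 0 (1/2) 0 + of_int D * elt3 (1/4) (1/4) (1/4) (1/4)"
    unfolding of_int_elt3[of E] elt3_scale_int elt3_add u' ABCD ABC E by (simp add: add_divide_distrib)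
  then show "\<exists>c0 c1 c2 c3. u = of_int c0 + of_int c1 * elt3 (1/2) (1/2) 0 0 + of_int c2 * elt3 (1/2) 0 (1/2) 0
      + of_int c3 * elt3 (1/4) (1/4) (1/4) (1/4)" by blast
qed simp_all

lemma beta_integral: "algebraic_int \<beta>"
  by (rule algebraic_int_of_square) (simp only: square, simp)

lemma alpha_integral: "algebraic_int \<alpha>"
  by (rule algebraic_int_of_square) (simp only: square, simp)

lemma half_beta_gamma_square:
  "elt3 0 0 (1/2) (1/2) * elt3 0 0 (1/2) (1/2) = elt3 (of_int (n + k) / 4) (of_int z / 2) 0 0"
  by (simp add: elt3_mult add_divide_distrib)

text \<open>Integers of the field have half-integral coordinates, since \<open>n\<close> and \<open>k\<close> are not \<open>1\<close> modulo \<open>4\<close>, and the parity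
  conditions of \<open>odd_coset_parity\<close> cut out the span of the basis.\<close>

lemma discriminant_one_1:
  assumes m1: "m mod 4 = 1" and nk: "n mod 4 = 2 \<and> k mod 4 = 2 \<and> even z \<or> n mod 4 = 3 \<and> k mod 4 = 3 \<and> odd z"
  shows "field_discriminant K = 16 * (m * n * k)"
proof (rule field_discriminant_triangular[where pa = "1/2" and pb = "1/2" and qa = 0 and qb = 0 and qc = 1
      and ra = 0 and rb = 0 and rc = "1/2" and rd = "1/2"])
  have e1: "elt3 (1/2) (1/2) 0 0 = (1 + \<alpha>) / 2" by (simp add: elt3_def of_rat_divide field_simps)
  show i1: "algebraic_int (elt3 (1/2) (1/2) 0 0)"
    unfolding e1 by (rule algebraic_int_half_one_plus_sqrt[OF square(1) m1])
  have "elt3 0 0 1 0 = \<beta>" by (simp add: elt3_def)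
  then show "algebraic_int (elt3 0 0 1 0)" using beta_integral by simp
  have "4 dvd n + k - 2 * z" using nk by presburger
  then obtain r where "n + k - 2 * z = 4 * r" by (elim dvdE)
  then have r: "n + k = 4 * r + 2 * z" by simp
  have sq: "elt3 0 0 (1/2) (1/2) * elt3 0 0 (1/2) (1/2) = of_int r + of_int z * elt3 (1/2) (1/2) 0 0"
    unfolding half_beta_gamma_square r of_int_elt3[of r] elt3_scale_int elt3_add by (simp add: add_divide_distrib)
  show "algebraic_int (elt3 0 0 (1/2) (1/2))"
    by (rule algebraic_int_of_square, unfold sq) (intro algebraic_int_add algebraic_int_mult algebraic_int_of_int i1)
  show "of_int (16 * (m * n * k)) = 256 * of_int (m * n * k) * ((1/2) * 1 * (1/2) :: rat) ^ 2"
    by (simp add: power2_eq_square)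
  fix u assume u: "u \<in> K" "algebraic_int u"
  obtain a b c d where u': "u = elt3 a b c d" using u(1) by (rule K_cases3)
  have n1: "n mod 4 \<noteq> 1" using nk by auto
  obtain A B C D :: int where ABCD: "a = of_int A / 4" "b = of_int B / 4" "c = of_int C / 4" "d = of_int D / 4"
    and par: "even A \<and> even B \<and> even C \<and> even D"
    using half_trace_parity[of a b c d] u(2) u' n1 by metis
  obtain A1 B1 C1 D1 where A1: "A = 2 * A1" "B = 2 * B1" "C = 2 * C1" "D = 2 * D1"
    using par by (elim conjE evenE) blast
  obtain P Q where PQ: "A * A + B * B * m - C * C * n - D * D * k = 8 * P" "A * B - C * D * z = 4 * Q"
    "even P \<and> even Q \<or> odd P \<and> odd Q \<and> m mod 4 = 1"
    using relative_norm_parity[of A B C D] u(2) u' ABCD by metis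
  have "A1 * A1 + B1 * B1 * m - C1 * C1 * n - D1 * D1 * k = 2 * P" "A1 * B1 - C1 * D1 * z = Q"
    using PQ(1,2) unfolding A1 by (simp_all add: algebra_simps)
  moreover have "even (P - Q)" using PQ(3) by auto
  ultimately have "even (A1 - B1)" "even (C1 - D1)"
    using odd_coset_parity[OF m1 nk] by blast+
  then obtain E F where "A1 - B1 = 2 * E" "C1 - D1 = 2 * F" by (elim evenE) blast
  then have EF: "A1 = 2 * E + B1" "C1 = 2 * F + D1" by simp_all
  have "u = of_int E + of_int B1 * elt3 (1/2) (1/2) 0 0 + of_int F * elt3 0 0 1 0 + of_int D1 * elt3 0 0 (1/2) (1/2)"
    unfolding of_int_elt3[of E] elt3_scale_int elt3_add u' ABCD A1 EF by (simp add: add_divide_distrib)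
  then show "\<exists>c0 c1 c2 c3. u = of_int c0 + of_int c1 * elt3 (1/2) (1/2) 0 0 + of_int c2 * elt3 0 0 1 0
      + of_int c3 * elt3 0 0 (1/2) (1/2)" by blast
qed simp_all

text \<open>The coordinates are half-integral again. As the relative norm lies in \<open>\<int>[\<alpha>]\<close>, those of \<open>1\<close> and \<open>\<alpha>\<close> are
  integers and the other two have numerators of equal parity.\<close>

lemma discriminant_no_1:
  assumes m3: "m mod 4 = 3" and nk: "n mod 4 = 2" "k mod 4 = 2" and z: "even z"
  shows "field_discriminant K = 64 * (m * n * k)"
proof (rule field_discriminant_triangular[where pa = 0 and pb = 1 and qa = 0 and qb = 0 and qc = 1
      and ra = 0 and rb = 0 and rc = "1/2" and rd = "1/2"])
  have e1: "elt3 0 1 0 0 = \<alpha>" "elt3 0 0 1 0 = \<beta>" by (simp_all add: elt3_def)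
  then show i1: "algebraic_int (elt3 0 1 0 0)" "algebraic_int (elt3 0 0 1 0)"
    using alpha_integral beta_integral by simp_all
  have "4 dvd n + k" using nk by presburger
  then obtain r where r: "n + k = 4 * r" by (elim dvdE)
  obtain z' where z': "z = 2 * z'" using z by (rule evenE)
  have sq: "elt3 0 0 (1/2) (1/2) * elt3 0 0 (1/2) (1/2) = of_int r + of_int z' * elt3 0 1 0 0"
    unfolding half_beta_gamma_square r of_int_elt3[of r] elt3_scale_int elt3_add by (simp add: z')
  show "algebraic_int (elt3 0 0 (1/2) (1/2))"
    by (rule algebraic_int_of_square, unfold sq) (intro algebraic_int_add algebraic_int_mult algebraic_int_of_int i1)
  show "of_int (64 * (m * n * k)) = 256 * of_int (m * n * k) * (1 * 1 * (1/2) :: rat) ^ 2"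
    by (simp add: power2_eq_square)
  fix u assume u: "u \<in> K" "algebraic_int u"
  obtain a b c d where u': "u = elt3 a b c d" using u(1) by (rule K_cases3)
  have m1: "m mod 4 \<noteq> 1" using m3 by auto
  obtain A B C D :: int where ABCD: "a = of_int A / 4" "b = of_int B / 4" "c = of_int C / 4" "d = of_int D / 4"
    and par: "even A \<and> even B \<and> even C \<and> even D"
    using half_trace_parity[of a b c d] u(2) u' m1 by metis
  obtain A1 B1 C1 D1 where A1: "A = 2 * A1" "B = 2 * B1" "C = 2 * C1" "D = 2 * D1"
    using par by (elim conjE evenE) blast
  obtain P Q where PQ: "A * A + B * B * m - C * C * n - D * D * k = 8 * P" "A * B - C * D * z = 4 * Q"
    "even P" "even Q"
    using relative_norm_parity[of A B C D] u(2) u' ABCD m1 by metis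
  have eqs: "A1 * A1 + B1 * B1 * m - C1 * C1 * n - D1 * D1 * k = 2 * P" "A1 * B1 - C1 * D1 * z = Q"
    using PQ(1,2) unfolding A1 by (simp_all add: algebra_simps)
  have "odd m" "even n" using m3 nk by presburger+
  moreover have "even k" using z by simp
  moreover have "even (A1 * A1 + B1 * B1 * m - C1 * C1 * n - D1 * D1 * k)" "even (A1 * B1 - C1 * D1 * z)"
    using eqs PQ(4) by simp_all
  ultimately have "even A1" "even B1" using z by auto
  then obtain A2 B2 where A2: "A1 = 2 * A2" "B1 = 2 * B2" by (elim evenE)
  obtain P' where P': "P = 2 * P'" using PQ(3) by (rule evenE)
  obtain n' k' where nk': "n = 4 * n' + 2" "k = 4 * k' + 2"
    using nk by (metis mod_mult_div_eq add.commute)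
  have "4 * (A2 * A2 + B2 * B2 * m) - C1 * C1 * (4 * n' + 2) - D1 * D1 * (4 * k' + 2) = 4 * P'"
    using eqs(1) unfolding A2 P' nk'(1)[symmetric] nk'(2)[symmetric] by (simp add: algebra_simps)
  then have "2 * (C1 * C1 + D1 * D1) = 4 * (A2 * A2 + B2 * B2 * m - C1 * C1 * n' - D1 * D1 * k' - P')"
    by (simp add: algebra_simps)
  then have "C1 * C1 + D1 * D1 = 2 * (A2 * A2 + B2 * B2 * m - C1 * C1 * n' - D1 * D1 * k' - P')" by simp
  then have "even (C1 * C1 + D1 * D1)" by simp
  then have "even (C1 - D1)" by simp
  then obtain F where "C1 - D1 = 2 * F" by (rule evenE)
  then have F: "C1 = 2 * F + D1" by simp
  have "u = of_int A2 + of_int B2 * elt3 0 1 0 0 + of_int F * elt3 0 0 1 0 + of_int D1 * elt3 0 0 (1/2) (1/2)"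
    unfolding of_int_elt3[of A2] elt3_scale_int elt3_add u' ABCD A1 A2 F by (simp add: add_divide_distrib)
  then show "\<exists>c0 c1 c2 c3. u = of_int c0 + of_int c1 * elt3 0 1 0 0 + of_int c2 * elt3 0 0 1 0
      + of_int c3 * elt3 0 0 (1/2) (1/2)" by blast
qed simp_all

end

section \<open>The discriminant of a biquadratic field\<close>

lemma qspan_commute: "qspan \<alpha> \<beta> = qspan \<beta> \<alpha>"
proof -
  have "qspan \<alpha> \<beta> \<subseteq> qspan \<beta> \<alpha>" for \<alpha> \<beta>
  proof
    fix w assume "w \<in> qspan \<alpha> \<beta>"
    then obtain a b c d where "w = of_rat a + of_rat b * \<alpha> + of_rat c * \<beta> + of_rat d * (\<alpha> * \<beta>)"
      by (auto simp: qspan_def)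
    then have "w = of_rat a + of_rat c * \<beta> + of_rat b * \<alpha> + of_rat d * (\<beta> * \<alpha>)" by (simp add: mult.commute)
    then show "w \<in> qspan \<beta> \<alpha>" unfolding qspan_def by blast
  qed
  then show ?thesis by blast
qed

lemma qspan_minus: "qspan (- \<alpha>) \<beta> = qspan \<alpha> \<beta>"
proof -
  have "qspan (- \<alpha>) \<beta> \<subseteq> qspan \<alpha> \<beta>" for \<alpha> \<beta>
  proof
    fix w assume "w \<in> qspan (- \<alpha>) \<beta>"
    then obtain a b c d where "w = of_rat a + of_rat b * (- \<alpha>) + of_rat c * \<beta> + of_rat d * ((- \<alpha>) * \<beta>)"
      unfolding qspan_def by blast
    then have "w = of_rat a + of_rat (- b) * \<alpha> + of_rat c * \<beta> + of_rat (- d) * (\<alpha> * \<beta>)" by (simp add: of_rat_minus)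
    then show "w \<in> qspan \<alpha> \<beta>" unfolding qspan_def by blast
  qed
  from this[of \<alpha> \<beta>] this[of "- \<alpha>" \<beta>] show ?thesis by auto
qed

text \<open>Two square roots of the same number differ by a sign, which the rational coefficients absorb.\<close>

lemma qspan_sign:
  assumes "\<alpha> * \<alpha> = \<alpha>' * \<alpha>'" "\<beta> * \<beta> = \<beta>' * \<beta>'"
  shows "qspan \<alpha> \<beta> = qspan \<alpha>' \<beta>'"
proof -
  have 1: "qspan \<alpha> \<delta> = qspan \<alpha>' \<delta>" if "\<alpha> * \<alpha> = \<alpha>' * \<alpha>'" for \<alpha> \<alpha>' \<delta>
    using that qspan_minus by (auto simp: square_eq_iff)
  have "qspan \<alpha> \<beta> = qspan \<beta> \<alpha>'" using 1[OF assms(1)] qspan_commute by metis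
  also have "\<dots> = qspan \<beta>' \<alpha>'" by (rule 1[OF assms(2)])
  finally show ?thesis using qspan_commute by metis
qed

context sqrt_triple
begin

lemma swap_12: "sqrt_triple n m \<beta> \<alpha> x z y \<gamma>"
  by unfold_locales (use sqfree ne square m_eq n_eq sqfree_k alpha_beta in \<open>auto simp: mult.commute\<close>)

lemma swap_23: "sqrt_triple m k \<alpha> \<gamma> y x z \<beta>"
proof unfold_locales
  show "\<gamma> * \<gamma> = of_int k" by (rule gamma_square)
  show "squarefree (x * z)" using sqfree n_eq by simp
  show "m = y * x" by (simp add: m_eq)
  show "m \<noteq> k" using k_ne by metis
qed (use sqfree ne square sqfree_k k_ne alpha_gamma in \<open>simp_all\<close>)

lemma negate: "sqrt_triple m n \<alpha> \<beta> (- x) (- y) (- z) (- \<gamma>)"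
  by unfold_locales (use sqfree ne square m_eq n_eq sqfree_k alpha_beta in auto)

lemma qspan_alpha_gamma_subset: "qspan \<alpha> \<gamma> \<subseteq> K"
proof
  fix w assume "w \<in> qspan \<alpha> \<gamma>"
  then obtain a b c d where "w = of_rat a + of_rat b * \<alpha> + of_rat c * \<gamma> + of_rat d * (\<alpha> * \<gamma>)"
    unfolding qspan_def by blast
  then have "w = elt3 a b (d * of_int y) c" unfolding alpha_gamma by (simp add: elt3_def of_rat_mult)
  then show "w \<in> K" by simp
qed

lemma qspan_alpha_gamma: "qspan \<alpha> \<gamma> = K"
  using qspan_alpha_gamma_subset sqrt_triple.qspan_alpha_gamma_subset[OF swap_23] by blast

lemma qspan_beta_gamma: "qspan \<beta> \<gamma> = K"
  using sqrt_triple.qspan_alpha_gamma[OF swap_12] qspan_commute[of \<alpha> \<beta>] by simp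

end

text \<open>The patterns for which an integral basis has been given, with the distinguished radicand in first position.\<close>

definition residue_pattern :: "int \<Rightarrow> int \<Rightarrow> int \<Rightarrow> bool" where
  "residue_pattern a b c \<longleftrightarrow> a mod 4 = 1 \<and> b mod 4 = 1 \<and> c mod 4 = 1
     \<or> a mod 4 = 1 \<and> b mod 4 = 2 \<and> c mod 4 = 2 \<or> a mod 4 = 1 \<and> b mod 4 = 3 \<and> c mod 4 = 3
     \<or> a mod 4 = 3 \<and> b mod 4 = 2 \<and> c mod 4 = 2"

text \<open>No product of two of \<open>x, y, z\<close> is divisible by \<open>4\<close>, so at most one of them is even, and the finitely many
  possible residues can be inspected.\<close>

lemma (in sqrt_triple) residue_pattern_cases:
  "residue_pattern m n k \<or> residue_pattern n m k \<or> residue_pattern k m n"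
proof -
  have nz: "m mod 4 \<noteq> 0" "n mod 4 \<noteq> 0" "k mod 4 \<noteq> 0"
    using four_not_dvd_squarefree[OF sqfree(1)] four_not_dvd_squarefree[OF sqfree(2)]
      four_not_dvd_squarefree[OF sqfree_k] by blast+
  have p: "m mod 4 = ((x mod 4) * (y mod 4)) mod 4" "n mod 4 = ((x mod 4) * (z mod 4)) mod 4"
    "k mod 4 = ((y mod 4) * (z mod 4)) mod 4"
    unfolding m_eq n_eq by (simp_all only: mod_mult_eq)
  have r: "a mod 4 = 0 \<or> a mod 4 = 1 \<or> a mod 4 = 2 \<or> a mod 4 = 3" for a :: int by presburger
  show ?thesis
    using r[of x] r[of y] r[of z] nz unfolding residue_pattern_def p by (elim disjE) simp_all
qed

text \<open>If \<open>m \<equiv> n \<equiv> 1 (mod 4)\<close>, then \<open>x, y, z\<close> agree modulo \<open>4\<close>; when they are \<open>3\<close>, changing the sign of all three and of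
  \<open>\<gamma>\<close> reduces to the case where they are \<open>1\<close>.\<close>

lemma (in sqrt_triple) discriminant_of_pattern:
  assumes "residue_pattern m n k"
  shows "field_discriminant K = disc_factor m * disc_factor n * disc_factor k"
  using assms unfolding residue_pattern_def
proof (elim disjE conjE)
  assume mod: "m mod 4 = 1" "n mod 4 = 1" "k mod 4 = 1"
  have p: "((x mod 4) * (y mod 4)) mod 4 = 1" "((x mod 4) * (z mod 4)) mod 4 = 1"
    using mod unfolding m_eq n_eq by (simp_all only: mod_mult_eq)
  have r: "a mod 4 = 0 \<or> a mod 4 = 1 \<or> a mod 4 = 2 \<or> a mod 4 = 3" for a :: int by presburger
  have "x mod 4 = 1 \<and> y mod 4 = 1 \<and> z mod 4 = 1 \<or> x mod 4 = 3 \<and> y mod 4 = 3 \<and> z mod 4 = 3"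
    using r[of x] r[of y] r[of z] p by (elim disjE) simp_all
  then have "field_discriminant K = m * n * k"
  proof
    assume "x mod 4 = 1 \<and> y mod 4 = 1 \<and> z mod 4 = 1"
    then show ?thesis using discriminant_all_1 by simp
  next
    assume "x mod 4 = 3 \<and> y mod 4 = 3 \<and> z mod 4 = 3"
    then have "(- x) mod 4 = 1 \<and> (- y) mod 4 = 1 \<and> (- z) mod 4 = 1" by presburger
    then show ?thesis using sqrt_triple.discriminant_all_1[OF negate] by simp
  qed
  then show ?thesis using mod by (simp add: disc_factor_def)
next
  assume mod: "m mod 4 = 1" "n mod 4 = 2" "k mod 4 = 2"
  have "odd m" "even n" using mod by presburger+
  then have "even z" by (auto simp: m_eq n_eq)
  then show ?thesis using discriminant_one_1 mod by (simp add: disc_factor_def)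
next
  assume mod: "m mod 4 = 1" "n mod 4 = 3" "k mod 4 = 3"
  have "odd n" using mod by presburger
  then have "odd z" by (simp add: n_eq)
  then show ?thesis using discriminant_one_1 mod by (simp add: disc_factor_def)
next
  assume mod: "m mod 4 = 3" "n mod 4 = 2" "k mod 4 = 2"
  have "odd m" "even n" using mod by presburger+
  then have "even z" by (auto simp: m_eq n_eq)
  then show ?thesis using discriminant_no_1 mod by (simp add: disc_factor_def)
qed

lemma (in sqrt_triple) discriminant_formula:
  "field_discriminant K = disc_factor m * disc_factor n * disc_factor k"
  using residue_pattern_cases
proof (elim disjE)
  assume "residue_pattern m n k"
  then show ?thesis by (rule discriminant_of_pattern)
next
  assume a: "residue_pattern n m k"
  have "field_discriminant (qspan \<beta> \<alpha>) = disc_factor n * disc_factor m * disc_factor (z * y)"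
    using sqrt_triple.discriminant_of_pattern[OF swap_12] a
    by (simp add: mult.commute)
  then show ?thesis by (simp add: qspan_commute[of \<beta> \<alpha>] mult_ac)
next
  assume a: "residue_pattern k m n"
  note s = sqrt_triple.swap_12[OF swap_23]
  have "field_discriminant (qspan \<gamma> \<alpha>) = disc_factor k * disc_factor m * disc_factor (z * x)"
    using sqrt_triple.discriminant_of_pattern[OF s] a n_eq
    by (simp add: mult.commute)
  moreover have "z * x = n" by (simp add: n_eq)
  ultimately show ?thesis by (simp add: qspan_commute[of \<gamma> \<alpha>] qspan_alpha_gamma mult_ac)
qed

definition biquad_field :: "int \<Rightarrow> int \<Rightarrow> complex set" where
  "biquad_field m n = qspan (csqrt (of_int m)) (csqrt (of_int n))"

definition radicand_pairs :: "(int \<times> int) set" where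
  "radicand_pairs = {(m, n). squarefree m \<and> squarefree n \<and> m \<noteq> 1 \<and> n \<noteq> 1 \<and> m \<noteq> n}"

definition third_radicand :: "int \<Rightarrow> int \<Rightarrow> int" where
  "third_radicand m n = (m div gcd m n) * (n div gcd m n)"

lemma csqrt_square: "csqrt w * csqrt w = w"
  using power2_csqrt[of w] by (simp add: power2_eq_square)

lemma sqrt_triple_csqrt:
  assumes "(m, n) \<in> radicand_pairs"
  shows "sqrt_triple m n (csqrt (of_int m)) (csqrt (of_int n)) (gcd m n) (m div gcd m n) (n div gcd m n)
    (csqrt (of_int m) * csqrt (of_int n) / of_int (gcd m n))"
proof unfold_locales
  have sq: "squarefree m" "squarefree n" using assms by (auto simp: radicand_pairs_def)
  then have "m \<noteq> 0" by auto
  then have g: "gcd m n \<noteq> 0" by simp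
  show "squarefree (m div gcd m n * (n div gcd m n))"
  proof (rule squarefree_mult_coprime)
    show "coprime (m div gcd m n) (n div gcd m n)" using \<open>m \<noteq> 0\<close> by (intro div_gcd_coprime) auto
    show "squarefree (m div gcd m n)" using sq(1) by (rule squarefree_mono[rotated]) (metis dvd_div_mult_self dvd_triv_left gcd_dvd1)
    show "squarefree (n div gcd m n)" using sq(2) by (rule squarefree_mono[rotated]) (metis dvd_div_mult_self dvd_triv_left gcd_dvd2)
  qed
  show "csqrt (of_int m) * csqrt (of_int n) = of_int (gcd m n) * (csqrt (of_int m) * csqrt (of_int n) / of_int (gcd m n))"
    using g by simp
qed (use assms in \<open>auto simp: radicand_pairs_def csqrt_square\<close>)

lemma third_radicand_ne:
  assumes "(m, n) \<in> radicand_pairs"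
  shows "third_radicand m n \<noteq> 1" "third_radicand m n \<noteq> m" "third_radicand m n \<noteq> n" "squarefree (third_radicand m n)"
  using sqrt_triple.k_ne[OF sqrt_triple_csqrt[OF assms]] sqrt_triple.sqfree_k[OF sqrt_triple_csqrt[OF assms]]
  by (simp_all add: third_radicand_def)

lemma biquad_field_discriminant:
  assumes "(m, n) \<in> radicand_pairs"
  shows "field_discriminant (biquad_field m n) = disc_factor m * disc_factor n * disc_factor (third_radicand m n)"
  unfolding biquad_field_def third_radicand_def
  by (rule sqrt_triple.discriminant_formula[OF sqrt_triple_csqrt[OF assms]])

lemma biquadratic_biquad_field:
  assumes "(m, n) \<in> radicand_pairs" shows "biquadratic (biquad_field m n)"
proof -
  interpret sqrt_triple m n "csqrt (of_int m)" "csqrt (of_int n)" "gcd m n" "m div gcd m n" "n div gcd m n"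
    "csqrt (of_int m) * csqrt (of_int n) / of_int (gcd m n)" by (rule sqrt_triple_csqrt[OF assms])
  show ?thesis unfolding biquad_field_def by (rule biquadratic_K)
qed

text \<open>The square roots of squarefree integers in the field determine the possible radicands, and any two of the
  three nontrivial ones generate it.\<close>

lemma biquad_field_eq_iff:
  assumes p: "(m, n) \<in> radicand_pairs" and p': "(m', n') \<in> radicand_pairs"
  shows "biquad_field m' n' = biquad_field m n \<longleftrightarrow>
    m' \<in> {m, n, third_radicand m n} \<and> n' \<in> {m, n, third_radicand m n}"
proof -
  define k where "k = third_radicand m n"
  interpret T: sqrt_triple m n "csqrt (of_int m)" "csqrt (of_int n)" "gcd m n" "m div gcd m n" "n div gcd m n"
    "csqrt (of_int m) * csqrt (of_int n) / of_int (gcd m n)" by (rule sqrt_triple_csqrt[OF p])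
  interpret T': sqrt_triple m' n' "csqrt (of_int m')" "csqrt (of_int n')" "gcd m' n'" "m' div gcd m' n'" "n' div gcd m' n'"
    "csqrt (of_int m') * csqrt (of_int n') / of_int (gcd m' n')" by (rule sqrt_triple_csqrt[OF p'])
  let ?\<gamma> = "csqrt (of_int m) * csqrt (of_int n) / of_int (gcd m n)"
  show ?thesis
  proof
    assume eq: "biquad_field m' n' = biquad_field m n"
    have mem: "csqrt (of_int m') \<in> biquad_field m n" "csqrt (of_int n') \<in> biquad_field m n"
      unfolding eq[symmetric] unfolding biquad_field_def by (rule T'.generators_in_K)+
    have "m' \<in> {1, m, n, k}" "n' \<in> {1, m, n, k}"
      using T.sqrt_in_K[OF mem(1)[unfolded biquad_field_def] csqrt_square T'.sqfree(1)]
        T.sqrt_in_K[OF mem(2)[unfolded biquad_field_def] csqrt_square T'.sqfree(2)]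
      by (simp_all add: k_def third_radicand_def)
    then show "m' \<in> {m, n, third_radicand m n} \<and> n' \<in> {m, n, third_radicand m n}"
      using T'.ne by (auto simp: k_def)
  next
    assume mem: "m' \<in> {m, n, third_radicand m n} \<and> n' \<in> {m, n, third_radicand m n}"
    have gam: "csqrt (of_int k) * csqrt (of_int k) = ?\<gamma> * ?\<gamma>"
      unfolding csqrt_square T.gamma_square k_def third_radicand_def ..
    have mn: "biquad_field n m = biquad_field m n" unfolding biquad_field_def by (rule qspan_commute)
    have mk: "biquad_field m k = biquad_field m n"
      unfolding biquad_field_def T.qspan_alpha_gamma[symmetric] by (rule qspan_sign[OF refl gam])
    have nk: "biquad_field n k = biquad_field m n"
      unfolding biquad_field_def T.qspan_beta_gamma[symmetric] by (rule qspan_sign[OF refl gam])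
    have km: "biquad_field k m = biquad_field m n" "biquad_field k n = biquad_field m n"
      using mk nk unfolding biquad_field_def by (simp_all only: qspan_commute)
    show "biquad_field m' n' = biquad_field m n"
      using mem T'.ne mn mk nk km unfolding k_def[symmetric] by auto
  qed
qed

section \<open>Every biquadratic field is generated by two square roots\<close>

lemma rational_square_class:
  fixes q :: rat
  assumes "q \<noteq> 0"
  obtains j :: int and r :: rat where "squarefree j" "r \<noteq> 0" "q = of_int j * r ^ 2"
proof -
  obtain a b where q: "q = of_int a / of_int b" "b > 0"
    using quotient_of_div[of q] quotient_of_denom_pos[of q] by (metis surj_pair)
  have ab: "a * b \<noteq> 0" using q assms by auto
  define s where "s = square_part (a * b)"
  define j where "j = squarefree_part (a * b)"
  have dec: "a * b = j * s ^ 2" unfolding j_def s_def by (rule squarefree_decompose)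
  have s: "s \<noteq> 0" using dec ab by auto
  have "q = of_int (a * b) / of_int b ^ 2" using q by (simp add: power2_eq_square)
  also have "\<dots> = of_int j * (of_int s / of_int b) ^ 2" unfolding dec by (simp add: power_divide)
  finally show thesis
    using that[of j "of_int s / of_int b"] s q unfolding j_def by simp
qed

text \<open>The situation provided by a Galois group isomorphic to the Klein four-group, with \<open>\<sigma>\<close>, \<open>\<tau>\<close> and \<open>\<sigma> \<tau>\<close> its three
  nontrivial elements.\<close>

locale klein_action =
  fixes K :: "complex set" and \<sigma> \<tau> :: "complex \<Rightarrow> complex"
  assumes K: "subfield K complex_ring"
    and \<sigma>K: "\<And>x. x \<in> K \<Longrightarrow> \<sigma> x \<in> K" and \<tau>K: "\<And>x. x \<in> K \<Longrightarrow> \<tau> x \<in> K"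
    and \<sigma>_add: "\<And>x y. x \<in> K \<Longrightarrow> y \<in> K \<Longrightarrow> \<sigma> (x + y) = \<sigma> x + \<sigma> y"
    and \<tau>_add: "\<And>x y. x \<in> K \<Longrightarrow> y \<in> K \<Longrightarrow> \<tau> (x + y) = \<tau> x + \<tau> y"
    and \<sigma>_mult: "\<And>x y. x \<in> K \<Longrightarrow> y \<in> K \<Longrightarrow> \<sigma> (x * y) = \<sigma> x * \<sigma> y"
    and \<tau>_mult: "\<And>x y. x \<in> K \<Longrightarrow> y \<in> K \<Longrightarrow> \<tau> (x * y) = \<tau> x * \<tau> y"
    and rat_fixed: "\<And>q. \<sigma> (of_rat q) = of_rat q" "\<And>q. \<tau> (of_rat q) = of_rat q"
    and invol: "\<And>x. x \<in> K \<Longrightarrow> \<sigma> (\<sigma> x) = x" "\<And>x. x \<in> K \<Longrightarrow> \<tau> (\<tau> x) = x"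
    and comm: "\<And>x. x \<in> K \<Longrightarrow> \<sigma> (\<tau> x) = \<tau> (\<sigma> x)"
    and fixed: "\<And>x. x \<in> K \<Longrightarrow> \<sigma> x = x \<Longrightarrow> \<tau> x = x \<Longrightarrow> x \<in> \<rat>"
    and nontrivial: "\<exists>x\<in>K. \<sigma> x \<noteq> x" "\<exists>x\<in>K. \<tau> x \<noteq> x" "\<exists>x\<in>K. \<sigma> (\<tau> x) \<noteq> x"
begin

lemmas KD = subfield_complexD[OF K]

definition eigen :: "complex \<Rightarrow> complex \<Rightarrow> complex \<Rightarrow> bool" where
  "eigen s t x \<longleftrightarrow> x \<in> K \<and> \<sigma> x = s * x \<and> \<tau> x = t * x"

lemma \<sigma>_minus: "x \<in> K \<Longrightarrow> \<sigma> (- x) = - \<sigma> x" and \<tau>_minus: "x \<in> K \<Longrightarrow> \<tau> (- x) = - \<tau> x"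
  using \<sigma>_mult[OF KD(9)[of "-1"], of x] \<tau>_mult[OF KD(9)[of "-1"], of x] rat_fixed[of "-1"] by simp_all

lemma \<sigma>_diff: "x \<in> K \<Longrightarrow> y \<in> K \<Longrightarrow> \<sigma> (x - y) = \<sigma> x - \<sigma> y"
  and \<tau>_diff: "x \<in> K \<Longrightarrow> y \<in> K \<Longrightarrow> \<tau> (x - y) = \<tau> x - \<tau> y"
  using \<sigma>_add[of x "- y"] \<tau>_add[of x "- y"] \<sigma>_minus[of y] \<tau>_minus[of y] KD(3)[of y] by simp_all

lemma eigen_mult: "eigen s t x \<Longrightarrow> eigen s' t' y \<Longrightarrow> eigen (s * s') (t * t') (x * y)"
  by (auto simp: eigen_def \<sigma>_mult \<tau>_mult KD)

lemma eigen_of_rat: "eigen 1 1 (of_rat q)" by (simp add: eigen_def KD rat_fixed)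

lemma eigen_1_1: "eigen 1 1 x \<Longrightarrow> x \<in> \<rat>" using fixed by (auto simp: eigen_def)

lemma eigen_inverse:
  assumes "eigen s t x" "s = 1 \<or> s = -1" "t = 1 \<or> t = -1" "x \<noteq> 0"
  shows "eigen s t (inverse x)"
proof -
  have x: "x \<in> K" "inverse x \<in> K" using assms KD by (auto simp: eigen_def)
  have "\<sigma> x * \<sigma> (inverse x) = 1" "\<tau> x * \<tau> (inverse x) = 1"
    using \<sigma>_mult[OF x] \<tau>_mult[OF x] rat_fixed[of 1] assms by simp_all
  then have "s * x * \<sigma> (inverse x) = 1" "t * x * \<tau> (inverse x) = 1" using assms by (simp_all add: eigen_def)
  moreover have "v = r * inverse x" if "r * x * v = 1" "r = 1 \<or> r = -1" for r v
  proof -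
    have "r * r = 1" using that(2) by auto
    then have "x * v = r" using arg_cong[OF that(1), of "\<lambda>w. r * w"] by (simp flip: mult.assoc)
    then show ?thesis using assms(4) by (simp add: field_simps)
  qed
  ultimately show ?thesis using assms x unfolding eigen_def by blast
qed

text \<open>For each of the three nontrivial automorphisms some element \<open>u \<noteq> 0\<close> is mapped to \<open>-u\<close>, and \<open>u\<close> is the
  sum of two eigenvectors, up to a factor \<open>2\<close>. So among the three nontrivial characters at least one of any two
  occurs. Hence two of them occur, and with them their product, the third.\<close>

lemma nonzero_eigenvectors:
  obtains \<alpha> \<beta> where "eigen (-1) 1 \<alpha>" "eigen 1 (-1) \<beta>" "\<alpha> \<noteq> 0" "\<beta> \<noteq> 0"
proof -
  define E where "E s t \<longleftrightarrow> (\<exists>x. eigen s t x \<and> x \<noteq> 0)" for s t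
  have EI: "E s t \<or> E s' t'" if "eigen s t a" "eigen s' t' b" "a + b \<noteq> 0" for s t s' t' a b
    using that unfolding E_def by (cases "a = 0") auto
  have 1: "E (-1) 1 \<or> E (-1) (-1)"
  proof -
    obtain x where x: "x \<in> K" "\<sigma> x \<noteq> x" using nontrivial by blast
    define u where "u = x - \<sigma> x"
    have u: "u \<in> K" "u \<noteq> 0" "\<sigma> u = - u" using x by (auto simp: u_def KD \<sigma>K \<sigma>_diff invol)
    have \<sigma>\<tau>: "\<sigma> (\<tau> u) = - \<tau> u" using u by (simp add: comm \<tau>_minus)
    show ?thesis
      by (rule EI[of _ _ "u + \<tau> u" _ _ "u - \<tau> u"])
        (use u \<sigma>\<tau> in \<open>auto simp: eigen_def KD \<tau>K \<sigma>_add \<tau>_add \<sigma>_diff \<tau>_diff invol\<close>)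
  qed
  have 2: "E 1 (-1) \<or> E (-1) (-1)"
  proof -
    obtain x where x: "x \<in> K" "\<tau> x \<noteq> x" using nontrivial by blast
    define u where "u = x - \<tau> x"
    have u: "u \<in> K" "u \<noteq> 0" "\<tau> u = - u" using x by (auto simp: u_def KD \<tau>K \<tau>_diff invol)
    have \<sigma>\<tau>: "\<tau> (\<sigma> u) = - \<sigma> u" using u comm[of u] by (simp add: \<sigma>_minus)
    show ?thesis
      by (rule EI[of _ _ "u + \<sigma> u" _ _ "u - \<sigma> u"])
        (use u \<sigma>\<tau> in \<open>auto simp: eigen_def KD \<sigma>K \<sigma>_add \<tau>_add \<sigma>_diff \<tau>_diff invol\<close>)
  qed
  have 3: "E 1 (-1) \<or> E (-1) 1"
  proof -
    obtain x where x: "x \<in> K" "\<sigma> (\<tau> x) \<noteq> x" using nontrivial by blast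
    define u where "u = x - \<sigma> (\<tau> x)"
    have u: "u \<in> K" "u \<noteq> 0" using x by (auto simp: u_def KD \<sigma>K \<tau>K)
    have "\<sigma> (\<tau> u) = - u"
      using x by (simp add: u_def KD \<sigma>K \<tau>K \<tau>_diff \<sigma>_diff invol comm)
    then have t: "\<tau> u = - \<sigma> u" "\<tau> (\<sigma> u) = - u"
      using u invol(1)[OF \<tau>K[OF u(1)]] \<sigma>_minus[OF u(1)] comm[OF u(1)] by simp_all
    show ?thesis
      by (rule EI[of _ _ "u + \<sigma> u" _ _ "u - \<sigma> u"])
        (use u t in \<open>auto simp: eigen_def KD \<sigma>K \<sigma>_add \<tau>_add \<sigma>_diff \<tau>_diff invol\<close>)
  qed
  have mult: "E (s * s') (t * t')" if "E s t" "E s' t'" for s t s' t'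
    using that eigen_mult unfolding E_def by (metis mult_eq_0_iff)
  have "E (-1) 1 \<and> E 1 (-1)"
    using 1 2 3 mult[of "-1" 1 "-1" "-1"] mult[of 1 "-1" "-1" "-1"] by auto
  then show thesis using that unfolding E_def by blast
qed

text \<open>The square of an eigenvector is fixed by the group, hence rational, and scaling by a rational number makes it a
  squarefree integer.\<close>

lemma squarefree_eigenvector:
  assumes "eigen s t x" "x \<noteq> 0" "s = 1 \<or> s = -1" "t = 1 \<or> t = -1"
  obtains \<alpha> j where "eigen s t \<alpha>" "\<alpha> \<noteq> 0" "squarefree j" "\<alpha> * \<alpha> = of_int j"
proof -
  have "s * s = 1" "t * t = 1" using assms(3,4) by auto
  then have "eigen 1 1 (x * x)" using eigen_mult[OF assms(1,1)] by simp
  then obtain q where q: "x * x = of_rat q" using eigen_1_1 by (auto simp: Rats_def)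
  then have "q \<noteq> 0" using assms(2) by auto
  then obtain j r where j: "squarefree j" "r \<noteq> 0" "q = of_int j * r ^ 2"
    by (rule rational_square_class)
  have "x * of_rat (inverse r) * (x * of_rat (inverse r)) = of_rat (q * (inverse r * inverse r))"
    using q by (simp add: of_rat_mult mult_ac)
  also have "q * (inverse r * inverse r) = of_int j" using j by (simp add: power2_eq_square field_simps)
  finally show thesis
    using that[of "x * of_rat (inverse r)" j] eigen_mult[OF assms(1) eigen_of_rat[of "inverse r"]] assms(2) j
    by simp
qed

lemma eigen_multiple:
  assumes "eigen s t \<alpha>" "\<alpha> \<noteq> 0" "s = 1 \<or> s = -1" "t = 1 \<or> t = -1" "eigen s t x"
  obtains q where "x = of_rat q * \<alpha>"
proof -
  have "s * s = 1" "t * t = 1" using assms(3,4) by auto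
  then have "eigen 1 1 (x * inverse \<alpha>)"
    using eigen_mult[OF assms(5) eigen_inverse[OF assms(1,3,4,2)]] by simp
  then obtain q where "x * inverse \<alpha> = of_rat q" using eigen_1_1 by (auto simp: Rats_def)
  then have "x = of_rat q * \<alpha>" using assms(2) by (simp add: field_simps)
  then show thesis by (rule that)
qed

text \<open>Each element is the sum of its four isotypic components, and each component is a rational multiple of \<open>1\<close>,
  \<open>\<alpha>\<close>, \<open>\<beta>\<close> or \<open>\<alpha> \<beta>\<close> since quotients of eigenvectors for the same character are fixed.\<close>

lemma K_biquad_field: "\<exists>m n. (m, n) \<in> radicand_pairs \<and> K = biquad_field m n"
proof -
  obtain x y where "eigen (-1) 1 x" "eigen 1 (-1) y" "x \<noteq> 0" "y \<noteq> 0" by (rule nonzero_eigenvectors)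
  obtain \<alpha> m where a: "eigen (-1) 1 \<alpha>" "\<alpha> \<noteq> 0" "squarefree m" "\<alpha> * \<alpha> = of_int m"
    by (rule squarefree_eigenvector[OF \<open>eigen (-1) 1 x\<close> \<open>x \<noteq> 0\<close>]) auto
  obtain \<beta> n where b: "eigen 1 (-1) \<beta>" "\<beta> \<noteq> 0" "squarefree n" "\<beta> * \<beta> = of_int n"
    by (rule squarefree_eigenvector[OF \<open>eigen 1 (-1) y\<close> \<open>y \<noteq> 0\<close>]) auto
  have ab: "eigen (-1) (-1) (\<alpha> * \<beta>)" "\<alpha> * \<beta> \<noteq> 0" using eigen_mult[OF a(1) b(1)] a b by simp_all
  have one: "\<sigma> 1 = 1" "\<tau> 1 = 1" using rat_fixed[of 1] by simp_all
  have m1: "m \<noteq> 1"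
  proof
    assume "m = 1"
    then have "\<alpha> = 1 \<or> \<alpha> = - 1" using a by (simp add: square_eq_1_iff)
    then show False using a(1) one KD(1) by (auto simp: eigen_def \<sigma>_minus)
  qed
  have n1: "n \<noteq> 1"
  proof
    assume "n = 1"
    then have "\<beta> = 1 \<or> \<beta> = - 1" using b by (simp add: square_eq_1_iff)
    then show False using b(1) one KD(1) by (auto simp: eigen_def \<tau>_minus)
  qed
  have mn: "m \<noteq> n"
  proof
    assume "m = n"
    then have "\<alpha> = \<beta> \<or> \<alpha> = - \<beta>" using a(4) b(4) by (metis square_eq_iff)
    then show False using a b by (auto simp: eigen_def \<sigma>_minus)
  qed
  have "K = qspan \<alpha> \<beta>"
  proof (intro equalityI subsetI)
    fix w assume w: "w \<in> K"
    define \<rho>w where "\<rho>w = \<sigma> (\<tau> w)"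
    have inK: "\<sigma> w \<in> K" "\<tau> w \<in> K" "\<rho>w \<in> K" using w by (auto simp: \<rho>w_def \<sigma>K \<tau>K)
    have act: "\<sigma> (\<sigma> w) = w" "\<sigma> (\<tau> w) = \<rho>w" "\<sigma> \<rho>w = \<tau> w" "\<tau> (\<sigma> w) = \<rho>w" "\<tau> (\<tau> w) = w" "\<tau> \<rho>w = \<sigma> w"
      using w inK by (auto simp: \<rho>w_def invol comm \<tau>K \<sigma>K)
    have e: "eigen 1 1 ((w + \<sigma> w) + (\<tau> w + \<rho>w))" "eigen (-1) 1 ((w - \<sigma> w) + (\<tau> w - \<rho>w))"
      "eigen 1 (-1) ((w + \<sigma> w) - (\<tau> w + \<rho>w))" "eigen (-1) (-1) ((w - \<sigma> w) - (\<tau> w - \<rho>w))"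
      unfolding eigen_def using w inK
      by (auto simp: KD \<sigma>_add \<tau>_add \<sigma>_diff \<tau>_diff act)
    obtain q0 where q0: "(w + \<sigma> w) + (\<tau> w + \<rho>w) = of_rat q0" using eigen_1_1[OF e(1)] by (auto simp: Rats_def)
    obtain q1 where q1: "(w - \<sigma> w) + (\<tau> w - \<rho>w) = of_rat q1 * \<alpha>"
      by (rule eigen_multiple[OF a(1,2) _ _ e(2)]) auto
    obtain q2 where q2: "(w + \<sigma> w) - (\<tau> w + \<rho>w) = of_rat q2 * \<beta>"
      by (rule eigen_multiple[OF b(1,2) _ _ e(3)]) auto
    obtain q3 where q3: "(w - \<sigma> w) - (\<tau> w - \<rho>w) = of_rat q3 * (\<alpha> * \<beta>)"
      by (rule eigen_multiple[OF ab _ _ e(4)]) auto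
    have "4 * w = ((w + \<sigma> w) + (\<tau> w + \<rho>w)) + ((w - \<sigma> w) + (\<tau> w - \<rho>w))
        + ((w + \<sigma> w) - (\<tau> w + \<rho>w)) + ((w - \<sigma> w) - (\<tau> w - \<rho>w))" by simp
    also have "\<dots> = of_rat q0 + of_rat q1 * \<alpha> + of_rat q2 * \<beta> + of_rat q3 * (\<alpha> * \<beta>)"
      unfolding q0 q1 q2 q3 ..
    finally have "w = of_rat (q0 / 4) + of_rat (q1 / 4) * \<alpha> + of_rat (q2 / 4) * \<beta> + of_rat (q3 / 4) * (\<alpha> * \<beta>)"
      by (simp add: of_rat_divide field_simps)
    then show "w \<in> qspan \<alpha> \<beta>" unfolding qspan_def by blast
  next
    fix w assume "w \<in> qspan \<alpha> \<beta>"
    moreover have "\<alpha> \<in> K" "\<beta> \<in> K" using a b by (auto simp: eigen_def)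
    ultimately show "w \<in> K" by (auto simp: qspan_def intro!: KD)
  qed
  also have "\<dots> = biquad_field m n"
    unfolding biquad_field_def by (rule qspan_sign) (simp_all only: csqrt_square a b)
  finally show ?thesis using a b m1 n1 mn by (auto simp: radicand_pairs_def)
qed

end

lemma galois_group_carrierD:
  assumes K: "subfield K complex_ring" and f: "f \<in> carrier (galois_group K)"
  shows "f \<in> Bij K" "f \<in> extensional K" "\<And>x. x \<in> K \<Longrightarrow> f x \<in> K" "inj_on f K"
    "\<And>x y. x \<in> K \<Longrightarrow> y \<in> K \<Longrightarrow> f (x + y) = f x + f y"
    "\<And>x y. x \<in> K \<Longrightarrow> y \<in> K \<Longrightarrow> f (x * y) = f x * f y"
    "f 1 = 1" "\<And>q. f (of_rat q) = of_rat q"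
proof -
  have h: "f \<in> Ring.ring_hom (as_ring K) (as_ring K)" and B: "f \<in> Bij K"
    using f by (auto simp: galois_group_def)
  show "f \<in> Bij K" "f \<in> extensional K" "inj_on f K" "\<And>x. x \<in> K \<Longrightarrow> f x \<in> K"
    using B by (auto simp: Bij_def bij_betw_def)
  note hD = ring_hom_as_ringD[OF h]
  show "f (x + y) = f x + f y" if "x \<in> K" "y \<in> K" for x y using hD(1) that by blast
  show "f (x * y) = f x * f y" if "x \<in> K" "y \<in> K" for x y using hD(2) that by blast
  show "f 1 = 1" using hD(3) by blast
  show "f (of_rat q) = of_rat q" for q using f by (auto simp: galois_group_def)
qed

lemma galois_group_compose:
  assumes K: "subfield K complex_ring" and f: "f \<in> carrier (galois_group K)" and g: "g \<in> carrier (galois_group K)"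
  shows "compose K f g \<in> carrier (galois_group K)" "f \<otimes>\<^bsub>galois_group K\<^esub> g = compose K f g"
proof -
  note fD = galois_group_carrierD[OF K f]
  note gD = galois_group_carrierD[OF K g]
  note KD = subfield_complexD[OF K]
  have "compose K f g \<in> Bij K" using fD(1) gD(1) by (rule compose_Bij)
  moreover have "compose K f g \<in> Ring.ring_hom (as_ring K) (as_ring K)"
    using fD gD KD by (auto simp: Ring.ring_hom_def compose_def)
  moreover have "\<forall>q\<in>\<rat>. compose K f g q = q" using fD gD KD by (auto simp: Rats_def compose_def)
  ultimately show "compose K f g \<in> carrier (galois_group K)" by (simp add: galois_group_def)
  show "f \<otimes>\<^bsub>galois_group K\<^esub> g = compose K f g"
    using fD(1) gD(1) by (simp add: galois_group_def BijGroup_def)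
qed

text \<open>Only the multiplication table of the group enters: the elements corresponding to \<open>(1, 0)\<close> and \<open>(0, 1)\<close> act as
  commuting involutions that generate the Galois group.\<close>

lemma biquadratic_imp_biquad_field:
  assumes "biquadratic K"
  shows "\<exists>m n. (m, n) \<in> radicand_pairs \<and> K = biquad_field m n"
proof -
  let ?Z = "integer_mod_group 2"
  let ?G = "galois_group K"
  have K: "subfield K complex_ring" and fixed: "{x \<in> K. \<forall>\<sigma>\<in>carrier ?G. \<sigma> x = x} = \<rat>"
    and iso: "?G \<cong> ?Z \<times>\<times> ?Z"
    using assms by (auto simp: biquadratic_def galois_over_rat_def number_field_def)
  note KD = subfield_complexD[OF K] and gD = galois_group_carrierD[OF K] and comp = galois_group_compose[OF K]
  obtain h where hom: "h \<in> hom ?G (?Z \<times>\<times> ?Z)" and bij: "bij_betw h (carrier ?G) (carrier (?Z \<times>\<times> ?Z))"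
    using iso by (auto simp: is_iso_def iso_def)
  have cZ: "carrier (?Z \<times>\<times> ?Z) = {0, 1} \<times> {0, 1}" by (auto simp: carrier_integer_mod_group)
  have inj: "f = g" if "f \<in> carrier ?G" "g \<in> carrier ?G" "h f = h g" for f g
    using bij that by (meson bij_betw_def inj_onD)
  have hm: "h (compose K f g) = h f \<otimes>\<^bsub>?Z \<times>\<times> ?Z\<^esub> h g" if "f \<in> carrier ?G" "g \<in> carrier ?G" for f g
    using hom comp(2)[OF that] that by (metis hom_mult)
  have surj: "\<exists>f\<in>carrier ?G. h f = p" if "p \<in> {0, 1} \<times> {0, 1}" for p
    using bij that cZ by (metis bij_betw_iff_bijections)
  obtain e where e: "e \<in> carrier ?G" "h e = (0, 0)" using surj[of "(0, 0)"] by auto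
  obtain \<sigma> where s: "\<sigma> \<in> carrier ?G" "h \<sigma> = (1, 0)" using surj[of "(1, 0)"] by auto
  obtain \<tau> where t: "\<tau> \<in> carrier ?G" "h \<tau> = (0, 1)" using surj[of "(0, 1)"] by auto
  have ee: "compose K e e = e" by (rule inj) (use e comp in \<open>auto simp: hm\<close>)
  have e_id: "e x = x" if "x \<in> K" for x
  proof -
    have "e (e x) = e x" using fun_cong[OF ee, of x] that by (simp add: compose_def)
    then show ?thesis using gD(4)[OF e(1)] gD(3)[OF e(1) that] that by (meson inj_onD)
  qed
  have ss: "compose K \<sigma> \<sigma> = e" by (rule inj) (use e s comp in \<open>auto simp: hm\<close>)
  have tt: "compose K \<tau> \<tau> = e" by (rule inj) (use e t comp in \<open>auto simp: hm\<close>)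
  have st: "compose K \<sigma> \<tau> = compose K \<tau> \<sigma>" by (rule inj) (use s t comp in \<open>auto simp: hm\<close>)
  have hst: "h (compose K \<sigma> \<tau>) = (1, 1)" using s t by (simp add: hm)
  have all: "f = e \<or> f = \<sigma> \<or> f = \<tau> \<or> f = compose K \<sigma> \<tau>" if f: "f \<in> carrier ?G" for f
  proof -
    have "h f \<in> {0, 1} \<times> {0, 1}" using bij f cZ by (metis bij_betwE)
    then have "h f = h e \<or> h f = h \<sigma> \<or> h f = h \<tau> \<or> h f = h (compose K \<sigma> \<tau>)"
      using e s t hst by auto
    then show ?thesis using inj[OF f] e(1) s(1) t(1) comp(1)[OF s(1) t(1)] by blast
  qed
  have moves: "\<exists>x\<in>K. f x \<noteq> x" if f: "f \<in> carrier ?G" "f \<noteq> e" for f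
  proof (rule ccontr)
    assume "\<not> (\<exists>x\<in>K. f x \<noteq> x)"
    then have "f = e" using gD(2)[OF f(1)] gD(2)[OF e(1)] e_id by (intro extensionalityI) auto
    then show False using f by simp
  qed
  interpret klein_action K \<sigma> \<tau>
  proof (rule klein_action.intro)
    show "subfield K complex_ring" by (rule K)
    show "\<sigma> (\<sigma> x) = x" if "x \<in> K" for x using fun_cong[OF ss, of x] that e_id by (simp add: compose_def)
    show "\<tau> (\<tau> x) = x" if "x \<in> K" for x using fun_cong[OF tt, of x] that e_id by (simp add: compose_def)
    show "\<sigma> (\<tau> x) = \<tau> (\<sigma> x)" if "x \<in> K" for x using fun_cong[OF st, of x] that by (simp add: compose_def)
    show "x \<in> \<rat>" if "x \<in> K" "\<sigma> x = x" "\<tau> x = x" for x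
    proof -
      have "f x = x" if "f \<in> carrier ?G" for f
        using all[OF that] \<open>x \<in> K\<close> \<open>\<sigma> x = x\<close> \<open>\<tau> x = x\<close> e_id by (auto simp: compose_def)
      then show ?thesis using fixed \<open>x \<in> K\<close> by blast
    qed
    show "\<exists>x\<in>K. \<sigma> x \<noteq> x" by (rule moves) (use s e in auto)
    show "\<exists>x\<in>K. \<tau> x \<noteq> x" by (rule moves) (use t e in auto)
    have "\<exists>x\<in>K. compose K \<sigma> \<tau> x \<noteq> x"
      by (rule moves) (use comp(1)[OF s(1) t(1)] hst e in auto)
    then show "\<exists>x\<in>K. \<sigma> (\<tau> x) \<noteq> x" by (auto simp: compose_def)
  qed (use gD s t in blast)+
  show ?thesis by (rule K_biquad_field)
qed

section \<open>Pairs of radicands\<close>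

definition pair_disc :: "int \<Rightarrow> int \<Rightarrow> int" where
  "pair_disc m n = disc_factor m * disc_factor n * disc_factor (third_radicand m n)"

definition bounded_radicand_pairs :: "real \<Rightarrow> (int \<times> int) set" where
  "bounded_radicand_pairs L = {(m, n). (m, n) \<in> radicand_pairs \<and> real_of_int (pair_disc m n) \<le> L}"

definition bounded_fields :: "real \<Rightarrow> complex set set" where
  "bounded_fields L = {K. biquadratic K \<and> real_of_int (field_discriminant K) \<le> L}"

text \<open>These are the ordered pairs of distinct elements of \<open>{m, n, k}\<close>.\<close>

lemma card_biquad_field_fibre:
  assumes K: "K \<in> bounded_fields L"
  shows "card {p \<in> bounded_radicand_pairs L. case_prod biquad_field p = K} = 6"
proof -
  have "biquadratic K" using K by (simp add: bounded_fields_def)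
  from biquadratic_imp_biquad_field[OF this]
  obtain m n where mn: "(m, n) \<in> radicand_pairs" and Kmn: "K = biquad_field m n" by blast
  define k where "k = third_radicand m n"
  have ne: "m \<noteq> 1" "n \<noteq> 1" "m \<noteq> n" "k \<noteq> 1" "k \<noteq> m" "k \<noteq> n" "squarefree m" "squarefree n" "squarefree k"
    using mn third_radicand_ne[OF mn] by (auto simp: radicand_pairs_def k_def)
  define S where "S = {m, n, k}"
  have S: "squarefree a \<and> a \<noteq> 1" if "a \<in> S" for a using that ne by (auto simp: S_def)
  have cS: "finite S" "card S = 3" using ne by (simp_all add: S_def)
  have mem: "(m', n') \<in> bounded_radicand_pairs L \<and> biquad_field m' n' = K \<longleftrightarrow>
      (m', n') \<in> radicand_pairs \<and> m' \<in> S \<and> n' \<in> S" for m' n'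
  proof (cases "(m', n') \<in> radicand_pairs")
    case True
    have "biquad_field m' n' = K \<longleftrightarrow> m' \<in> S \<and> n' \<in> S"
      unfolding Kmn S_def k_def by (rule biquad_field_eq_iff[OF mn True])
    moreover have "real_of_int (pair_disc m' n') \<le> L" if "biquad_field m' n' = K"
      using biquad_field_discriminant[OF True] K that by (simp add: pair_disc_def bounded_fields_def)
    ultimately show ?thesis using True unfolding bounded_radicand_pairs_def by blast
  qed (simp add: bounded_radicand_pairs_def)
  have "{p \<in> bounded_radicand_pairs L. case_prod biquad_field p = K} = S \<times> S - (\<lambda>a. (a, a)) ` S"
  proof (rule Set.set_eqI)
    fix p :: "int \<times> int"
    obtain a b where p: "p = (a, b)" by force
    have "p \<in> {p \<in> bounded_radicand_pairs L. case_prod biquad_field p = K} \<longleftrightarrow> (a, b) \<in> radicand_pairs \<and> a \<in> S \<and> b \<in> S"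
      using mem[of a b] by (simp add: p)
    also have "\<dots> \<longleftrightarrow> a \<in> S \<and> b \<in> S \<and> a \<noteq> b" using S by (auto simp: radicand_pairs_def)
    also have "\<dots> \<longleftrightarrow> p \<in> S \<times> S - (\<lambda>a. (a, a)) ` S" by (auto simp: p)
    finally show "p \<in> {p \<in> bounded_radicand_pairs L. case_prod biquad_field p = K} \<longleftrightarrow> p \<in> S \<times> S - (\<lambda>a. (a, a)) ` S" .
  qed
  moreover have "card (S \<times> S - (\<lambda>a. (a, a)) ` S) = card (S \<times> S) - card ((\<lambda>a. (a, a)) ` S)"
    using cS by (intro card_Diff_subset) auto
  moreover have "card ((\<lambda>a. (a, a)) ` S) = card S" by (rule card_image) (auto simp: inj_on_def)
  ultimately show ?thesis using cS by (simp add: card_cartesian_product)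
qed

lemma card_bounded_radicand_pairs:
  assumes fin: "finite (bounded_radicand_pairs L)"
  shows "card (bounded_radicand_pairs L) = 6 * biquadratic_count L"
proof -
  let ?R = "bounded_radicand_pairs L" and ?B = "bounded_fields L"
  have img: "?B = case_prod biquad_field ` ?R"
  proof (intro equalityI subsetI)
    fix K assume K: "K \<in> ?B"
    then have "{p \<in> ?R. case_prod biquad_field p = K} \<noteq> {}"
      using card_biquad_field_fibre[OF K] by (metis card.empty zero_neq_numeral)
    then show "K \<in> case_prod biquad_field ` ?R" by auto
  next
    fix K assume "K \<in> case_prod biquad_field ` ?R"
    then obtain m n where "(m, n) \<in> ?R" "K = biquad_field m n" by auto
    then show "K \<in> ?B"
      using biquadratic_biquad_field[of m n] biquad_field_discriminant[of m n]
      by (auto simp: bounded_fields_def bounded_radicand_pairs_def pair_disc_def)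
  qed
  have "card ?R = card (\<Union>K\<in>?B. {p \<in> ?R. case_prod biquad_field p = K})"
    unfolding img by (intro arg_cong[of _ _ card]) auto
  also have "\<dots> = (\<Sum>K\<in>?B. card {p \<in> ?R. case_prod biquad_field p = K})"
    using fin by (intro card_UN_disjoint) (auto simp: img)
  also have "\<dots> = (\<Sum>K\<in>?B. 6)" by (intro sum.cong refl card_biquad_field_fibre)
  also have "\<dots> = 6 * biquadratic_count L" by (simp add: biquadratic_count_def bounded_fields_def)
  finally show ?thesis .
qed

text \<open>Representatives of the subgroup of square classes generated by \<open>-1\<close> and \<open>2\<close>. Every squarefree integer is
  uniquely the product of one of them and \<open>primary M\<close> for an odd squarefree \<open>M\<close>, and its residue modulo \<open>4\<close>
  is that of the first factor.\<close>

definition two_parts :: "int set" where "two_parts = {1, -1, 2, -2}"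

definition primary :: "nat \<Rightarrow> int" where "primary M = (if int M mod 4 = 1 then int M else - int M)"

lemma primary_mod_4: "odd M \<Longrightarrow> primary M mod 4 = 1"
  unfolding primary_def by presburger

lemma abs_primary [simp]: "\<bar>primary M\<bar> = int M"
  by (simp add: primary_def)

lemma primary_odd: "odd M \<Longrightarrow> odd (primary M)"
  by (simp add: primary_def)

lemma squarefree_int_nat: "squarefree (int M) \<longleftrightarrow> squarefree M"
proof
  assume sq: "squarefree (int M)"
  show "squarefree M"
  proof (rule squarefreeI)
    fix x assume "x ^ 2 dvd M"
    then have "(int x) ^ 2 dvd int M" by (metis int_dvd_int_iff of_nat_power)
    then have "int x dvd 1" using squarefreeD[OF sq] by blast
    then show "x dvd 1" by simp
  qed
next
  assume sq: "squarefree M"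
  show "squarefree (int M)"
  proof (rule squarefreeI)
    fix x :: int assume "x ^ 2 dvd int M"
    moreover have "x ^ 2 = int ((nat \<bar>x\<bar>) ^ 2)" by simp
    ultimately have "(nat \<bar>x\<bar>) ^ 2 dvd M" by (metis int_dvd_int_iff)
    then have "nat \<bar>x\<bar> dvd 1" using squarefreeD[OF sq] by blast
    then show "x dvd 1" by auto
  qed
qed

lemma squarefree_primary: "squarefree (primary M) \<longleftrightarrow> squarefree M"
  by (simp add: primary_def squarefree_int_nat)

lemma squarefree_normal_form:
  assumes "t \<in> two_parts" "M \<in> odd_squarefree"
  shows "squarefree (t * primary M)"
proof -
  have M: "odd M" "squarefree M" using assms by (auto simp: odd_squarefree_def)
  have "coprime 2 (primary M)" using primary_odd[OF M(1)] by simp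
  moreover have "squarefree (2 :: int)" by (intro squarefree_prime) simp
  ultimately have "squarefree (2 * primary M)"
    using M by (intro squarefree_mult_coprime) (simp_all add: squarefree_primary)
  then have "squarefree (- (2 * primary M))" by (simp only: squarefree_minus)
  then show ?thesis
    using assms M \<open>squarefree (2 * primary M)\<close> by (auto simp: two_parts_def squarefree_primary)
qed

lemma normal_form_unique:
  assumes "t \<in> two_parts" "t' \<in> two_parts" "odd M" "odd M'" "t * primary M = t' * primary M'"
  shows "t = t'" "M = M'"
proof -
  have odd: "odd (primary M)" "odd (primary M')" using assms primary_odd by auto
  have mod: "primary M mod 4 = 1" "primary M' mod 4 = 1" using assms primary_mod_4 by auto
  have t: "t = 1 \<or> t = -1 \<or> t = 2 \<or> t = -2" "t' = 1 \<or> t' = -1 \<or> t' = 2 \<or> t' = -2"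
    using assms by (auto simp: two_parts_def)
  have "even t \<longleftrightarrow> even t'" using assms(5) odd by (metis even_mult_iff)
  then have "t = t' \<or> t = - t'" using t by auto
  then show tt: "t = t'"
  proof
    assume "t = - t'"
    then have "primary M = - primary M'" using assms(5) t(2) by auto
    then have False using mod by presburger
    then show ?thesis ..
  qed
  then have "primary M = primary M'" using assms(5) t by auto
  then have "\<bar>primary M\<bar> = \<bar>primary M'\<bar>" by simp
  then show "M = M'" by simp
qed

lemma normal_form_exists:
  assumes "squarefree (m :: int)"
  obtains t M where "t \<in> two_parts" "M \<in> odd_squarefree" "m = t * primary M"
proof -
  have odd_case: "\<exists>t M. (t = 1 \<or> t = -1) \<and> M \<in> odd_squarefree \<and> j = t * primary M" if "squarefree j" "odd j" for j :: int
  proof -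
    define M where "M = nat \<bar>j\<bar>"
    have jM: "j = int M \<or> j = - int M" by (auto simp: M_def)
    then have "squarefree (int M)" using that by auto
    then have "M \<in> odd_squarefree" using that jM by (auto simp: odd_squarefree_def squarefree_int_nat)
    moreover have "j = primary M \<or> j = - primary M" using jM by (auto simp: primary_def)
    ultimately show ?thesis by (metis mult_1 mult_minus1)
  qed
  show thesis
  proof (cases "even m")
    case False
    then show thesis using odd_case[OF assms] that by (auto simp: two_parts_def)
  next
    case True
    then obtain j where j: "m = 2 * j" by (rule evenE)
    have "odd j"
    proof
      assume "even j"
      then have "2 ^ 2 dvd m" unfolding j by (auto elim!: evenE)
      then have "(2 :: int) dvd 1" using squarefreeD[OF assms] by blast
      then show False by simp
    qed
    moreover have "squarefree j" using assms unfolding j by (rule squarefree_mono[rotated]) simp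
    ultimately obtain t M where tM: "t = 1 \<or> t = -1" "M \<in> odd_squarefree" "j = t * primary M" using odd_case by blast
    then have "m = (2 * t) * primary M" "2 * t \<in> two_parts" by (auto simp: j two_parts_def)
    then show thesis using that tM by blast
  qed
qed

text \<open>Each of the three radicands that is not \<open>1\<close> modulo \<open>4\<close> contributes a factor \<open>2\<close> to the square root of the
  discriminant, and so does the prime \<open>2\<close> if it divides a radicand.\<close>

definition disc_weight :: "int \<Rightarrow> int \<Rightarrow> int" where
  "disc_weight t s = (if t = 1 then 1 else 2) * (if s = 1 then 1 else 2) * (if t = s then 1 else 2)
     * (if even t \<or> even s then 2 else 1)"

lemma normal_form_mod_4:
  assumes "t \<in> two_parts" "odd M"
  shows "t * primary M mod 4 = 1 \<longleftrightarrow> t = 1"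
proof -
  have "primary M mod 4 = 1" using primary_mod_4[OF assms(2)] .
  then have "(t * primary M) mod 4 = t mod 4" by (metis mod_mult_right_eq mult_1_right)
  then show ?thesis using assms(1) by (auto simp: two_parts_def)
qed

lemma third_radicand_times_gcd_square:
  assumes "m \<noteq> 0"
  shows "m * n = gcd m n * gcd m n * third_radicand m n"
proof -
  have "m * n = (gcd m n * (m div gcd m n)) * (gcd m n * (n div gcd m n))" by simp
  then show ?thesis by (simp only: third_radicand_def mult_ac)
qed

text \<open>The third radicand has the square class of \<open>t s\<close> times an integer that is \<open>1\<close> modulo \<open>4\<close>, and odd squares are \<open>1\<close>
  modulo \<open>4\<close>. If both factors are even, a common factor \<open>2\<close> is removed first.\<close>

lemma third_radicand_mod_4:
  assumes ts: "t \<in> two_parts" "s \<in> two_parts" and MN: "odd M" "odd N"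
  shows "third_radicand (t * primary M) (s * primary N) mod 4 = 1 \<longleftrightarrow> t = s"
proof -
  define m where "m = t * primary M"
  define n where "n = s * primary N"
  define k where "k = third_radicand m n"
  have nz: "primary M \<noteq> 0" "primary N \<noteq> 0" using MN primary_odd by (metis dvd_0_right)+
  have m0: "m \<noteq> 0" using nz ts by (auto simp: m_def two_parts_def)
  have eq: "m * n = gcd m n * gcd m n * k"
    unfolding k_def by (rule third_radicand_times_gcd_square[OF m0])
  have mod: "primary M mod 4 = 1" "primary N mod 4 = 1" using MN primary_mod_4 by auto
  have sMN: "primary M * primary N mod 4 = 1" using mod mod_mult_eq[of "primary M" 4 "primary N"] by simp
  have odd: "odd (primary M)" "odd (primary N)" using MN primary_odd by auto
  (* the common argument: c is the product of t and s, or of their halves *)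
  have key: "(k mod 4 = 1) = (c = 1)" if g: "odd g" and c: "c = 1 \<or> c = -1" and e: "c * (primary M * primary N) = g * g * k" for g c
  proof -
    have "(g * g * k) mod 4 = k mod 4" using odd_square_mod_4[OF g] by (metis mod_mult_left_eq mult_1_left)
    moreover have "(c * (primary M * primary N)) mod 4 = c mod 4" using sMN by (metis mod_mult_right_eq mult_1_right)
    ultimately have "k mod 4 = c mod 4" using e by simp
    then show ?thesis using c by auto
  qed
  consider "odd t" "odd s" | "odd t" "even s" | "even t" "odd s" | "even t" "even s" by blast
  then have "(k mod 4 = 1) = (t = s)"
  proof cases
    case 1
    then have ts': "t = 1 \<or> t = -1" "s = 1 \<or> s = -1" using ts by (auto simp: two_parts_def)
    have "odd m" using 1 odd by (simp add: m_def)
    then have "odd (gcd m n)" by (meson dvd_trans gcd_dvd1)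
    moreover have "(t * s) * (primary M * primary N) = gcd m n * gcd m n * k" using eq by (simp add: m_def n_def mult_ac)
    ultimately have "(k mod 4 = 1) = (t * s = 1)" using ts' by (intro key[of "gcd m n"]) auto
    then show ?thesis using ts' by auto
  next
    case 2
    have "odd m" "even n" using 2 odd by (auto simp: m_def n_def)
    then have "odd (gcd m n)" by (meson dvd_trans gcd_dvd1)
    then have "even k" using eq \<open>even n\<close> by (metis even_mult_iff)
    then have "k mod 4 \<noteq> 1" by presburger
    then show ?thesis using 2 by auto
  next
    case 3
    have "even m" "odd n" using 3 odd by (auto simp: m_def n_def)
    then have "odd (gcd m n)" by (meson dvd_trans gcd_dvd2)
    then have "even k" using eq \<open>even m\<close> by (metis even_mult_iff)
    then have "k mod 4 \<noteq> 1" by presburger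
    then show ?thesis using 3 by auto
  next
    case 4
    define t' where "t' = t div 2"
    define s' where "s' = s div 2"
    have t': "t = 2 * t'" "t' = 1 \<or> t' = -1" and s': "s = 2 * s'" "s' = 1 \<or> s' = -1"
      using ts 4 by (auto simp: two_parts_def t'_def s'_def)
    define g where "g = gcd (t' * primary M) (s' * primary N)"
    have g: "gcd m n = 2 * g"
      unfolding m_def n_def g_def t'(1) s'(1) by (simp add: mult.assoc gcd_mult_distrib_int[symmetric])
    have "odd (t' * primary M)" using t' odd by auto
    then have "odd g" unfolding g_def by (meson dvd_trans gcd_dvd1)
    moreover have "(t' * s') * (primary M * primary N) = g * g * k"
      using eq unfolding g by (simp add: m_def n_def t'(1) s'(1) mult_ac)
    ultimately have "(k mod 4 = 1) = (t' * s' = 1)" using t' s' by (intro key[of g]) auto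
    then show ?thesis using t' s' by auto
  qed
  then show ?thesis by (simp add: k_def m_def n_def)
qed

lemma lcm_normal_form:
  assumes ts: "t \<in> two_parts" "s \<in> two_parts" and MN: "odd M" "odd N"
  shows "lcm (t * primary M) (s * primary N) = (if even t \<or> even s then 2 else 1) * int (lcm M N)"
proof -
  have t: "t = 1 \<or> t = -1 \<or> t = 2 \<or> t = -2" "s = 1 \<or> s = -1 \<or> s = 2 \<or> s = -2"
    using ts by (auto simp: two_parts_def)
  define i :: nat where "i = (if even t then 1 else 0)"
  define j :: nat where "j = (if even s then 1 else 0)"
  have at: "\<bar>t\<bar> = 2 ^ i" "\<bar>s\<bar> = 2 ^ j" using t by (auto simp: i_def j_def)
  have "lcm (t * primary M) (s * primary N) = lcm \<bar>t * primary M\<bar> \<bar>s * primary N\<bar>" by simp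
  also have "\<dots> = lcm (int (2 ^ i * M)) (int (2 ^ j * N))" unfolding abs_mult at by simp
  also have "\<dots> = int (lcm (2 ^ i * M) (2 ^ j * N))" by (rule lcm_int_int_eq)
  also have "lcm (2 ^ i * M) (2 ^ j * N) = 2 ^ max i j * lcm M N"
    by (rule lcm_prime_power_mult) (use MN in auto)
  also have "int \<dots> = (if even t \<or> even s then 2 else 1) * int (lcm M N)"
    by (auto simp: i_def j_def)
  finally show ?thesis .
qed

text \<open>The product of the three radicands is \<open>lcm(m, n)\<^sup>2\<close>.\<close>

lemma pair_disc_normal_form:
  assumes ts: "t \<in> two_parts" "s \<in> two_parts" and MN: "odd M" "odd N"
  shows "pair_disc (t * primary M) (s * primary N) = (disc_weight t s * int (lcm M N)) ^ 2"
proof -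
  define m where "m = t * primary M"
  define n where "n = s * primary N"
  define k where "k = third_radicand m n"
  define g where "g = gcd m n"
  have nz: "primary M \<noteq> 0" "primary N \<noteq> 0" using MN primary_odd by (metis dvd_0_right)+
  have m0: "m \<noteq> 0" "n \<noteq> 0" using nz ts by (auto simp: m_def n_def two_parts_def)
  have g0: "g \<noteq> 0" using m0 by (simp add: g_def)
  have eq: "m * n = g * g * k" unfolding k_def g_def by (rule third_radicand_times_gcd_square[OF m0(1)])
  have "(g * lcm m n) ^ 2 = (m * n) ^ 2"
    unfolding g_def by (metis abs_mult power2_abs prod_gcd_lcm_int)
  also have "\<dots> = (g * g * k) * (m * n)" using eq by (simp add: power2_eq_square)
  finally have "g * g * (lcm m n) ^ 2 = g * g * (m * n * k)" by (simp add: power2_eq_square mult_ac)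
  then have mnk: "m * n * k = (lcm m n) ^ 2" using g0 by simp
  have df: "disc_factor j = (if j mod 4 = 1 then 1 else 2) ^ 2 * j" for j by (simp add: disc_factor_def)
  have "pair_disc m n = ((if m mod 4 = 1 then 1 else 2) * (if n mod 4 = 1 then 1 else 2) * (if k mod 4 = 1 then 1 else 2)) ^ 2 * (m * n * k)"
    unfolding pair_disc_def df k_def[symmetric] power_mult_distrib by (simp only: mult_ac)
  also have "m mod 4 = 1 \<longleftrightarrow> t = 1" unfolding m_def by (rule normal_form_mod_4[OF ts(1) MN(1)])
  also have "n mod 4 = 1 \<longleftrightarrow> s = 1" unfolding n_def by (rule normal_form_mod_4[OF ts(2) MN(2)])
  also have "k mod 4 = 1 \<longleftrightarrow> t = s" unfolding k_def m_def n_def by (rule third_radicand_mod_4[OF ts MN])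
  also have "m * n * k = ((if even t \<or> even s then 2 else 1) * int (lcm M N)) ^ 2"
    unfolding mnk unfolding m_def n_def lcm_normal_form[OF ts MN] ..
  finally show ?thesis
    unfolding disc_weight_def m_def[symmetric] n_def[symmetric] by (simp only: power_mult_distrib mult.assoc)
qed

section \<open>The asymptotic formula\<close>

definition two_part_pairs :: "(int \<times> int) set" where "two_part_pairs = two_parts \<times> two_parts"

definition pair_weight :: "int \<times> int \<Rightarrow> real" where
  "pair_weight = (\<lambda>(t, s). real_of_int (disc_weight t s))"

text \<open>Parametrizes the pairs of squarefree integers, degenerate ones included, whose formal discriminant is at most
  \<open>y\<^sup>2\<close>.\<close>

definition parameters :: "real \<Rightarrow> ((int \<times> int) \<times> (nat \<times> nat)) set" where
  "parameters y = (SIGMA p:two_part_pairs. bounded_lcm_pairs (y / pair_weight p))"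

definition param_pair :: "(int \<times> int) \<times> (nat \<times> nat) \<Rightarrow> int \<times> int" where
  "param_pair = (\<lambda>((t, s), (M, N)). (t * primary M, s * primary N))"

lemma finite_two_part_pairs [simp]: "finite two_part_pairs"
  by (simp add: two_part_pairs_def two_parts_def)

lemma pair_weight_ge_1: "pair_weight p \<ge> 1"
  by (auto simp: pair_weight_def disc_weight_def split: prod.splits)

lemma inj_on_param_pair: "inj_on param_pair (parameters y)"
proof (rule inj_onI)
  fix p q assume pq: "p \<in> parameters y" "q \<in> parameters y" "param_pair p = param_pair q"
  obtain t s M N t' s' M' N' where p: "p = ((t, s), (M, N))" and q: "q = ((t', s'), (M', N'))"
    by (metis surj_pair)
  have "t \<in> two_parts" "s \<in> two_parts" "odd M" "odd N" "t' \<in> two_parts" "s' \<in> two_parts" "odd M'" "odd N'"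
    using pq unfolding p q by (auto simp: parameters_def two_part_pairs_def bounded_lcm_pairs_def odd_squarefree_def)
  moreover have "t * primary M = t' * primary M'" "s * primary N = s' * primary N'"
    using pq(3) unfolding p q by (simp_all add: param_pair_def)
  ultimately show "p = q"
    using normal_form_unique[of t t' M M'] normal_form_unique[of s s' N N'] by (simp add: p q)
qed

lemma bounded_radicand_pairs_param:
  assumes B: "B \<ge> 0"
  shows "bounded_radicand_pairs B = param_pair ` parameters (sqrt B) \<inter> radicand_pairs"
proof -
  have key: "real_of_int (pair_disc (t * primary M) (s * primary N)) \<le> B \<longleftrightarrow> real (lcm M N) \<le> sqrt B / pair_weight (t, s)"
    if "t \<in> two_parts" "s \<in> two_parts" "M \<in> odd_squarefree" "N \<in> odd_squarefree" for t s M N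
  proof -
    define w where "w = pair_weight (t, s)"
    have w: "w > 0" using pair_weight_ge_1[of "(t, s)"] by (simp add: w_def)
    have "real_of_int (pair_disc (t * primary M) (s * primary N)) = (w * real (lcm M N)) ^ 2"
      using that by (subst pair_disc_normal_form) (auto simp: odd_squarefree_def w_def pair_weight_def)
    also have "\<dots> \<le> B \<longleftrightarrow> w * real (lcm M N) \<le> sqrt B"
      using w B by (auto simp: real_le_rsqrt sqrt_ge_absD intro: real_sqrt_le_mono dest: power_mono[of _ _ 2])
    also have "\<dots> \<longleftrightarrow> real (lcm M N) \<le> sqrt B / w" using w by (simp add: field_simps)
    finally show ?thesis by (simp only: w_def)
  qed
  show ?thesis
  proof (intro equalityI subsetI)
    fix p assume p: "p \<in> bounded_radicand_pairs B"
    obtain m n where mn: "p = (m, n)" by force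
    have "squarefree m" "squarefree n" using p by (auto simp: mn bounded_radicand_pairs_def radicand_pairs_def)
    obtain t M where tM: "t \<in> two_parts" "M \<in> odd_squarefree" "m = t * primary M"
      using normal_form_exists[OF \<open>squarefree m\<close>] by blast
    obtain s N where sN: "s \<in> two_parts" "N \<in> odd_squarefree" "n = s * primary N"
      using normal_form_exists[OF \<open>squarefree n\<close>] by blast
    have "((t, s), (M, N)) \<in> parameters (sqrt B)"
      using key[OF tM(1) sN(1) tM(2) sN(2)] p tM sN
      by (simp add: parameters_def two_part_pairs_def bounded_lcm_pairs_def bounded_radicand_pairs_def mn)
    moreover have "p = param_pair ((t, s), (M, N))" by (simp add: mn param_pair_def tM sN)
    ultimately show "p \<in> param_pair ` parameters (sqrt B) \<inter> radicand_pairs"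
      using p by (auto simp: bounded_radicand_pairs_def)
  next
    fix p assume p: "p \<in> param_pair ` parameters (sqrt B) \<inter> radicand_pairs"
    then obtain t s M N where tsMN: "((t, s), (M, N)) \<in> parameters (sqrt B)" "p = (t * primary M, s * primary N)"
      by (auto simp: param_pair_def)
    then have "real_of_int (pair_disc (t * primary M) (s * primary N)) \<le> B"
      by (subst key) (auto simp: parameters_def two_part_pairs_def bounded_lcm_pairs_def)
    then show "p \<in> bounded_radicand_pairs B"
      using p tsMN by (simp add: bounded_radicand_pairs_def)
  qed
qed

lemma finite_parameters: "finite (parameters y)"
  unfolding parameters_def by (intro finite_SigmaI finite_bounded_lcm_pairs) simp

lemma card_parameters:
  "real (card (parameters y)) = (\<Sum>p\<in>two_part_pairs. summatory (mult_fun lcm_coeff) (y / pair_weight p))"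
  unfolding parameters_def
  by (subst card_SigmaI) (auto simp: finite_bounded_lcm_pairs card_bounded_lcm_pairs)

lemma two_parts_card [simp]: "finite two_parts" "card two_parts = 4"
  by (simp_all add: two_parts_def)

text \<open>A degenerate pair is determined by its kind, of which there are three, by a two-part, of which there are four, and
  by an odd number up to \<open>y\<close>.\<close>

lemma card_degenerate_le:
  assumes y: "y \<ge> 0"
  shows "real (card (param_pair ` parameters y - radicand_pairs)) \<le> 12 * y"
proof -
  define D where "D = two_parts \<times> {1..nat \<lfloor>y\<rfloor>}"
  have D: "finite D" "real (card D) \<le> 4 * y"
    using y by (simp_all add: D_def card_cartesian_product)
  define f1 where "f1 = (\<lambda>(s, N). ((1::int), s * primary N))"
  define f2 where "f2 = (\<lambda>(s, N). (s * primary N, (1::int)))"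
  define f3 where "f3 = (\<lambda>(s, N). (s * primary N, s * primary N))"
  have "param_pair ` parameters y - radicand_pairs \<subseteq> f1 ` D \<union> (f2 ` D \<union> f3 ` D)"
  proof
    fix p assume p: "p \<in> param_pair ` parameters y - radicand_pairs"
    then obtain t s M N where tsMN: "((t, s), (M, N)) \<in> parameters y" "p = (t * primary M, s * primary N)"
      by (auto simp: param_pair_def)
    have ts: "t \<in> two_parts" "s \<in> two_parts" and MN: "M \<in> odd_squarefree" "N \<in> odd_squarefree"
      and le: "real (lcm M N) \<le> y / pair_weight (t, s)"
      using tsMN(1) by (auto simp: parameters_def two_part_pairs_def bounded_lcm_pairs_def)
    have odd: "odd M" "odd N" using MN by (auto simp: odd_squarefree_def)
    have pos: "M > 0" "N > 0" using MN odd_squarefree_pos by auto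
    have "y / pair_weight (t, s) \<le> y / 1"
      using pair_weight_ge_1[of "(t, s)"] y by (intro divide_left_mono) auto
    then have lcm: "real (lcm M N) \<le> y" using le by simp
    have "M \<le> lcm M N" "N \<le> lcm M N" using pos by (auto intro!: dvd_imp_le simp: lcm_pos_nat)
    then have "real M \<le> y" "real N \<le> y" using lcm by linarith+
    then have inD: "(t, M) \<in> D" "(s, N) \<in> D"
      using ts pos by (auto simp: D_def nat_floor_ge_iff Suc_le_eq)
    have "squarefree (t * primary M)" "squarefree (s * primary N)" using squarefree_normal_form ts MN by auto
    then consider "t * primary M = 1" | "s * primary N = 1" | "t * primary M = s * primary N"
      using p tsMN(2) by (auto simp: radicand_pairs_def)
    then show "p \<in> f1 ` D \<union> (f2 ` D \<union> f3 ` D)"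
    proof cases
      case 1
      then have "p = f1 (s, N)" by (simp add: f1_def tsMN(2))
      then show ?thesis using inD by blast
    next
      case 2
      then have "p = f2 (t, M)" by (simp add: f2_def tsMN(2))
      then show ?thesis using inD by blast
    next
      case 3
      then have "p = f3 (t, M)" by (simp add: f3_def tsMN(2))
      then show ?thesis using inD by blast
    qed
  qed
  then have "card (param_pair ` parameters y - radicand_pairs) \<le> card (f1 ` D \<union> (f2 ` D \<union> f3 ` D))"
    using D by (intro card_mono) auto
  also have "\<dots> \<le> card (f1 ` D) + (card (f2 ` D) + card (f3 ` D))"
    by (intro order_trans[OF card_Un_le] add_mono order_refl card_Un_le)
  also have "\<dots> \<le> card D + (card D + card D)"
    using D by (intro add_mono card_image_le)
  finally show ?thesis using D by linarith
qed

lemma six_biquadratic_count: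
  assumes B: "B \<ge> 0"
  shows "\<bar>6 * real (biquadratic_count B) - (\<Sum>p\<in>two_part_pairs. summatory (mult_fun lcm_coeff) (sqrt B / pair_weight p))\<bar> \<le> 12 * sqrt B"
proof -
  let ?I = "param_pair ` parameters (sqrt B)"
  have fin: "finite ?I" using finite_parameters by simp
  have "card ?I = card (parameters (sqrt B))" by (rule card_image[OF inj_on_param_pair])
  moreover have "card ?I = card (?I \<inter> radicand_pairs) + card (?I - radicand_pairs)"
    using card_Int_Diff[OF fin] .
  moreover have "card (?I \<inter> radicand_pairs) = 6 * biquadratic_count B"
    using card_bounded_radicand_pairs[of B] fin unfolding bounded_radicand_pairs_param[OF B] by simp
  ultimately have "real (card (parameters (sqrt B))) = 6 * real (biquadratic_count B) + real (card (?I - radicand_pairs))"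
    by linarith
  then show ?thesis
    using card_degenerate_le[of "sqrt B"] B unfolding card_parameters[symmetric] by simp
qed

lemma sum_two_part_pairs:
  fixes f :: "real \<Rightarrow> real"
  shows "(\<Sum>p\<in>two_part_pairs. f (pair_weight p)) = f 1 + 3 * f 4 + 6 * f 8 + 6 * f 16"
  unfolding two_part_pairs_def two_parts_def sum.cartesian_product[symmetric]
  by (simp add: pair_weight_def disc_weight_def)

lemma summatory_lcm_coeff_bigo:
  assumes c: "c > 0"
  shows "(\<lambda>x. summatory (mult_fun lcm_coeff) (sqrt x / c) - pair_density * ((sqrt x / c) * (ln (sqrt x / c))\<^sup>2 / 2))
    \<in> O[at_top](\<lambda>x. (sqrt x / c) * (1 + ln (sqrt x / c)))"
proof -
  obtain C where C: "\<And>y. y \<ge> 1 \<Longrightarrow>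
    \<bar>summatory (mult_fun lcm_coeff) y - pair_density * y * (ln y)\<^sup>2 / 2\<bar> \<le> C * y * (1 + ln y)"
    using summatory_mult_fun_lcm_coeff_asymptotic by blast
  have ev: "\<forall>\<^sub>F x in at_top. sqrt x / c \<ge> 1" using c by real_asymp
  show ?thesis
  proof (rule bigoI[of _ C])
    show "\<forall>\<^sub>F x in at_top. norm (summatory (mult_fun lcm_coeff) (sqrt x / c) - pair_density * ((sqrt x / c) * (ln (sqrt x / c))\<^sup>2 / 2))
        \<le> C * norm ((sqrt x / c) * (1 + ln (sqrt x / c)))"
      using ev
    proof eventually_elim
      case (elim x)
      have "0 \<le> (sqrt x / c) * (1 + ln (sqrt x / c))" using elim by (intro mult_nonneg_nonneg) auto
      then show ?case
        using C[OF elim] unfolding real_norm_def mult.assoc times_divide_eq_right[symmetric]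
        by (simp only: abs_of_nonneg)
    qed
  qed
qed

text \<open>Passing from \<open>ln (\<surd>x / c)\<close> to \<open>(ln x) / 2\<close> changes the main term by a multiple of \<open>\<surd>x ln x\<close> and one of \<open>\<surd>x\<close>.\<close>

lemma summatory_lcm_coeff_scaled:
  assumes c: "c \<in> {1, 4, 8, 16}"
  shows "(\<lambda>x. summatory (mult_fun lcm_coeff) (sqrt x / c) - pair_density / (8 * c) * (sqrt x * (ln x)\<^sup>2))
    \<in> O[at_top](\<lambda>x. sqrt x * ln x)"
proof -
  have "(\<lambda>x. (sqrt x / c) * (1 + ln (sqrt x / c))) \<in> O[at_top](\<lambda>x. sqrt x * ln x)"
    using c by (elim insertE emptyE; hypsubst; real_asymp)
  with summatory_lcm_coeff_bigo[of c] c
  have 1: "(\<lambda>x. summatory (mult_fun lcm_coeff) (sqrt x / c) - pair_density * ((sqrt x / c) * (ln (sqrt x / c))\<^sup>2 / 2))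
      \<in> O[at_top](\<lambda>x. sqrt x * ln x)" by (auto intro: landau_o.big_trans)
  have "sqrt \<in> O[at_top](\<lambda>x. sqrt x * ln x)" by real_asymp
  moreover have scale: "(\<lambda>x. a * f x) \<in> O[at_top](g)" if "f \<in> O[at_top](g)" for a and f g :: "real \<Rightarrow> real"
    using that by (cases "a = 0") simp_all
  ultimately have "(\<lambda>x. - pair_density * ln c / (2 * c) * (sqrt x * ln x) + pair_density * (ln c)\<^sup>2 / (2 * c) * sqrt x)
      \<in> O[at_top](\<lambda>x. sqrt x * ln x)"
    by (intro sum_in_bigo scale) simp_all
  moreover have "\<forall>\<^sub>F x in at_top. - pair_density * ln c / (2 * c) * (sqrt x * ln x) + pair_density * (ln c)\<^sup>2 / (2 * c) * sqrt x
      = pair_density * ((sqrt x / c) * (ln (sqrt x / c))\<^sup>2 / 2) - pair_density / (8 * c) * (sqrt x * (ln x)\<^sup>2)"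
    using eventually_gt_at_top[of 0]
  proof eventually_elim
    case (elim x)
    have "c > 0" using c by auto
    then have eq: "ln (sqrt x / c) = ln x / 2 - ln c" using elim by (simp add: ln_div ln_sqrt)
    show ?case unfolding eq using \<open>c > 0\<close> by (simp add: power2_eq_square field_simps)
  qed
  ultimately have 2: "(\<lambda>x. pair_density * ((sqrt x / c) * (ln (sqrt x / c))\<^sup>2 / 2) - pair_density / (8 * c) * (sqrt x * (ln x)\<^sup>2))
      \<in> O[at_top](\<lambda>x. sqrt x * ln x)"
    by (rule landau_o.big.in_cong[THEN iffD1, rotated])
  show ?thesis using sum_in_bigo(1)[OF 1 2] by simp
qed

theorem theorem1p1:
  shows "(\<lambda>x::real. real (biquadratic_count x)
            - 23 / 960 * sqrt x * (ln x)\<^sup>2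
              * (\<Prod>p::nat. if prime p then (1 - 1 / real p) ^ 3 * (1 + 3 / real p) else 1))
         \<in> O[at_top](\<lambda>x. sqrt x * ln x)"
proof -
  define F where "F x c = summatory (mult_fun lcm_coeff) (sqrt x / c)" for x c :: real
  define G where "G x c = F x c - pair_density / (8 * c) * (sqrt x * (ln x)\<^sup>2)" for x c :: real
  have G: "(\<lambda>x. G x c) \<in> O[at_top](\<lambda>x. sqrt x * ln x)" if "c \<in> {1, 4, 8, 16}" for c
    using summatory_lcm_coeff_scaled[OF that] by (simp add: G_def F_def)
  define E where "E x = 6 * real (biquadratic_count x) - (F x 1 + 3 * F x 4 + 6 * F x 8 + 6 * F x 16)" for x
  have "E \<in> O[at_top](\<lambda>x. sqrt x)"
  proof (rule bigoI[of _ 12])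
    show "\<forall>\<^sub>F x in at_top. norm (E x) \<le> 12 * norm (sqrt x)"
      using eventually_ge_at_top[of 0]
    proof eventually_elim
      case (elim x)
      then show ?case
        using six_biquadratic_count[OF elim] sum_two_part_pairs[of "F x"] by (simp add: E_def F_def)
    qed
  qed
  also have "(\<lambda>x. sqrt x) \<in> O[at_top](\<lambda>x. sqrt x * ln x)" by real_asymp
  finally have E: "E \<in> O[at_top](\<lambda>x. sqrt x * ln x)" .
  have "(\<lambda>x. 1 / 6 * (E x + (G x 1 + 3 * G x 4 + 6 * G x 8 + 6 * G x 16))) \<in> O[at_top](\<lambda>x. sqrt x * ln x)"
    using E G by (intro landau_o.big.cmult_in_iff[THEN iffD2] sum_in_bigo) auto
  moreover have "1 / 6 * (E x + (G x 1 + 3 * G x 4 + 6 * G x 8 + 6 * G x 16))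
      = real (biquadratic_count x) - 23 / 960 * sqrt x * (ln x)\<^sup>2 * (\<Prod>p. euler_factor p)" for x
    by (simp add: E_def G_def pair_density_def field_simps)
  ultimately have "(\<lambda>x. real (biquadratic_count x) - 23 / 960 * sqrt x * (ln x)\<^sup>2 * (\<Prod>p. euler_factor p))
      \<in> O[at_top](\<lambda>x. sqrt x * ln x)" by (simp only:)
  then show ?thesis unfolding euler_factor_def .
qed

end
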